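(* Let $n\ge 0$ and let $\mathcal{C}\subset G=SU(2)$ be a conjugacy class other than $\{\mathbf 1\}$ and $\{-\mathbf 1\}$. Then there is an isomorphism of $G$-spaces $$X_n(\mathcal{C})\cong G/T\times X_n^r,$$ where $G$ acts diagonally on the right-hand side (by left translation on $G/T$ and by conjugation on $X_n^r$). In particular $H_G^*(X_n(\mathcal{C}))\cong H_T^*(X_n^r)$.
   Context: $G=SU(2)$ with identity matrix $\mathbf 1$; $T\subset G$ is the maximal torus of diagonal matrices. For a conjugacy class $\mathcal{C}\subset G$, $X_n(\mathcal{C})=\{(g_0,\dots,g_n)\in G^{n+1}\mid \prod_{i=0}^n g_i^2\in\mathcal{C}\}$, with $G$ acting by simultaneous conjugation. $X_n^r:=X_n(\{(-\mathbf 1)^n\})$. Cohomology is with rational coefficients; $H_G$, $H_T$ denote Borel equivariant cohomology. *)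

theory Defs
  imports
    "HOL-Analysis.Analysis"
    "HOL-Algebra.Group_Action"
    "HOL-Algebra.Left_Coset"
    "HOL-Homology.Homology"
begin

section \<open>The group SU(2)\<close>

definition conj_transpose :: "complex^'n^'m \<Rightarrow> complex^'m^'n" where
  "conj_transpose A = (\<chi> i j. cnj (A $ j $ i))"

definition SU2 :: "(complex^2^2) monoid" where
  "SU2 = \<lparr>carrier = {A. A ** conj_transpose A = mat 1 \<and> det A = 1}, mult = (**), one = mat 1\<rparr>"

definition SU2_top :: "(complex^2^2) topology" where
  "SU2_top = top_of_set (carrier SU2)"

definition max_torus :: "(complex^2^2) set" where
  "max_torus = {A \<in> carrier SU2. \<forall>i j. i \<noteq> j \<longrightarrow> A $ i $ j = 0}"

abbreviation torus_group :: "(complex^2^2) monoid" where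
  "torus_group \<equiv> SU2\<lparr>carrier := max_torus\<rparr>"

definition conjugation :: "complex^2^2 \<Rightarrow> complex^2^2 \<Rightarrow> complex^2^2" where
  "conjugation g x = g \<otimes>\<^bsub>SU2\<^esub> x \<otimes>\<^bsub>SU2\<^esub> inv\<^bsub>SU2\<^esub> g"

definition conjugacy_classes :: "(complex^2^2) set set" where
  "conjugacy_classes = orbits SU2 (carrier SU2) conjugation"

lemma conj_transpose_mult:
  "conj_transpose (A ** B) = conj_transpose B ** conj_transpose (A :: complex^'n^'m)"
  by (simp add: conj_transpose_def matrix_matrix_mult_def vec_eq_iff mult.commute)

lemma conj_transpose_transpose [simp]: "conj_transpose (conj_transpose A) = A"
  by (simp add: conj_transpose_def vec_eq_iff)

lemma det_conj_transpose: "det (conj_transpose A) = cnj (det (A :: complex^2^2))"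
  by (simp add: det_2 conj_transpose_def mult.commute)

lemma group_SU2: "group SU2"
proof (rule groupI)
  fix x y assume "x \<in> carrier SU2" "y \<in> carrier SU2"
  then show "x \<otimes>\<^bsub>SU2\<^esub> y \<in> carrier SU2"
    by (simp add: SU2_def det_mul conj_transpose_mult)
      (metis matrix_mul_assoc matrix_mul_rid)
next
  have "conj_transpose (mat 1 :: complex^2^2) = mat 1"
    by (simp add: conj_transpose_def mat_def vec_eq_iff)
  then show "\<one>\<^bsub>SU2\<^esub> \<in> carrier SU2"
    by (simp add: SU2_def)
next
  fix x assume x: "x \<in> carrier SU2"
  then have "conj_transpose x ** x = mat 1"
    by (simp add: SU2_def matrix_left_right_inverse)
  with x show "\<exists>y\<in>carrier SU2. y \<otimes>\<^bsub>SU2\<^esub> x = \<one>\<^bsub>SU2\<^esub>"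
    by (intro bexI[of _ "conj_transpose x"]) (auto simp: SU2_def det_conj_transpose)
qed (auto simp: SU2_def matrix_mul_assoc)

lemma subgroup_max_torus: "subgroup max_torus SU2"
proof (rule group.subgroupI[OF group_SU2])
  have "mat 1 \<in> max_torus"
    using group.is_monoid[OF group_SU2, THEN monoid.one_closed]
    by (simp add: max_torus_def SU2_def mat_def)
  then show "max_torus \<noteq> {}" by blast
next
  fix x assume x: "x \<in> max_torus"
  then have xc: "x \<in> carrier SU2" by (simp add: max_torus_def)
  have cx: "conj_transpose x \<in> carrier SU2" "conj_transpose x \<otimes>\<^bsub>SU2\<^esub> x = \<one>\<^bsub>SU2\<^esub>"
  proof -
    have "conj_transpose x ** x = mat 1"
      using xc by (simp add: SU2_def matrix_left_right_inverse)
    then show "conj_transpose x \<in> carrier SU2" "conj_transpose x \<otimes>\<^bsub>SU2\<^esub> x = \<one>\<^bsub>SU2\<^esub>"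
      using xc by (simp_all add: SU2_def det_conj_transpose)
  qed
  then have "inv\<^bsub>SU2\<^esub> x = conj_transpose x"
    using group.inv_equality[OF group_SU2] xc by blast
  moreover have "\<forall>i j. i \<noteq> j \<longrightarrow> conj_transpose x $ i $ j = 0"
    using x by (auto simp: max_torus_def conj_transpose_def)
  ultimately show "inv\<^bsub>SU2\<^esub> x \<in> max_torus"
    using cx(1) by (simp add: max_torus_def)
next
  fix x y assume xy: "x \<in> max_torus" "y \<in> max_torus"
  then have "x \<otimes>\<^bsub>SU2\<^esub> y \<in> carrier SU2"
    using group.is_monoid[OF group_SU2, THEN monoid.m_closed, of x y] by (simp add: max_torus_def)
  moreover have "\<forall>i j. i \<noteq> j \<longrightarrow> (x \<otimes>\<^bsub>SU2\<^esub> y) $ i $ j = 0"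
    using xy by (simp add: max_torus_def forall_2) (simp add: SU2_def matrix_matrix_mult_def sum_2)
  ultimately show "x \<otimes>\<^bsub>SU2\<^esub> y \<in> max_torus"
    by (simp add: max_torus_def)
qed (auto simp: max_torus_def)

section \<open>Quotient spaces and equivariant homeomorphisms\<close>

definition quotient_topology :: "'a topology \<Rightarrow> ('a \<Rightarrow> 'b) \<Rightarrow> 'b topology" where
  "quotient_topology X q =
     topology (\<lambda>U. U \<subseteq> q ` topspace X \<and> openin X {x \<in> topspace X. q x \<in> U})"

lemma openin_quotient_topology:
  "openin (quotient_topology X q) U \<longleftrightarrow>
     U \<subseteq> q ` topspace X \<and> openin X {x \<in> topspace X. q x \<in> U}"
proof -
  have "istopology (\<lambda>U. U \<subseteq> q ` topspace X \<and> openin X {x \<in> topspace X. q x \<in> U})"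
    unfolding istopology_def
  proof (intro conjI allI impI)
    fix S T
    assume *: "S \<subseteq> q ` topspace X \<and> openin X {x \<in> topspace X. q x \<in> S}"
      "T \<subseteq> q ` topspace X \<and> openin X {x \<in> topspace X. q x \<in> T}"
    then show "S \<inter> T \<subseteq> q ` topspace X" by blast
    have "{x \<in> topspace X. q x \<in> S \<inter> T} =
        {x \<in> topspace X. q x \<in> S} \<inter> {x \<in> topspace X. q x \<in> T}" by blast
    with * show "openin X {x \<in> topspace X. q x \<in> S \<inter> T}" by (simp add: openin_Int)
  next
    fix \<K>
    assume *: "\<forall>K\<in>\<K>. K \<subseteq> q ` topspace X \<and> openin X {x \<in> topspace X. q x \<in> K}"
    then show "\<Union>\<K> \<subseteq> q ` topspace X" by blast
    have "{x \<in> topspace X. q x \<in> \<Union>\<K>} = (\<Union>K\<in>\<K>. {x \<in> topspace X. q x \<in> K})" by blast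
    with * show "openin X {x \<in> topspace X. q x \<in> \<Union>\<K>}" by auto
  qed
  then show ?thesis by (simp add: quotient_topology_def)
qed

lemma topspace_quotient_topology: "topspace (quotient_topology X q) = q ` topspace X"
proof -
  have "{x \<in> topspace X. q x \<in> q ` topspace X} = topspace X" by blast
  then have "openin (quotient_topology X q) (q ` topspace X)"
    by (simp add: openin_quotient_topology)
  then show ?thesis
    by (meson openin_quotient_topology openin_subset openin_topspace subset_antisym)
qed

lemma quotient_map_quotient_topology: "quotient_map X (quotient_topology X q) q"
  by (auto simp: quotient_map_def topspace_quotient_topology openin_quotient_topology)

definition equivariant_homeomorphic ::
  "('g, 'm) monoid_scheme \<Rightarrow> 'a topology \<Rightarrow> ('g \<Rightarrow> 'a \<Rightarrow> 'a) \<Rightarrow> 'b topology \<Rightarrow> ('g \<Rightarrow> 'b \<Rightarrow> 'b) \<Rightarrow> bool"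
  where
  "equivariant_homeomorphic G X \<alpha> Y \<beta> \<longleftrightarrow>
     (\<exists>f. homeomorphic_map X Y f \<and>
          (\<forall>g\<in>carrier G. \<forall>x\<in>topspace X. f (\<alpha> g x) = \<beta> g (f x)))"

definition diag_action :: "('g \<Rightarrow> 'a \<Rightarrow> 'a) \<Rightarrow> ('g \<Rightarrow> 'b \<Rightarrow> 'b) \<Rightarrow> 'g \<Rightarrow> 'a \<times> 'b \<Rightarrow> 'a \<times> 'b" where
  "diag_action \<alpha> \<beta> g z = (\<alpha> g (fst z), \<beta> g (snd z))"

definition G_mod_T :: "(complex^2^2) set topology" where
  "G_mod_T = quotient_topology SU2_top (\<lambda>g. g <#\<^bsub>SU2\<^esub> max_torus)"

definition left_translation :: "complex^2^2 \<Rightarrow> (complex^2^2) set \<Rightarrow> (complex^2^2) set" where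
  "left_translation g c = g <#\<^bsub>SU2\<^esub> c"

section \<open>The spaces \<open>X\<^sub>n(C)\<close>\<close>

definition square_word :: "nat \<Rightarrow> (nat \<Rightarrow> complex^2^2) \<Rightarrow> complex^2^2" where
  "square_word n g =
     foldr (mult SU2) (map (\<lambda>i. g i [^]\<^bsub>SU2\<^esub> (2::nat)) [0..<Suc n]) \<one>\<^bsub>SU2\<^esub>"

definition X_space :: "nat \<Rightarrow> (complex^2^2) set \<Rightarrow> (nat \<Rightarrow> complex^2^2) topology" where
  "X_space n C =
     subtopology (product_topology (\<lambda>_. SU2_top) {0..n}) {g. square_word n g \<in> C}"

definition Xr_space :: "nat \<Rightarrow> (nat \<Rightarrow> complex^2^2) topology" where
  "Xr_space n = X_space n {(- mat 1) [^]\<^bsub>SU2\<^esub> n}"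

definition simultaneous_conjugation ::
  "nat \<Rightarrow> complex^2^2 \<Rightarrow> (nat \<Rightarrow> complex^2^2) \<Rightarrow> nat \<Rightarrow> complex^2^2" where
  "simultaneous_conjugation n g x = (\<lambda>i\<in>{0..n}. conjugation g (x i))"

section \<open>Rational singular cohomology\<close>

text \<open>
  A rational \<open>p\<close>-cochain is determined by its values on the singular \<open>p\<close>-simplices; it is
  represented by a function that vanishes on everything that is not a singular \<open>p\<close>-simplex.
\<close>

type_synonym 'a cochain = "((nat \<Rightarrow> real) \<Rightarrow> 'a) \<Rightarrow> rat"

definition cochains :: "nat \<Rightarrow> 'a topology \<Rightarrow> 'a cochain set" where
  "cochains p X = {a. \<forall>\<sigma>. \<not> singular_simplex p X \<sigma> \<longrightarrow> a \<sigma> = 0}"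

definition coboundary :: "nat \<Rightarrow> 'a topology \<Rightarrow> 'a cochain \<Rightarrow> 'a cochain" where
  "coboundary p X a = (\<lambda>\<sigma>. if singular_simplex (Suc p) X \<sigma>
     then \<Sum>k\<le>Suc p. (-1) ^ k * a (singular_face (Suc p) k \<sigma>) else 0)"

definition cocycles :: "nat \<Rightarrow> 'a topology \<Rightarrow> 'a cochain set" where
  "cocycles p X = {a \<in> cochains p X. coboundary p X a = (\<lambda>\<sigma>. 0)}"

definition coboundaries :: "nat \<Rightarrow> 'a topology \<Rightarrow> 'a cochain set" where
  "coboundaries p X =
     (case p of 0 \<Rightarrow> {\<lambda>\<sigma>. 0} | Suc q \<Rightarrow> coboundary q X ` cochains q X)"

definition cohom_class :: "nat \<Rightarrow> 'a topology \<Rightarrow> 'a cochain \<Rightarrow> 'a cochain set" where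
  "cohom_class p X a = {b \<in> cocycles p X. (\<lambda>\<sigma>. b \<sigma> - a \<sigma>) \<in> coboundaries p X}"

definition cohomology :: "nat \<Rightarrow> 'a topology \<Rightarrow> 'a cochain set set" where
  "cohomology p X = cohom_class p X ` cocycles p X"

text \<open>The operations on classes are formed, as for factor rings, from all representatives.\<close>

definition cohom_add ::
  "nat \<Rightarrow> 'a topology \<Rightarrow> 'a cochain set \<Rightarrow> 'a cochain set \<Rightarrow> 'a cochain set" where
  "cohom_add p X A B = (\<Union>a\<in>A. \<Union>b\<in>B. cohom_class p X (\<lambda>\<sigma>. a \<sigma> + b \<sigma>))"

definition cohom_scale :: "nat \<Rightarrow> 'a topology \<Rightarrow> rat \<Rightarrow> 'a cochain set \<Rightarrow> 'a cochain set" where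
  "cohom_scale p X c A = (\<Union>a\<in>A. cohom_class p X (\<lambda>\<sigma>. c * a \<sigma>))"

definition front_face :: "nat \<Rightarrow> ((nat \<Rightarrow> real) \<Rightarrow> 'a) \<Rightarrow> (nat \<Rightarrow> real) \<Rightarrow> 'a" where
  "front_face p \<sigma> = restrict \<sigma> (standard_simplex p)"

definition back_face :: "nat \<Rightarrow> nat \<Rightarrow> ((nat \<Rightarrow> real) \<Rightarrow> 'a) \<Rightarrow> (nat \<Rightarrow> real) \<Rightarrow> 'a" where
  "back_face p q \<sigma> = (\<lambda>x\<in>standard_simplex q. \<sigma> (\<lambda>i. if i < p then 0 else x (i - p)))"

definition cup :: "nat \<Rightarrow> nat \<Rightarrow> 'a topology \<Rightarrow> 'a cochain \<Rightarrow> 'a cochain \<Rightarrow> 'a cochain" where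
  "cup p q X a b = (\<lambda>\<sigma>. if singular_simplex (p + q) X \<sigma>
     then a (front_face p \<sigma>) * b (back_face p q \<sigma>) else 0)"

definition cohom_cup ::
  "nat \<Rightarrow> nat \<Rightarrow> 'a topology \<Rightarrow> 'a cochain set \<Rightarrow> 'a cochain set \<Rightarrow> 'a cochain set" where
  "cohom_cup p q X A B = (\<Union>a\<in>A. \<Union>b\<in>B. cohom_class (p + q) X (cup p q X a b))"

definition cohom_one :: "'a topology \<Rightarrow> 'a cochain set" where
  "cohom_one X = cohom_class 0 X (\<lambda>\<sigma>. if singular_simplex 0 X \<sigma> then 1 else 0)"

definition cohomology_isomorphic :: "'a topology \<Rightarrow> 'b topology \<Rightarrow> bool" where
  "cohomology_isomorphic X Y \<longleftrightarrow>
     (\<exists>\<Phi> :: nat \<Rightarrow> 'a cochain set \<Rightarrow> 'b cochain set.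
        (\<forall>p. bij_betw (\<Phi> p) (cohomology p X) (cohomology p Y)) \<and>
        (\<forall>p. \<forall>A\<in>cohomology p X. \<forall>B\<in>cohomology p X.
           \<Phi> p (cohom_add p X A B) = cohom_add p Y (\<Phi> p A) (\<Phi> p B)) \<and>
        (\<forall>p c. \<forall>A\<in>cohomology p X.
           \<Phi> p (cohom_scale p X c A) = cohom_scale p Y c (\<Phi> p A)) \<and>
        (\<forall>p q. \<forall>A\<in>cohomology p X. \<forall>B\<in>cohomology q X.
           \<Phi> (p + q) (cohom_cup p q X A B) = cohom_cup p q Y (\<Phi> p A) (\<Phi> q B)) \<and>
        \<Phi> 0 (cohom_one X) = cohom_one Y)"

section \<open>The Borel construction\<close>

text \<open>
  The model of \<open>EG\<close> for \<open>G = SU(2)\<close> is the unit sphere of the Hilbert sum of countably many copies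
  of the standard representation on \<open>\<complex>\<^sup>2\<close>. On the unit sphere the product topology of
  coordinatewise convergence coincides with the norm topology, so the space is metrizable; it is
  contractible and \<open>G\<close>, a compact Lie group, acts freely and continuously on it, so that
  \<open>EG \<rightarrow> EG/G\<close> is a universal principal bundle.  By restricting the action the same space serves as
  \<open>EH\<close> for every closed subgroup \<open>H\<close>, in particular for the maximal torus.
\<close>

definition EG_set :: "(nat \<Rightarrow> complex^2) set" where
  "EG_set = {v. (\<lambda>i. (norm (v i))\<^sup>2) sums 1}"

definition EG :: "(nat \<Rightarrow> complex^2) topology" where
  "EG = top_of_set EG_set"

definition EG_action :: "complex^2^2 \<Rightarrow> (nat \<Rightarrow> complex^2) \<Rightarrow> nat \<Rightarrow> complex^2" where
  "EG_action g v = (\<lambda>i. g *v v i)"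

lemma SU2_entries:
  assumes "A \<in> carrier SU2"
  shows "A $ 2 $ 2 = cnj (A $ 1 $ 1)" "A $ 2 $ 1 = - cnj (A $ 1 $ 2)"
    "A $ 1 $ 1 * cnj (A $ 1 $ 1) + A $ 1 $ 2 * cnj (A $ 1 $ 2) = 1"
proof -
  obtain a b c d where e: "A $ 1 $ 1 = a" "A $ 1 $ 2 = b" "A $ 2 $ 1 = c" "A $ 2 $ 2 = d" by simp
  have u: "A ** conj_transpose A = mat 1" and det: "a * d - b * c = 1"
    using assms by (auto simp: SU2_def det_2 e)
  have "(A ** conj_transpose A) $ i $ j = (if i = j then 1 else 0)" for i j
    by (simp add: u mat_def)
  from this[of 1 1] this[of 2 1]
  have 1: "a * cnj a + b * cnj b = 1" and 2: "c * cnj a + d * cnj b = 0"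
    by (simp_all add: matrix_matrix_mult_def conj_transpose_def sum_2 e)
  have "cnj a = cnj a * (a * d - b * c)" by (simp add: det)
  also have "\<dots> = d * (a * cnj a + b * cnj b) - b * (c * cnj a + d * cnj b)"
    by (simp add: algebra_simps)
  finally have d: "d = cnj a" by (simp add: 1 2)
  have "- cnj b = - cnj b * (a * d - b * c)" by (simp add: det)
  also have "\<dots> = c * (a * cnj a + b * cnj b) - a * (c * cnj a + d * cnj b)"
    by (simp add: algebra_simps)
  finally have "c = - cnj b" by (simp add: 1 2)
  with d 1 show "A $ 2 $ 2 = cnj (A $ 1 $ 1)" "A $ 2 $ 1 = - cnj (A $ 1 $ 2)"
    "A $ 1 $ 1 * cnj (A $ 1 $ 1) + A $ 1 $ 2 * cnj (A $ 1 $ 2) = 1"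
    by (simp_all add: e)
qed

lemma norm_SU2_mult:
  assumes "A \<in> carrier SU2"
  shows "norm (A *v w) = norm w"
proof -
  have n: "complex_of_real ((norm x)\<^sup>2) = x $ 1 * cnj (x $ 1) + x $ 2 * cnj (x $ 2)" for x :: "complex^2"
    by (simp add: norm_vec_def L2_set_def sum_2 complex_norm_square flip: of_real_power)
  obtain a b where e: "A $ 1 $ 1 = a" "A $ 1 $ 2 = b" by simp
  note s = SU2_entries[OF assms, unfolded e]
  have "complex_of_real ((norm (A *v w))\<^sup>2) =
     (a * cnj a + b * cnj b) * (w $ 1 * cnj (w $ 1) + w $ 2 * cnj (w $ 2))"
    unfolding n by (simp add: matrix_vector_mult_def sum_2 e s(1,2)) (simp add: algebra_simps)
  then have "complex_of_real ((norm (A *v w))\<^sup>2) = complex_of_real ((norm w)\<^sup>2)"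
    by (simp only: s(3) n mult_1)
  then show ?thesis by (simp only: of_real_eq_iff power2_eq_iff_nonneg norm_ge_zero)
qed

lemma EG_action_closed: "g \<in> carrier SU2 \<Longrightarrow> v \<in> EG_set \<Longrightarrow> EG_action g v \<in> EG_set"
  by (simp add: EG_set_def EG_action_def norm_SU2_mult)

lemma EG_action_free:
  assumes "g \<in> carrier SU2" "v \<in> EG_set" "EG_action g v = v"
  shows "g = mat 1"
proof -
  have "\<exists>i. v i \<noteq> 0"
  proof (rule ccontr)
    assume "\<not> ?thesis"
    then have "(\<lambda>_::nat. 0::real) sums 1" using assms(2) by (simp add: EG_set_def)
    then show False using sums_unique2[OF _ sums_zero] by fastforce
  qed
  then obtain w where w: "w \<noteq> 0" "g *v w = w"
    using assms(3) by (metis EG_action_def)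
  obtain a b x y where e: "g $ 1 $ 1 = a" "g $ 1 $ 2 = b" "w $ 1 = x" "w $ 2 = y" by simp
  note s = SU2_entries[OF assms(1), unfolded e]
  from w(2) have "(g *v w) $ 1 = x" "(g *v w) $ 2 = y" by (simp_all add: e)
  then have eq: "a * x + b * y = x" "- cnj b * x + cnj a * y = y"
    by (simp_all add: matrix_vector_mult_def sum_2 e s)
  have k: "(2 - a - cnj a) * x = 0" "(2 - a - cnj a) * y = 0"
  proof -
    have d: "2 - a - cnj a = (1 - a) * (1 - cnj a) + b * cnj b"
      using s(3) by (simp add: algebra_simps)
    have 1: "(1 - a) * x = b * y" "(1 - cnj a) * y = - (cnj b * x)"
      using eq by (simp_all add: algebra_simps)
    have "(2 - a - cnj a) * x = (1 - cnj a) * ((1 - a) * x) + b * (cnj b * x)"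
      unfolding d by (simp add: algebra_simps)
    also have "\<dots> = b * ((1 - cnj a) * y) + b * (cnj b * x)"
      by (simp only: 1(1) mult.left_commute)
    also have "\<dots> = 0" by (simp only: 1(2)) simp
    finally show "(2 - a - cnj a) * x = 0" .
    have "(2 - a - cnj a) * y = (1 - a) * ((1 - cnj a) * y) + cnj b * (b * y)"
      unfolding d by (simp add: algebra_simps)
    also have "\<dots> = - (cnj b * ((1 - a) * x)) + cnj b * (b * y)"
      by (simp only: 1(2) mult_minus_right mult.left_commute)
    also have "\<dots> = 0" by (simp only: 1(1)) simp
    finally show "(2 - a - cnj a) * y = 0" .
  qed
  have "x \<noteq> 0 \<or> y \<noteq> 0" using w(1) e by (auto simp: vec_eq_iff forall_2)
  with k have "2 - a - cnj a = 0" by auto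
  then have re: "Re a = 1" by (simp add: complex_eq_iff)
  have "(Re a)\<^sup>2 + (Im a)\<^sup>2 + ((Re b)\<^sup>2 + (Im b)\<^sup>2) = 1"
    using s(3) by (simp add: complex_eq_iff power2_eq_square)
  then have "a = 1" "b = 0"
    using re by (auto simp: complex_eq_iff sum_power2_eq_zero_iff add_nonneg_eq_0_iff)
  then show ?thesis by (simp add: vec_eq_iff forall_2 mat_def e s)
qed

lemma contractible_EG: "contractible_space EG"
proof -
  define h where "h i t = max 0 (min 1 (real (i+1) * real (i+2) * t - real (i+1))) * (pi/2)" for i :: nat and t :: real
  define U where "U z i = cos (h i (fst z)) *\<^sub>R snd z i +
      (if i = 0 then 0 else sin (h (i-1) (fst z)) *\<^sub>R snd z (i-1))" for z :: "real \<times> (nat \<Rightarrow> complex^2)" and i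
  define e where "e i = (if i = 0 then axis 1 1 else 0 :: complex^2)" for i :: nat
  define S where "S v i = (if i = 0 then 0 else v (i-1))" for v :: "nat \<Rightarrow> complex^2" and i
  define V where "V z i = (if i = 0 then sin (fst z * (pi/2)) *\<^sub>R axis 1 1
      else cos (fst z * (pi/2)) *\<^sub>R snd z (i-1))" for z :: "real \<times> (nat \<Rightarrow> complex^2)" and i
  have shift: "(\<lambda>i. if i = 0 then c else f (i-1)) sums (s + c)" if "f sums s" for f :: "nat \<Rightarrow> real" and s c
    using that sums_Suc_iff[of "\<lambda>i. if i = 0 then c else f (i-1)" s] by simp
  have U_in: "U (t, v) \<in> EG_set" if "v \<in> EG_set" "t \<in> {0..1}" for t v
  proof -
    have v: "(\<lambda>i. (norm (v i))\<^sup>2) sums 1" using that by (simp add: EG_set_def)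
    have cs: "(cos (h i t))\<^sup>2 + (sin (h i t))\<^sup>2 = 1" for i by simp
    define f where "f i = (cos (h i t))\<^sup>2 * (norm (v i))\<^sup>2" for i
    define g where "g i = (sin (h i t))\<^sup>2 * (norm (v i))\<^sup>2" for i
    have fg: "f i + g i = (norm (v i))\<^sup>2" for i
      by (simp only: f_def g_def flip: distrib_right) simp
    have sf: "summable f" "summable g"
      by (rule summable_comparison_test'[OF sums_summable[OF v], of 0],
          simp add: f_def g_def abs_mult mult_left_le_one_le power_le_one abs_square_le_1)+
    have "(\<lambda>i. if i = 0 then 0 else g (i-1)) sums (suminf g + 0)"
      by (rule shift) (use sf in \<open>simp add: summable_sums\<close>)
    then have "(\<lambda>i. f i + (if i = 0 then 0 else g (i-1))) sums (suminf f + (suminf g + 0))"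
      using sf by (intro sums_add summable_sums)
    moreover have "suminf f + (suminf g + 0) = 1"
      using sums_add[OF summable_sums[OF sf(1)] summable_sums[OF sf(2)]] v
      by (simp add: fg sums_unique2)
    moreover have "(norm (U (t,v) i))\<^sup>2 = f i + (if i = 0 then 0 else g (i-1))" for i
    proof (cases i)
      case 0 then show ?thesis by (simp add: U_def f_def power_mult_distrib)
    next
      case (Suc j)
      show ?thesis
      proof (cases "real (j+1) * real (j+2) * t - real (j+1) \<le> 0")
        case True
        then have "max 0 (min 1 (real (j+1) * real (j+2) * t - real (j+1))) = 0" by linarith
        then have "h j t = 0" by (simp only: h_def mult_zero_left)
        then show ?thesis by (simp add: Suc U_def f_def g_def power_mult_distrib)
      next
        case False
        then have "real (j+1) * (real (j+2) * t - 1) > 0" by (simp add: algebra_simps)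
        then have "real (j+2) * t > 1" by (simp add: zero_less_mult_iff)
        then have "real (j+3) * (real (j+2) * t) \<ge> real (j+3) * 1"
          by (intro mult_left_mono) (auto simp: mult.commute)
        then have "real (Suc j+1) * real (Suc j+2) * t - real (Suc j+1) \<ge> 1"
          by (simp add: algebra_simps)
        then have "max 0 (min 1 (real (Suc j+1) * real (Suc j+2) * t - real (Suc j+1))) = 1" by linarith
        then have "h (Suc j) t = pi/2" by (simp only: h_def mult_1_left)
        then have "cos (h (Suc j) t) = 0" by (simp only: cos_pi_half)
        then show ?thesis by (simp add: Suc U_def f_def g_def power_mult_distrib)
      qed
    qed
    ultimately show ?thesis by (simp add: EG_set_def)
  qed
  have nax: "norm (axis 1 1 :: complex^2) = 1"
    by (simp add: norm_vec_def L2_set_def axis_def sum_2)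
  have V_in: "V (t, v) \<in> EG_set" if "v \<in> EG_set" for t v
  proof -
    have "(\<lambda>i. (norm (v i))\<^sup>2) sums 1" using that by (simp add: EG_set_def)
    from shift[OF sums_mult[OF this, of "(cos (t * (pi/2)))\<^sup>2"], of "(sin (t * (pi/2)))\<^sup>2"]
    have "(\<lambda>i. if i = 0 then (sin (t * (pi/2)))\<^sup>2 else (cos (t * (pi/2)))\<^sup>2 * (norm (v (i-1)))\<^sup>2) sums 1"
      by simp
    moreover have "(norm (V (t,v) i))\<^sup>2 =
        (if i = 0 then (sin (t * (pi/2)))\<^sup>2 else (cos (t * (pi/2)))\<^sup>2 * (norm (v (i-1)))\<^sup>2)" for i
      by (simp add: V_def power_mult_distrib nax)
    ultimately show ?thesis by (simp add: EG_set_def)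
  qed
  have coord: "continuous_on W (\<lambda>z. snd z i)" for W :: "(real \<times> (nat \<Rightarrow> complex^2)) set" and i
    by (rule continuous_on_product_then_coordinatewise) (intro continuous_intros)
  have h0: "h i 0 = 0" for i by (simp add: h_def)
  have h1: "cos (h i 1) = 0" "sin (h i 1) = 1" for i
  proof -
    have "1 * 1 \<le> real (i+1) * real (i+1)" by (intro mult_mono) auto
    then have "max 0 (min 1 (real (i+1) * real (i+2) * 1 - real (i+1))) = 1"
      by (simp add: algebra_simps)
    then have "h i 1 = pi/2" by (simp only: h_def mult_1_left)
    then show "cos (h i 1) = 0" "sin (h i 1) = 1" by (simp_all only: cos_pi_half sin_pi_half)
  qed
  have hc: "continuous_on W (\<lambda>z. h i (fst z))" for W :: "(real \<times> (nat \<Rightarrow> complex^2)) set" and i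
    unfolding h_def by (intro continuous_intros)
  have "homotopic_with_canon (\<lambda>_. True) EG_set EG_set id S"
  proof (simp add: homotopic_with, rule exI[of _ U], intro conjI ballI)
    show "continuous_on ({0..1} \<times> EG_set) U"
    proof (rule continuous_on_coordinatewise_then_product)
      fix i show "continuous_on ({0..1} \<times> EG_set) (\<lambda>z. U z i)"
        by (cases "i = 0"; simp add: U_def; intro continuous_intros hc coord)
    qed
    show "U \<in> {0..1} \<times> EG_set \<rightarrow> EG_set" using U_in by auto
  qed (auto simp: U_def S_def h0 h1 fun_eq_iff)
  moreover have "homotopic_with_canon (\<lambda>_. True) EG_set EG_set S (\<lambda>_. e)"
  proof (simp add: homotopic_with, rule exI[of _ V], intro conjI ballI)
    show "continuous_on ({0..1} \<times> EG_set) V"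
    proof (rule continuous_on_coordinatewise_then_product)
      fix i show "continuous_on ({0..1} \<times> EG_set) (\<lambda>z. V z i)"
        by (cases "i = 0"; simp add: V_def; intro continuous_intros coord) auto
    qed
    show "V \<in> {0..1} \<times> EG_set \<rightarrow> EG_set" using V_in by auto
  qed (auto simp: V_def S_def e_def fun_eq_iff)
  ultimately have "homotopic_with_canon (\<lambda>_. True) EG_set EG_set id (\<lambda>_. e)"
    by (rule homotopic_with_trans)
  then show ?thesis unfolding contractible_space_def EG_def by blast
qed

definition borel_construction ::
  "(complex^2^2) monoid \<Rightarrow> 'a topology \<Rightarrow> (complex^2^2 \<Rightarrow> 'a \<Rightarrow> 'a) \<Rightarrow>
     ((nat \<Rightarrow> complex^2) \<times> 'a) set topology" where
  "borel_construction H X \<alpha> =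
     quotient_topology (prod_topology EG X) (orbit H (diag_action EG_action \<alpha>))"

definition equivariant_cohomology_isomorphic ::
  "(complex^2^2) monoid \<Rightarrow> 'a topology \<Rightarrow> (complex^2^2 \<Rightarrow> 'a \<Rightarrow> 'a) \<Rightarrow>
   (complex^2^2) monoid \<Rightarrow> 'b topology \<Rightarrow> (complex^2^2 \<Rightarrow> 'b \<Rightarrow> 'b) \<Rightarrow> bool" where
  "equivariant_cohomology_isomorphic H X \<alpha> K Y \<beta> \<longleftrightarrow>
     cohomology_isomorphic (borel_construction H X \<alpha>) (borel_construction K Y \<beta>)"

end

theory Submission
  imports Defs
begin

text \<open>
  Write \<open>\<mu>(g) = \<Prod> g\<^sub>i\<^sup>2\<close> and \<open>\<tau>\<^sub>i = Re (tr g\<^sub>i) / 2\<close>. For a unit imaginary \<open>u\<close>, there is a polynomial vector field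
  on \<open>G\<^sup>n\<^sup>+\<^sup>1\<close> along which \<open>\<mu>\<close> moves with velocity \<open>(\<Sum> \<tau>\<^sub>i\<^sup>2) u \<mu>\<close>, and it is equivariant under the centralizer
  of \<open>u\<close>. The speed vanishes only where all \<open>\<tau>\<^sub>i\<close> do, and there \<open>\<mu> = (-1)\<^sup>n\<^sup>+\<^sup>1\<close>. So, normalizing the speed, the flow
  carries the fibre of \<open>\<mu>\<close> over any \<open>t \<in> T\<close> other than \<open>\<plusminus> 1\<close> along the arc of \<open>T\<close> avoiding \<open>(-1)\<^sup>n\<^sup>+\<^sup>1\<close>
  to the fibre over \<open>(-1)\<^sup>n\<close>, \<open>T\<close>-equivariantly. As the centralizer of \<open>t\<close> is \<open>T\<close> and \<open>(-1)\<^sup>n\<close> is central, this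
  induces the isomorphism of \<open>G\<close>-spaces. The Borel constructions are compared by presenting both as quotients
  of \<open>EG \<times> G \<times> X\<^sub>n\<^sup>r\<close> with the same fibres.
\<close>

section \<open>Homeomorphism invariance of cohomology\<close>

text \<open>Moving A with velocity \<xi> A moves A^2 with velocity (\<xi> + A \<xi> A^-1) A^2, and 1
  + Ad A is singular on the Lie algebra exactly where \<tau>, half the trace of A, vanishes. On
  SU(2) already \<tau> (1 + Ad A)^-1 is polynomial; a second factor \<tau> turns each contribution
  into the square \<tau>^2, so that contributions cannot cancel. Dividing by the total speed would
  destroy the Lipschitz bound near the critical points. The divisor is therefore cut off below at a
  constant \<open>d\<close>, and a quantitative form of the remark on critical points shows that the
  cutoff never acts on the arc in use. The flow is composed of short pieces, for which the
  contraction principle suffices. Their length is uniform because the bounds on the field do not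
  depend on the starting point. In the Borel construction the factor \<open>EG\<close> is not
  locally compact, so that taking products with it need not preserve quotient maps. The map from G x
  X_n^r onto X_n(C) is therefore shown to be perfect, by compactness, and this survives the
  product.\<close>

definition cochain_map ::
  "nat \<Rightarrow> 'b topology \<Rightarrow> ('b \<Rightarrow> 'a) \<Rightarrow> 'a cochain \<Rightarrow> 'b cochain" where
  "cochain_map p Y g a = (\<lambda>\<sigma>. if singular_simplex p Y \<sigma> then a (simplex_map p g \<sigma>) else 0)"

lemma cochain_map_in_cochains: "cochain_map p Y g a \<in> cochains p Y"
  by (simp add: cochain_map_def cochains_def)

lemma singular_face_simplex_map_commute:
  assumes "singular_simplex (Suc p) Y \<sigma>" "k \<le> Suc p"
  shows "singular_face (Suc p) k (simplex_map (Suc p) g \<sigma>) = simplex_map p g (singular_face (Suc p) k \<sigma>)"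
proof -
  have "\<forall>x\<in>standard_simplex p. simplical_face k x \<in> standard_simplex (Suc p)"
    using simplical_face_in_standard_simplex[of "Suc p" k] assms by simp
  then show ?thesis
    by (auto simp: singular_face_def simplex_map_def fun_eq_iff)
qed

lemma coboundary_cochain_map:
  assumes "continuous_map Y X g"
  shows "coboundary p Y (cochain_map p Y g a) = cochain_map (Suc p) Y g (coboundary p X a)"
proof
  fix \<sigma>
  show "coboundary p Y (cochain_map p Y g a) \<sigma> = cochain_map (Suc p) Y g (coboundary p X a) \<sigma>"
  proof (cases "singular_simplex (Suc p) Y \<sigma>")
    case True
    have "singular_simplex p Y (singular_face (Suc p) k \<sigma>)" if "k \<le> Suc p" for k
      using singular_simplex_singular_face[OF True, of k] that by simp
    then show ?thesis
      using True singular_simplex_simplex_map[OF True assms]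
      by (simp add: coboundary_def cochain_map_def singular_face_simplex_map_commute del: sum.atMost_Suc)
  qed (simp add: coboundary_def cochain_map_def)
qed

text \<open>\<open>cochain_map\<close> returns 0 off singular simplices, so naturality needs the
  front and back faces of a simplex of \<open>Y\<close> to be singular simplices themselves; the
  work lies in the two face inclusions.\<close>

lemma cup_cochain_map:
  assumes "continuous_map Y X g"
  shows "cup p q Y (cochain_map p Y g a) (cochain_map q Y g b) = cochain_map (p + q) Y g (cup p q X a b)"
proof
  fix \<sigma>
  show "cup p q Y (cochain_map p Y g a) (cochain_map q Y g b) \<sigma>
      = cochain_map (p + q) Y g (cup p q X a b) \<sigma>"
  proof (cases "singular_simplex (p + q) Y \<sigma>")
    case True
    have front: "standard_simplex p \<subseteq> standard_simplex (p + q)"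
    proof
      fix x assume x: "x \<in> standard_simplex p"
      then have "(\<Sum>i\<le>p + q. x i) = (\<Sum>i\<le>p. x i)"
        by (intro sum.mono_neutral_right) (auto simp: standard_simplex_def)
      with x show "x \<in> standard_simplex (p + q)" by (auto simp: standard_simplex_def)
    qed
    have bk: "(\<lambda>i. if i < p then 0 else x (i - p)) \<in> standard_simplex (p + q)"
      if "x \<in> standard_simplex q" for x
    proof -
      have "(\<Sum>i\<le>p + q. if i < p then 0 else x (i - p)) = (\<Sum>i\<in>{p..p + q}. x (i - p))"
        by (rule sum.mono_neutral_cong_right) auto
      also have "\<dots> = (\<Sum>i\<le>q. x i)"
        by (rule sum.reindex_bij_witness[of _ "\<lambda>i. i + p" "\<lambda>i. i - p"]) auto
      finally show ?thesis using that by (auto simp: standard_simplex_def)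
    qed
    have cback: "continuous_map (subtopology (powertop_real UNIV) (standard_simplex q))
        (subtopology (powertop_real UNIV) (standard_simplex (p + q)))
        (\<lambda>x i. if i < p then 0 else x (i - p))"
      using bk
      by (auto simp: continuous_map_in_subtopology continuous_map_componentwise_UNIV
          intro!: continuous_map_from_subtopology continuous_map_product_projection)
    have s: "singular_simplex p Y (front_face p \<sigma>)" "singular_simplex q Y (back_face p q \<sigma>)"
    proof -
      have c: "continuous_map (subtopology (powertop_real UNIV) (standard_simplex (p + q))) Y \<sigma>"
        using True by (simp add: singular_simplex_def)
      have "continuous_map (subtopology (powertop_real UNIV) (standard_simplex p)) Y \<sigma>"
        using continuous_map_from_subtopology_mono[OF c front] .
      then show "singular_simplex p Y (front_face p \<sigma>)"
        by (auto simp: singular_simplex_def front_face_def elim: continuous_map_eq)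
      show "singular_simplex q Y (back_face p q \<sigma>)"
        using continuous_map_compose[OF cback c]
        by (auto simp: singular_simplex_def back_face_def elim: continuous_map_eq)
    qed
    have "front_face p (simplex_map (p + q) g \<sigma>) = simplex_map p g (front_face p \<sigma>)"
      using front by (auto simp: front_face_def simplex_map_def fun_eq_iff)
    moreover have "back_face p q (simplex_map (p + q) g \<sigma>) = simplex_map q g (back_face p q \<sigma>)"
      using bk by (auto simp: back_face_def simplex_map_def fun_eq_iff)
    ultimately show ?thesis
      using True singular_simplex_simplex_map[OF True assms] s
      by (simp add: cup_def cochain_map_def)
  qed (simp add: cup_def cochain_map_def)
qed

lemma cochain_map_inverse:
  assumes "homeomorphic_maps X Y f g" "a \<in> cochains p X"
  shows "cochain_map p X f (cochain_map p Y g a) = a"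
proof
  fix \<sigma>
  have f: "continuous_map X Y f" and gf: "\<And>x. x \<in> topspace X \<Longrightarrow> g (f x) = x"
    using assms(1) by (auto simp: homeomorphic_maps_def)
  show "cochain_map p X f (cochain_map p Y g a) \<sigma> = a \<sigma>"
  proof (cases "singular_simplex p X \<sigma>")
    case True
    have "simplex_map p g (simplex_map p f \<sigma>) = simplex_map p (g \<circ> f) \<sigma>"
      by (simp add: simplex_map_compose)
    also have "\<dots> = \<sigma>"
      by (rule simplex_map_id_gen[OF True]) (simp add: gf)
    finally show ?thesis
      using True singular_simplex_simplex_map[OF True f] by (simp add: cochain_map_def)
  qed (use assms(2) in \<open>simp add: cochain_map_def cochains_def\<close>)
qed

lemma cochain_map_cocycles:
  assumes "continuous_map Y X g" "a \<in> cocycles p X"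
  shows "cochain_map p Y g a \<in> cocycles p Y"
  using assms
  by (auto simp: cocycles_def cochain_map_in_cochains coboundary_cochain_map) (simp add: cochain_map_def)

lemma cochain_map_coboundaries:
  assumes "continuous_map Y X g" "a \<in> coboundaries p X"
  shows "cochain_map p Y g a \<in> coboundaries p Y"
proof (cases p)
  case 0
  then show ?thesis using assms by (simp add: coboundaries_def cochain_map_def fun_eq_iff)
next
  case (Suc q)
  then obtain b where "a = coboundary q X b" using assms by (auto simp: coboundaries_def)
  then have "cochain_map p Y g a = coboundary q Y (cochain_map q Y g b)"
    by (simp add: Suc coboundary_cochain_map[OF assms(1)])
  then show ?thesis by (simp add: Suc coboundaries_def cochain_map_in_cochains)
qed

lemma cochain_map_diff:
  "(\<lambda>\<sigma>. cochain_map p Y g a \<sigma> - cochain_map p Y g b \<sigma>) = cochain_map p Y g (\<lambda>\<sigma>. a \<sigma> - b \<sigma>)"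
  by (auto simp: cochain_map_def)

lemma cocycles_cochains: "a \<in> cocycles p X \<Longrightarrow> a \<in> cochains p X"
  by (simp add: cocycles_def)

text \<open>A class is the set of all its representatives, and the induced map takes the image of
  that set. For a merely continuous \<open>g\<close> this could be a proper subset of a class;
  pulling back along the inverse \<open>f\<close> shows that it is all of it.\<close>

lemma cochain_map_cohom_class:
  assumes h: "homeomorphic_maps X Y f g" and a: "a \<in> cochains p X"
  shows "cochain_map p Y g ` cohom_class p X a = cohom_class p Y (cochain_map p Y g a)"
proof -
  have f: "continuous_map X Y f" and g: "continuous_map Y X g" and h': "homeomorphic_maps Y X g f"
    using h by (auto simp: homeomorphic_maps_def)
  show ?thesis
  proof (intro subset_antisym subsetI)
    fix c assume "c \<in> cochain_map p Y g ` cohom_class p X a"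
    then obtain b where b: "b \<in> cocycles p X" "(\<lambda>\<sigma>. b \<sigma> - a \<sigma>) \<in> coboundaries p X"
      "c = cochain_map p Y g b" by (auto simp: cohom_class_def)
    then show "c \<in> cohom_class p Y (cochain_map p Y g a)"
      using cochain_map_cocycles[OF g] cochain_map_coboundaries[OF g b(2)]
      by (simp add: cohom_class_def cochain_map_diff)
  next
    fix c assume "c \<in> cohom_class p Y (cochain_map p Y g a)"
    then have c: "c \<in> cocycles p Y" "(\<lambda>\<sigma>. c \<sigma> - cochain_map p Y g a \<sigma>) \<in> coboundaries p Y"
      by (auto simp: cohom_class_def)
    have "(\<lambda>\<sigma>. cochain_map p X f c \<sigma> - a \<sigma>) \<in> coboundaries p X"
      using cochain_map_coboundaries[OF f c(2)] cochain_map_inverse[OF h a]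
      by (simp flip: cochain_map_diff)
    then have "cochain_map p X f c \<in> cohom_class p X a"
      using cochain_map_cocycles[OF f c(1)] by (simp add: cohom_class_def)
    then show "c \<in> cochain_map p Y g ` cohom_class p X a"
      using cochain_map_inverse[OF h' cocycles_cochains[OF c(1)]] by (metis imageI)
  qed
qed

lemma cohom_class_subset: "cohom_class p X a \<subseteq> cocycles p X"
  by (auto simp: cohom_class_def)

text \<open>The operations on classes are unions over all representatives, and images commute with
  unions, so each compatibility of \<open>F\<close> reduces to one between cochains.\<close>

lemma homeomorphic_imp_cohomology_isomorphic:
  assumes "X homeomorphic_space Y"
  shows "cohomology_isomorphic X Y"
proof -
  obtain f g where h: "homeomorphic_maps X Y f g"
    using assms by (auto simp: homeomorphic_space_def)
  then have f: "continuous_map X Y f" and g: "continuous_map Y X g" and h': "homeomorphic_maps Y X g f"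
    by (auto simp: homeomorphic_maps_def)
  define F where "F p = image (cochain_map p Y g)" for p
  have F_class: "F p (cohom_class p X a) = cohom_class p Y (cochain_map p Y g a)"
    if "a \<in> cochains p X" for p a
    unfolding F_def by (rule cochain_map_cohom_class[OF h that])
  have coch: "a \<in> cochains p X" if "a \<in> A" "A \<in> cohomology p X" for a A p
    using that cohom_class_subset cocycles_cochains by (fastforce simp: cohomology_def)
  show ?thesis
    unfolding cohomology_isomorphic_def
  proof (rule exI[of _ F], intro conjI allI ballI)
    fix p
    have inv: "image (cochain_map p X f) (F p A) = A" if "A \<in> cohomology p X" for A
    proof -
      have "cochain_map p X f (cochain_map p Y g a) = a" if "a \<in> A" for a
        using cochain_map_inverse[OF h coch[OF that \<open>A \<in> cohomology p X\<close>]] .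
      then show ?thesis by (simp add: F_def image_image)
    qed
    show "bij_betw (F p) (cohomology p X) (cohomology p Y)"
      unfolding bij_betw_def
    proof
      show "inj_on (F p) (cohomology p X)" using inv by (metis inj_onI)
      show "F p ` cohomology p X = cohomology p Y"
      proof (intro subset_antisym subsetI)
        fix B assume "B \<in> F p ` cohomology p X"
        then show "B \<in> cohomology p Y"
          using F_class cochain_map_cocycles[OF g] cocycles_cochains by (fastforce simp: cohomology_def)
      next
        fix B assume "B \<in> cohomology p Y"
        then obtain b where b: "b \<in> cocycles p Y" "B = cohom_class p Y b" by (auto simp: cohomology_def)
        then have "B = F p (cohom_class p X (cochain_map p X f b))"
          by (simp add: F_class cochain_map_in_cochains cochain_map_inverse[OF h'] cocycles_cochains)
        then show "B \<in> F p ` cohomology p X"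
          using cochain_map_cocycles[OF f b(1)] by (auto simp: cohomology_def)
      qed
    qed
  next
    fix p A B assume AB: "A \<in> cohomology p X" "B \<in> cohomology p X"
    have "F p (cohom_class p X (\<lambda>\<sigma>. a \<sigma> + b \<sigma>))
        = cohom_class p Y (\<lambda>\<sigma>. cochain_map p Y g a \<sigma> + cochain_map p Y g b \<sigma>)"
      if "a \<in> A" "b \<in> B" for a b
    proof -
      have "(\<lambda>\<sigma>. a \<sigma> + b \<sigma>) \<in> cochains p X"
        using coch[OF that(1) AB(1)] coch[OF that(2) AB(2)] by (simp add: cochains_def)
      then show ?thesis
        by (simp add: F_class) (simp add: cochain_map_def fun_eq_iff if_distrib cong: if_cong)
    qed
    then show "F p (cohom_add p X A B) = cohom_add p Y (F p A) (F p B)"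
      unfolding cohom_add_def by (simp add: F_def image_UN)
  next
    fix p c A assume A: "A \<in> cohomology p X"
    have "F p (cohom_class p X (\<lambda>\<sigma>. c * a \<sigma>)) = cohom_class p Y (\<lambda>\<sigma>. c * cochain_map p Y g a \<sigma>)"
      if "a \<in> A" for a
    proof -
      have "(\<lambda>\<sigma>. c * a \<sigma>) \<in> cochains p X"
        using coch[OF that A] by (simp add: cochains_def)
      then show ?thesis
        by (simp add: F_class) (simp add: cochain_map_def if_distrib cong: if_cong)
    qed
    then show "F p (cohom_scale p X c A) = cohom_scale p Y c (F p A)"
      unfolding cohom_scale_def by (simp add: F_def image_UN)
  next
    fix p q A B assume "A \<in> cohomology p X" "B \<in> cohomology q X"
    have "F (p + q) (cohom_class (p + q) X (cup p q X a b))
        = cohom_class (p + q) Y (cup p q Y (cochain_map p Y g a) (cochain_map q Y g b))" for a b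
      by (simp add: F_class cup_cochain_map[OF g]) (simp add: F_class cochains_def cup_def)
    then show "F (p + q) (cohom_cup p q X A B) = cohom_cup p q Y (F p A) (F q B)"
      unfolding cohom_cup_def by (simp add: F_def image_UN)
  next
    show "F 0 (cohom_one X) = cohom_one Y"
    proof -
      have "cochain_map 0 Y g (\<lambda>\<sigma>. if singular_simplex 0 X \<sigma> then 1 else 0)
          = (\<lambda>\<sigma>. if singular_simplex 0 Y \<sigma> then 1 else 0)"
        using singular_simplex_simplex_map[OF _ g] by (auto simp: cochain_map_def fun_eq_iff)
      then show ?thesis
        by (simp add: cohom_one_def F_class cochains_def)
    qed
  qed
qed

section \<open>Short-time flows of Lipschitz vector fields\<close>

text \<open>Staying in \<open>N\<close> is part of the notion, because the Lipschitz and norm bounds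
  of the field are assumed only there.\<close>

definition solves_ode_on :: "('a::real_normed_vector \<Rightarrow> 'a) \<Rightarrow> 'a set \<Rightarrow> real \<Rightarrow> (real \<Rightarrow> 'a) \<Rightarrow> bool" where
  "solves_ode_on V N h y \<longleftrightarrow>
     (\<forall>s\<in>{0..h}. y s \<in> N \<and> (y has_vector_derivative V (y s)) (at s within {0..h}))"

lemma solves_ode_on_continuous: "solves_ode_on V N h y \<Longrightarrow> continuous_on {0..h} y"
  by (meson solves_ode_on_def continuous_on_vector_derivative)

lemma solves_ode_on_reverse:
  assumes "solves_ode_on V N h y"
  shows "solves_ode_on (\<lambda>x. - V x) N h (\<lambda>s. y (h - s))"
  unfolding solves_ode_on_def
proof
  fix s assume s: "s \<in> {0..h}"
  have "((\<lambda>s. y (h - s)) has_vector_derivative (-1) *\<^sub>R V (y (h - s))) (at s within {0..h})"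
  proof (rule vector_diff_chain_within[of "\<lambda>s. h - s" "-1" s "{0..h}" y, unfolded o_def])
    show "((-) h has_vector_derivative - 1) (at s within {0..h})"
      by (auto intro!: derivative_eq_intros)
    have "(-) h ` {0..h} = {0..h}" by (auto simp: image_iff intro!: bexI[of _ "h - _"])
    then show "(y has_vector_derivative V (y (h - s))) (at (h - s) within (-) h ` {0..h})"
      using assms s by (auto simp: solves_ode_on_def)
  qed
  then show "y (h - s) \<in> N \<and> ((\<lambda>s. y (h - s)) has_vector_derivative - V (y (h - s))) (at s within {0..h})"
    using assms s by (auto simp: solves_ode_on_def)
qed

text \<open>This replaces Gronwall: at the point \<open>m\<close> where the distance is greatest,
  the mean value inequality gives |f m - f 0| \<le> h L |f m| \<le> |f m| / 2, and the right side is
  absorbed. Uniqueness and continuity in the initial value both follow.\<close>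

lemma solves_ode_on_stability:
  assumes V: "L-lipschitz_on N V" and hL: "h * L \<le> 1/2"
    and y: "solves_ode_on V N h y" and z: "solves_ode_on V N h z" and s: "s \<in> {0..h}"
  shows "dist (y s) (z s) \<le> 2 * dist (y 0) (z 0)"
proof -
  define f where "f s = y s - z s" for s
  have h: "0 \<le> h" using s by auto
  have "continuous_on {0..h} (\<lambda>s. norm (f s))"
    unfolding f_def using solves_ode_on_continuous y z by (intro continuous_intros)
  then obtain m where m: "m \<in> {0..h}" "\<And>s. s \<in> {0..h} \<Longrightarrow> norm (f s) \<le> norm (f m)"
    using continuous_attains_sup[of "{0..h}" "\<lambda>s. norm (f s)"] h by auto
  have L: "0 \<le> L" using V by (rule lipschitz_on_nonneg)
  have "norm (f m - f 0) \<le> (L * norm (f m)) * norm (m - 0)"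
  proof (rule differentiable_bound[of "{0..h}" f "\<lambda>s r. r *\<^sub>R (V (y s) - V (z s))"])
    fix s assume s: "s \<in> {0..h}"
    show "(f has_derivative (\<lambda>r. r *\<^sub>R (V (y s) - V (z s)))) (at s within {0..h})"
      using y z s unfolding f_def has_vector_derivative_def[symmetric]
      by (auto simp: solves_ode_on_def intro!: derivative_intros)
    have "norm (V (y s) - V (z s)) \<le> L * norm (f s)"
      using lipschitz_on_normD[OF V] y z s by (auto simp: solves_ode_on_def f_def)
    also have "\<dots> \<le> L * norm (f m)" using m(2)[OF s] L by (rule mult_left_mono)
    finally show "onorm (\<lambda>r. r *\<^sub>R (V (y s) - V (z s))) \<le> L * norm (f m)"
      by (intro onorm_le) (simp add: mult.commute mult_left_mono)
  qed (use m h in auto)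
  also have "\<dots> = (m * L) * norm (f m)" using m by simp
  also have "\<dots> \<le> (h * L) * norm (f m)" using m L by (intro mult_right_mono) auto
  also have "\<dots> \<le> 1/2 * norm (f m)" using hL by (intro mult_right_mono) auto
  finally have "norm (f m) \<le> 2 * norm (f 0)"
    using norm_triangle_ineq2[of "f m" "f 0"] by linarith
  then show ?thesis using m(2)[OF s] by (simp add: f_def dist_norm)
qed

lemma solves_ode_on_unique:
  assumes "L-lipschitz_on N V" "h * L \<le> 1/2" "solves_ode_on V N h y" "solves_ode_on V N h z"
    "y 0 = z 0" "s \<in> {0..h}"
  shows "y s = z s"
  using solves_ode_on_stability[OF assms(1-4,6)] assms(5) by simp

text \<open>Picard iteration as a contraction: \<open>h * M \<le> 1\<close> keeps the iterates in
  the unit ball about \<open>k\<close>, and \<open>h * L \<le> 1/2\<close> gives the contraction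
  factor.\<close>

lemma solves_ode_on_exists:
  fixes V :: "'a::banach \<Rightarrow> 'a"
  assumes N: "cball k 1 \<subseteq> N" and V: "L-lipschitz_on N V" and M: "\<And>x. x \<in> N \<Longrightarrow> norm (V x) \<le> M"
    and h: "0 \<le> h" "h * M \<le> 1" "h * L \<le> 1/2"
  obtains y where "y 0 = k" "solves_ode_on V N h y"
proof -
  \<comment> \<open>Clamping time to \<open>{0..h}\<close> lets the iterates be bounded continuous
    functions on the whole line, which form a complete space.\<close>
  define c where "c s = max 0 (min h s)" for s :: real
  define I where "I w s = integral {0..s} (\<lambda>r. V (apply_bcontfun w r))" for w :: "real \<Rightarrow>\<^sub>C 'a" and s
  define P where "P w = Bcontfun (\<lambda>s. k + I w (c s))" for w
  define S where "S = PiC (UNIV :: real set) (\<lambda>_. cball k 1)"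
  have c: "c s \<in> {0..h}" for s using h by (auto simp: c_def)
  have L: "0 \<le> L" using V by (rule lipschitz_on_nonneg)
  have M0: "0 \<le> M" using order_trans[OF norm_ge_zero M[of k]] N by (meson centre_in_cball subsetD zero_le_one)
  have S_iff: "w \<in> S \<longleftrightarrow> (\<forall>r. dist k (apply_bcontfun w r) \<le> 1)" for w
    by (auto simp: S_def mem_PiC_iff)
  then have S: "apply_bcontfun w r \<in> cball k 1" if "w \<in> S" for w r
    using that by simp
  have cV: "continuous_on T (\<lambda>r. V (apply_bcontfun w r))" if "w \<in> S" for w T
    by (rule continuous_on_compose2[OF lipschitz_on_continuous_on[OF V]]) (use S[OF that] N in auto)
  have bound: "norm (I w s) \<le> M * s" if "w \<in> S" "s \<in> {0..h}" for w s
  proof -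
    have "norm (V (apply_bcontfun w r)) \<le> M" for r
      using M N S[OF that(1)] by blast
    then show ?thesis
      unfolding I_def using integral_bound[of 0 s "\<lambda>r. V (apply_bcontfun w r)" M] that(2) cV[OF that(1)]
      by simp
  qed
  have bound1: "norm (I w s) \<le> 1" if "w \<in> S" "s \<in> {0..h}" for w s
  proof -
    have "M * s \<le> h * M" using that M0 by (simp add: mult.commute mult_left_mono)
    then show ?thesis using bound[OF that] h by linarith
  qed
  have cI: "continuous_on UNIV (\<lambda>s. k + I w (c s))" if "w \<in> S" for w
  proof -
    have "continuous_on {0..h} (I w)" unfolding I_def
      by (intro indefinite_integral_continuous_1 integrable_continuous_real cV that)
    moreover have "continuous_on UNIV c" unfolding c_def by (intro continuous_intros)
    ultimately have "continuous_on UNIV (\<lambda>s. I w (c s))"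
      by (rule continuous_on_compose2) (use c in auto)
    then show ?thesis by (intro continuous_intros)
  qed
  have P: "apply_bcontfun (P w) s = k + I w (c s)" if "w \<in> S" for w s
  proof -
    have "norm (k + I w (c s)) \<le> norm k + 1" for s
      using norm_triangle_ineq[of k "I w (c s)"] bound1[OF that c, of s] by linarith
    then have "(\<lambda>s. k + I w (c s)) \<in> bcontfun"
      by (rule bcontfun_normI[OF cI[OF that]])
    then show ?thesis by (simp add: P_def Bcontfun_inverse)
  qed
  have "\<exists>!w\<in>S. P w = w"
  proof (rule Banach_fix)
    show "complete S" unfolding S_def by (simp add: complete_eq_closed closed_PiC)
    have "const_bcontfun k \<in> S" by (simp add: S_iff)
    then show "S \<noteq> {}" by blast
    show "P ` S \<subseteq> S"
    proof clarify
      fix w assume "w \<in> S"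
      then show "P w \<in> S" using bound1[OF _ c] by (simp add: S_iff[of "P w"] P dist_norm)
    qed
    show "dist (P w) (P w') \<le> 1/2 * dist w w'" if w: "w \<in> S" "w' \<in> S" for w w'
    proof (rule dist_bound)
      fix s
      have "I w (c s) - I w' (c s) = integral {0..c s} (\<lambda>r. V (apply_bcontfun w r) - V (apply_bcontfun w' r))"
        unfolding I_def by (rule integral_diff[symmetric]) (intro integrable_continuous_real cV w)+
      also have "norm \<dots> \<le> (L * dist w w') * (c s - 0)"
      proof (rule integral_bound)
        show "continuous_on {0..c s} (\<lambda>r. V (apply_bcontfun w r) - V (apply_bcontfun w' r))"
          by (intro continuous_intros cV w)
        fix r
        have "norm (V (apply_bcontfun w r) - V (apply_bcontfun w' r)) \<le> L * dist (apply_bcontfun w r) (apply_bcontfun w' r)"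
          using lipschitz_onD[OF V] S w N by (metis dist_norm subsetD)
        also have "\<dots> \<le> L * dist w w'" by (intro mult_left_mono dist_bounded L)
        finally show "norm (V (apply_bcontfun w r) - V (apply_bcontfun w' r)) \<le> L * dist w w'" .
      qed (use c in auto)
      also have "\<dots> = (c s * L) * dist w w'" by simp
      also have "\<dots> \<le> (h * L) * dist w w'"
        using c[of s] L by (intro mult_right_mono) auto
      also have "\<dots> \<le> 1/2 * dist w w'" using h by (intro mult_right_mono) auto
      finally show "dist (apply_bcontfun (P w) s) (apply_bcontfun (P w') s) \<le> 1/2 * dist w w'"
        by (simp add: P w dist_norm)
    qed
  qed auto
  then obtain w where w: "w \<in> S" "P w = w" by blast
  have weq: "apply_bcontfun w s = k + I w (c s)" for s using P[OF w(1)] w(2) by metis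
  have cs: "c s = s" if "s \<in> {0..h}" for s using that by (auto simp: c_def)
  show ?thesis
  proof
    show "apply_bcontfun w 0 = k" using weq[of 0] h by (simp add: c_def I_def)
    show "solves_ode_on V N h (apply_bcontfun w)"
      unfolding solves_ode_on_def
    proof
      fix s assume s: "s \<in> {0..h}"
      have "((\<lambda>s. k + I w s) has_vector_derivative 0 + V (apply_bcontfun w s)) (at s within {0..h})"
        unfolding I_def by (intro derivative_intros integral_has_vector_derivative cV w s)
      then have "(apply_bcontfun w has_vector_derivative V (apply_bcontfun w s)) (at s within {0..h})"
        by (rule has_vector_derivative_transform[rotated 2, THEN has_vector_derivative_eq_rhs])
          (use s in \<open>simp_all add: weq cs\<close>)
      then show "apply_bcontfun w s \<in> N \<and>
          (apply_bcontfun w has_vector_derivative V (apply_bcontfun w s)) (at s within {0..h})"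
        using S[OF w(1)] N by blast
    qed
  qed
qed

section \<open>Matrix calculus in SU(2)\<close>

lemma scaleR_matrix_mult:
  fixes A :: "complex^'n^'m" and B :: "complex^'p^'n"
  shows "(r *\<^sub>R A) ** B = r *\<^sub>R (A ** B)" "A ** (r *\<^sub>R B) = r *\<^sub>R (A ** B)"
  by (simp_all add: matrix_matrix_mult_def vec_eq_iff scaleR_sum_right)

lemma bilinear_matrix_mult:
  "bilinear ((**) :: complex^'n^'m \<Rightarrow> complex^'p^'n \<Rightarrow> complex^'p^'m)"
  unfolding bilinear_def
  by (auto intro!: linearI simp: scaleR_matrix_mult matrix_add_ldistrib
      simp: matrix_matrix_mult_def vec_eq_iff sum.distrib algebra_simps scaleR_sum_right)

interpretation matrix_mult: bounded_bilinear "(**) :: complex^2^2 \<Rightarrow> complex^2^2 \<Rightarrow> complex^2^2"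
  using bilinear_matrix_mult bilinear_conv_bounded_bilinear by blast

lemma conj_transpose_mat [simp]: "conj_transpose (mat 1 :: complex^'n^'n) = mat 1"
  by (simp add: conj_transpose_def mat_def vec_eq_iff)

lemma conj_transpose_linear:
  fixes A B :: "complex^'n^'m"
  shows "conj_transpose (A + B) = conj_transpose A + conj_transpose B"
    "conj_transpose (A - B) = conj_transpose A - conj_transpose B"
    "conj_transpose (- A) = - conj_transpose A"
    "conj_transpose (r *\<^sub>R A) = r *\<^sub>R conj_transpose A"
  by (simp_all add: conj_transpose_def vec_eq_iff)

lemma bounded_linear_conj_transpose: "bounded_linear (conj_transpose :: complex^'n^'m \<Rightarrow> complex^'m^'n)"
  by (rule linear_conv_bounded_linear[THEN iffD1]) (auto intro!: linearI simp: conj_transpose_linear)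

lemmas matrix_mult_simps =
  matrix_mult.add_left matrix_mult.add_right matrix_mult.diff_left matrix_mult.diff_right
  matrix_mult.minus_left matrix_mult.minus_right matrix_mult.scaleR_left matrix_mult.scaleR_right

interpretation SU2: group SU2
  by (rule group_SU2)

lemma SU2_simps [simp]: "\<one>\<^bsub>SU2\<^esub> = mat 1" "a \<otimes>\<^bsub>SU2\<^esub> b = a ** b"
  by (simp_all add: SU2_def)

lemma SU2_iff: "A \<in> carrier SU2 \<longleftrightarrow> conj_transpose A ** A = mat 1 \<and> det A = 1"
  by (auto simp: SU2_def matrix_left_right_inverse)

lemma SU2_cancel:
  assumes "A \<in> carrier SU2"
  shows "A ** conj_transpose A = mat 1" "conj_transpose A ** A = mat 1"
    "A ** (conj_transpose A ** B) = B" "conj_transpose A ** (A ** B) = B"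
proof -
  show *: "A ** conj_transpose A = mat 1" "conj_transpose A ** A = mat 1"
    using assms by (auto simp: SU2_def matrix_left_right_inverse)
  then show "A ** (conj_transpose A ** B) = B" "conj_transpose A ** (A ** B) = B"
    by (simp_all add: matrix_mul_assoc)
qed

lemma SU2_mult_closed: "A \<in> carrier SU2 \<Longrightarrow> B \<in> carrier SU2 \<Longrightarrow> A ** B \<in> carrier SU2"
  using SU2.m_closed by simp

lemma SU2_conj_transpose_closed: "A \<in> carrier SU2 \<Longrightarrow> conj_transpose A \<in> carrier SU2"
  by (auto simp: SU2_def det_conj_transpose matrix_left_right_inverse)

lemma SU2_one_closed: "mat 1 \<in> carrier SU2"
  using SU2.one_closed by simp

lemma SU2_inv: "A \<in> carrier SU2 \<Longrightarrow> inv\<^bsub>SU2\<^esub> A = conj_transpose A"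
  using SU2_cancel SU2_conj_transpose_closed by (intro SU2.inv_equality) simp_all

lemma conjugation_eq: "g \<in> carrier SU2 \<Longrightarrow> conjugation g x = g ** x ** conj_transpose g"
  by (simp add: conjugation_def SU2_inv)

text \<open>The norm is in fact sqrt 2; the rounder 2 later serves as the radius of a ball
  containing all embedded tuples.\<close>

lemma norm_SU2_le:
  assumes "A \<in> carrier SU2"
  shows "norm A \<le> 2"
proof -
  note e = SU2_entries[OF assms]
  have "(norm (A $ 1 $ 1))\<^sup>2 + (norm (A $ 1 $ 2))\<^sup>2 = 1"
    using e(3) by (metis complex_norm_square of_real_1 of_real_add of_real_eq_iff)
  then have "(norm A)\<^sup>2 = 2"
    by (simp add: norm_vec_def L2_set_def sum_2 e(1,2) add.commute)
  then have "(norm A)\<^sup>2 \<le> 2\<^sup>2" by simp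
  then show ?thesis by (rule power2_le_imp_le) simp
qed

definition half_trace :: "complex^2^2 \<Rightarrow> real" where
  "half_trace A = Re (trace A) / 2"

lemma bounded_linear_half_trace: "bounded_linear half_trace"
  by (rule linear_conv_bounded_linear[THEN iffD1])
    (auto intro!: linearI simp: half_trace_def trace_def sum_2 field_simps)

lemma SU2_plus_conj_transpose:
  assumes "A \<in> carrier SU2"
  shows "A + conj_transpose A = (2 * half_trace A) *\<^sub>R mat 1"
  using SU2_entries(1,2)[OF assms]
  by (simp add: vec_eq_iff forall_2 conj_transpose_def mat_def half_trace_def trace_def sum_2 complex_eq_iff)

lemma SU2_conj_transpose_eq:
  assumes "A \<in> carrier SU2"
  shows "conj_transpose A = (2 * half_trace A) *\<^sub>R mat 1 - A"
  using SU2_plus_conj_transpose[OF assms] by (metis add_diff_cancel_left')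

text \<open>Cayley-Hamilton for determinant 1.\<close>

lemma SU2_square:
  assumes "A \<in> carrier SU2"
  shows "A ** A = (2 * half_trace A) *\<^sub>R A - mat 1"
  using SU2_cancel(1)[OF assms]
  by (simp add: SU2_conj_transpose_eq[OF assms] matrix_mult_simps) (metis add.commute eq_diff_eq)

text \<open>
  On \<open>SU(2)\<close> this solves \<open>\<xi> A + A \<xi> = (half_trace A)\<^sup>2 \<eta> A\<close>, so that moving \<open>A\<close> with velocity
  \<open>\<xi> A\<close> moves \<open>A\<^sup>2\<close> with velocity a multiple of \<open>\<eta> A\<^sup>2\<close>. It is polynomial, and skew-Hermitian for
  skew-Hermitian \<open>\<eta>\<close> and arbitrary \<open>A\<close>.
\<close>

definition sqrt_lift :: "complex^2^2 \<Rightarrow> complex^2^2 \<Rightarrow> complex^2^2" where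
  "sqrt_lift \<eta> A = (half_trace A / 2) *\<^sub>R (half_trace A *\<^sub>R \<eta> +
     (1/4) *\<^sub>R (\<eta> ** (A - conj_transpose A) - (A - conj_transpose A) ** \<eta>))"

text \<open>Cayley-Hamilton makes the outer terms \<open>\<eta> ** A ** A\<close> and
  \<open>A ** (A ** \<eta>)\<close> linear in \<open>A\<close>. The mixed terms
  \<open>A ** \<eta> ** A\<close> cancel, and so do those with \<open>A ** \<eta>\<close>, which
  leaves only \<open>\<eta> ** A\<close>.\<close>

lemma sqrt_lift_SU2:
  assumes "A \<in> carrier SU2"
  shows "sqrt_lift \<eta> A ** A + A ** sqrt_lift \<eta> A = (half_trace A)\<^sup>2 *\<^sub>R (\<eta> ** A)"
proof -
  define t where "t = half_trace A"
  have l: "sqrt_lift \<eta> A = (t / 2) *\<^sub>R (t *\<^sub>R \<eta> + (1/2) *\<^sub>R (\<eta> ** A - A ** \<eta>))"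
  proof -
    have "A - conj_transpose A = 2 *\<^sub>R A - (2 * t) *\<^sub>R mat 1"
      by (simp add: SU2_conj_transpose_eq[OF assms] scaleR_2 t_def)
    then show ?thesis by (simp add: sqrt_lift_def matrix_mult_simps scaleR_right_diff_distrib t_def)
  qed
  have sq: "A ** A = (2 * t) *\<^sub>R A - mat 1" using SU2_square[OF assms] by (simp add: t_def)
  have "\<eta> ** A ** A = (2 * t) *\<^sub>R (\<eta> ** A) - \<eta>"
    by (simp add: sq matrix_mult_simps flip: matrix_mul_assoc)
  moreover have "A ** (A ** \<eta>) = (2 * t) *\<^sub>R (A ** \<eta>) - \<eta>"
    by (simp add: sq matrix_mult_simps matrix_mul_assoc)
  moreover have "A ** \<eta> ** A = A ** (\<eta> ** A)" by (simp add: matrix_mul_assoc)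
  moreover have "(t * t / 2) *\<^sub>R (\<eta> ** A) + (t * t / 2) *\<^sub>R (\<eta> ** A) = (t * t) *\<^sub>R (\<eta> ** A)"
    by (simp flip: scaleR_add_left)
  ultimately show ?thesis
    unfolding l t_def[symmetric]
    by (simp add: matrix_mult_simps scaleR_add_right scaleR_right_diff_distrib power2_eq_square)
qed

text \<open>Skewness makes the velocity tangent to the unitary group. It is stated for every
  \<open>A\<close> because it is applied along a solution before that is known to stay in
  SU(2).\<close>

lemma sqrt_lift_skew:
  assumes "conj_transpose \<eta> = - \<eta>"
  shows "conj_transpose (sqrt_lift \<eta> A) = - sqrt_lift \<eta> A"
  unfolding sqrt_lift_def conj_transpose_linear conj_transpose_mult
  by (simp add: assms matrix_mult_simps algebra_simps)

lemma trace_scaleR: "trace (r *\<^sub>R (A :: complex^'n^'n)) = r *\<^sub>R trace A"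
  by (simp add: trace_def scaleR_sum_right)

lemma trace_sqrt_lift:
  assumes "trace \<eta> = 0"
  shows "trace (sqrt_lift \<eta> A) = 0"
  unfolding sqrt_lift_def by (simp add: trace_scaleR trace_add trace_sub assms trace_mul_sym[of \<eta>])

subsection \<open>The maximal torus\<close>

definition torus_elt :: "real \<Rightarrow> complex^2^2" where
  "torus_elt \<theta> = (\<chi> i j. if i = j then (if i = 1 then cis \<theta> else cis (- \<theta>)) else 0)"

text \<open>This is the unit \<open>u\<close> of the overview, the velocity of
  \<open>torus_elt\<close> at 0.\<close>

definition torus_gen :: "complex^2^2" where
  "torus_gen = (\<chi> i j. if i = j then (if i = 1 then \<i> else - \<i>) else 0)"

lemma conj_transpose_torus_gen: "conj_transpose torus_gen = - torus_gen"
  by (simp add: conj_transpose_def torus_gen_def vec_eq_iff)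

lemma trace_torus_gen: "trace torus_gen = 0"
  by (simp add: trace_def torus_gen_def sum_2)

lemma torus_elt_add: "torus_elt a ** torus_elt b = torus_elt (a + b)"
  by (simp add: torus_elt_def vec_eq_iff forall_2 matrix_matrix_mult_def sum_2 cis_mult)

lemma torus_elt_0 [simp]: "torus_elt 0 = mat 1"
  by (simp add: torus_elt_def vec_eq_iff forall_2 mat_def)

lemma torus_elt_eq_iff: "torus_elt a = torus_elt b \<longleftrightarrow> cis a = cis b"
  by (auto simp: torus_elt_def vec_eq_iff forall_2 cis_cnj[symmetric])

lemma torus_elt_closed: "torus_elt a \<in> max_torus"
  by (simp add: max_torus_def SU2_def vec_eq_iff forall_2 matrix_matrix_mult_def sum_2 mat_def
      conj_transpose_def torus_elt_def cis_cnj cis_mult det_2)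

lemma max_torus_SU2: "t \<in> max_torus \<Longrightarrow> t \<in> carrier SU2"
  by (simp add: max_torus_def)

lemma max_torus_commute:
  assumes "t \<in> max_torus"
  shows "t ** torus_elt a = torus_elt a ** t" "t ** torus_gen = torus_gen ** t"
  using assms
  by (simp_all add: max_torus_def torus_elt_def torus_gen_def vec_eq_iff forall_2
      matrix_matrix_mult_def sum_2 mult.commute)

text \<open>Commutation multiplies the off-diagonal entries by cis a - cis (-a) = 2 i sin a, up to
  sign, and equates the result with 0.\<close>

lemma commute_torus_elt_imp_max_torus:
  assumes "g \<in> carrier SU2" "g ** torus_elt a = torus_elt a ** g" "sin a \<noteq> 0"
  shows "g \<in> max_torus"
proof -
  have "(g ** torus_elt a) $ i $ j = (torus_elt a ** g) $ i $ j" for i j using assms(2) by simp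
  from this[of 1 2] this[of 2 1]
  have "g $ 1 $ 2 * cis (-a) = cis a * g $ 1 $ 2" "g $ 2 $ 1 * cis a = cis (-a) * g $ 2 $ 1"
    by (simp_all add: matrix_matrix_mult_def sum_2 torus_elt_def)
  then have "g $ 1 $ 2 * (cis a - cis (-a)) = 0" "g $ 2 $ 1 * (cis a - cis (-a)) = 0"
    unfolding right_diff_distrib by (simp_all only: mult.commute diff_self)
  moreover have "cis a - cis (-a) \<noteq> 0" using assms(3) by (simp add: complex_eq_iff)
  ultimately have "g $ 1 $ 2 = 0" "g $ 2 $ 1 = 0" unfolding mult_eq_0_iff by blast+
  then show ?thesis using assms(1) by (simp add: max_torus_def forall_2)
qed

lemma torus_elt_eq_cos_sin: "torus_elt \<theta> = cos \<theta> *\<^sub>R mat 1 + sin \<theta> *\<^sub>R torus_gen"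
  by (simp add: torus_elt_def torus_gen_def mat_def vec_eq_iff complex_eq_iff)

lemma has_vector_derivative_torus_elt:
  assumes "(f has_real_derivative f') (at s within S)"
  shows "((\<lambda>s. torus_elt (f s)) has_vector_derivative f' *\<^sub>R (torus_gen ** torus_elt (f s))) (at s within S)"
proof -
  have "torus_gen ** torus_gen = - mat 1"
    by (simp add: torus_gen_def vec_eq_iff forall_2 matrix_matrix_mult_def sum_2 mat_def)
  then have g: "torus_gen ** torus_elt \<theta> = cos \<theta> *\<^sub>R torus_gen - sin \<theta> *\<^sub>R mat 1" for \<theta>
    by (simp add: torus_elt_eq_cos_sin matrix_mult_simps)
  show ?thesis
    unfolding g unfolding torus_elt_eq_cos_sin using assms
    by (auto intro!: derivative_eq_intros simp: algebra_simps has_real_derivative_iff_has_vector_derivative)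
qed

text \<open>If the off-diagonal entry vanishes, the matrix is already in the torus; otherwise an
  eigenvector can be written down.\<close>

lemma SU2_diagonalize:
  assumes a: "a \<in> carrier SU2"
  obtains g \<theta> where "g \<in> carrier SU2" "a = g ** torus_elt \<theta> ** conj_transpose g"
proof -
  obtain \<alpha> \<beta> where e: "a $ 1 $ 1 = \<alpha>" "a $ 1 $ 2 = \<beta>" by simp
  note s = SU2_entries[OF a, unfolded e]
  show ?thesis
  proof (cases "\<beta> = 0")
    case True
    then have "(norm \<alpha>)\<^sup>2 = 1"
      using s(3) by (metis complex_norm_square of_real_1 of_real_eq_iff add_0_right mult_zero_left)
    then have "norm \<alpha> = 1" using power2_eq_imp_eq[of "norm \<alpha>" 1] by simp
    then have "\<alpha> = cis (Arg \<alpha>)"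
      by (metis cis_Arg norm_zero sgn_eq div_by_1 of_real_1 zero_neq_one)
    then have "a = torus_elt (Arg \<alpha>)"
      using True s by (simp add: vec_eq_iff forall_2 torus_elt_def e flip: cis_cnj)
    then show ?thesis using that[OF SU2_one_closed, of "Arg \<alpha>"] by simp
  next
    case False
    define c where "c = Re \<alpha>"
    have "c\<^sup>2 \<le> 1"
    proof -
      have "(norm \<alpha>)\<^sup>2 + (norm \<beta>)\<^sup>2 = 1"
        using s(3) by (metis complex_norm_square of_real_1 of_real_add of_real_eq_iff)
      moreover have "c\<^sup>2 \<le> (norm \<alpha>)\<^sup>2" by (simp add: c_def cmod_power2)
      ultimately show ?thesis by (smt (verit) zero_le_power2)
    qed
    then have "\<bar>c\<bar> \<le> 1" by (simp add: abs_square_le_1)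
    \<comment> \<open>The eigenvalues are cis (\<plusminus> \<theta>), where cos \<theta> is half
      the trace, that is, the real part of \<alpha>.\<close>
    define \<theta> where "\<theta> = arccos c"
    have c: "cos \<theta> = c" using \<open>\<bar>c\<bar> \<le> 1\<close> by (simp add: \<theta>_def)
    define l where "l = cis \<theta>"
    have "\<alpha> + cnj \<alpha> = l + cnj l" "l * cnj l = 1"
      by (simp_all add: l_def complex_eq_iff c c_def cis_cnj cis_mult)
    then have l: "l * l = l * (\<alpha> + cnj \<alpha>) - 1" by (simp add: distrib_left)
    \<comment> \<open>The vector (\<beta>, l - \<alpha>) is the eigenvector for \<open>l\<close>
      read off from the first row of \<open>a\<close>, and \<open>N\<close> is its length, positive
      because \<beta> is nonzero.\<close>
    define N where "N = sqrt ((norm \<beta>)\<^sup>2 + (norm (l - \<alpha>))\<^sup>2)"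
    have N: "N > 0" "N\<^sup>2 = (norm \<beta>)\<^sup>2 + (norm (l - \<alpha>))\<^sup>2"
      using False by (auto simp: N_def add_pos_nonneg)
    define p where "p = \<beta> / N"
    define q where "q = (l - \<alpha>) / N"
    \<comment> \<open>The second column is the orthogonal unit vector that makes the determinant 1.
      It belongs to the conjugate eigenvalue, so its two equations are the conjugates of those of
      the first column.\<close>
    define g :: "complex^2^2" where
      "g = (\<chi> i j. if i = 1 then (if j = 1 then p else - cnj q) else (if j = 1 then q else cnj p))"
    have pq: "p * cnj p + q * cnj q = 1"
    proof -
      have "(norm p)\<^sup>2 + (norm q)\<^sup>2 = 1"
        using N False by (simp add: p_def q_def norm_divide power_divide flip: add_divide_distrib)
      then show ?thesis by (metis complex_norm_square of_real_1 of_real_add)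
    qed
    have g: "g \<in> carrier SU2"
      using pq by (simp add: SU2_def vec_eq_iff forall_2 matrix_matrix_mult_def sum_2 mat_def
          conj_transpose_def g_def det_2 algebra_simps)
    have 1: "\<alpha> * p + \<beta> * q = l * p"
      by (simp add: p_def q_def algebra_simps flip: add_divide_distrib diff_divide_distrib)
    have "- (cnj \<beta> * \<beta>) + cnj \<alpha> * (l - \<alpha>) = l * (l - \<alpha>)"
      using s(3) l by (simp add: algebra_simps)
    then have 2: "- (cnj \<beta> * p) + cnj \<alpha> * q = l * q"
      unfolding p_def q_def by (metis add_divide_distrib minus_divide_left times_divide_eq_right)
    have 3: "- (\<beta> * cnj p) + \<alpha> * cnj q = cnj l * cnj q"
      using arg_cong[OF 2, of cnj] by simp
    have 4: "cnj \<alpha> * cnj p + cnj \<beta> * cnj q = cnj l * cnj p"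
      using arg_cong[OF 1, of cnj] by simp
    have "a ** g = g ** torus_elt \<theta>"
      using 1 2 3 4
      by (simp add: vec_eq_iff forall_2 matrix_matrix_mult_def sum_2 torus_elt_def e s g_def
          flip: cis_cnj l_def) (simp add: algebra_simps)
    then have "a = g ** torus_elt \<theta> ** conj_transpose g"
      using SU2_cancel(1)[OF g] by (metis matrix_mul_assoc matrix_mul_rid)
    then show ?thesis using g that by blast
  qed
qed

subsection \<open>Products of squares\<close>

text \<open>The recursion peels off the last factor, so that \<open>sq_prod x i\<close> is the
  prefix in front of the square of \<open>x i\<close>; the vector field involves all these
  prefixes.\<close>

primrec sq_prod :: "(nat \<Rightarrow> complex^2^2) \<Rightarrow> nat \<Rightarrow> complex^2^2" where
  "sq_prod x 0 = mat 1"
| "sq_prod x (Suc i) = sq_prod x i ** (x i ** x i)"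

lemma square_word_eq: "square_word n x = sq_prod x (Suc n)"
proof -
  have "foldr (mult SU2) (map (\<lambda>i. x i [^]\<^bsub>SU2\<^esub> (2::nat)) [0..<m]) z = sq_prod x m ** z" for m z
  proof (induction m arbitrary: z)
    case (Suc m)
    then show ?case by (simp add: numeral_2_eq_2 matrix_mul_assoc)
  qed simp
  then show ?thesis by (simp add: square_word_def del: sq_prod.simps upt_Suc)
qed

lemma sq_prod_closed: "(\<And>j. j < i \<Longrightarrow> x j \<in> carrier SU2) \<Longrightarrow> sq_prod x i \<in> carrier SU2"
  by (induction i) (simp_all add: SU2_mult_closed SU2_one_closed)

lemma sq_prod_cong: "(\<And>j. j < i \<Longrightarrow> x j = y j) \<Longrightarrow> sq_prod x i = sq_prod y i"
  by (induction i) simp_all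

lemma sq_prod_conj:
  assumes "t \<in> carrier SU2"
  shows "sq_prod (\<lambda>i. t ** x i ** conj_transpose t) m = t ** sq_prod x m ** conj_transpose t"
proof (induction m)
  case 0
  then show ?case using SU2_cancel[OF assms] by simp
next
  case (Suc m)
  then show ?case
    by (simp add: SU2_cancel[OF assms] flip: matrix_mul_assoc)
qed

text \<open>As A^2 = 2 \<tau> A - 1, each square is -1 up to 2 \<tau> A. Behind the prefix this
  error has norm at most 2 |\<tau>| times the bound 2 on SU(2), whence the constant 4, and the
  errors add up.\<close>

lemma norm_sq_prod_le:
  assumes "\<And>j. j < i \<Longrightarrow> x j \<in> carrier SU2"
  shows "norm (sq_prod x i - (-1) ^ i *\<^sub>R mat 1) \<le> 4 * (\<Sum>j<i. \<bar>half_trace (x j)\<bar>)"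
  using assms
proof (induction i)
  case (Suc i)
  define P where "P = sq_prod x i"
  have x: "x i \<in> carrier SU2" and P: "P \<in> carrier SU2" using Suc.prems sq_prod_closed[of i x] by (auto simp: P_def)
  have "sq_prod x (Suc i) - (-1) ^ Suc i *\<^sub>R mat 1 = (2 * half_trace (x i)) *\<^sub>R (P ** x i) - (P - (-1) ^ i *\<^sub>R mat 1)"
    by (simp add: SU2_square[OF x] matrix_mult_simps P_def)
  also have "norm \<dots> \<le> \<bar>2 * half_trace (x i)\<bar> * norm (P ** x i) + norm (P - (-1) ^ i *\<^sub>R mat 1)"
    using norm_triangle_ineq4 by (metis norm_scaleR)
  also have "\<bar>2 * half_trace (x i)\<bar> * norm (P ** x i) \<le> \<bar>2 * half_trace (x i)\<bar> * 2"
    by (intro mult_left_mono norm_SU2_le SU2_mult_closed P x) simp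
  finally show ?case using Suc by (simp add: P_def)
qed simp

definition trace_energy :: "nat \<Rightarrow> (nat \<Rightarrow> complex^2^2) \<Rightarrow> real" where
  "trace_energy n x = (\<Sum>i\<le>n. (half_trace (x i))\<^sup>2)"

text \<open>With P the prefix in front of the factor A, this is P^-1 u P on SU(2): the left velocity
  that A^2 needs in order that P A^2 have left velocity u.\<close>

definition frame :: "(nat \<Rightarrow> complex^2^2) \<Rightarrow> nat \<Rightarrow> complex^2^2" where
  "frame x i = conj_transpose (sq_prod x i) ** torus_gen ** sq_prod x i"

text \<open>
  Trace-free elements of \<open>SU(2)\<close> square to \<open>-1\<close>, so the critical points of the product of \<open>n + 1\<close>
  squares, where \<open>trace_energy\<close> vanishes, all lie over \<open>(-1)\<^sup>n\<^sup>+\<^sup>1\<close>.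
\<close>

lemma trace_energy_bound:
  assumes "\<And>i. i \<le> n \<Longrightarrow> x i \<in> carrier SU2" "0 \<le> e"
    "norm (sq_prod x (Suc n) - (-1) ^ Suc n *\<^sub>R mat 1) \<ge> 4 * real (Suc n) * e"
  shows "e\<^sup>2 \<le> trace_energy n x"
proof (rule ccontr)
  assume neg: "\<not> e\<^sup>2 \<le> trace_energy n x"
  have "\<bar>half_trace (x i)\<bar> < e" if "i \<in> {..n}" for i
  proof -
    have "(half_trace (x i))\<^sup>2 \<le> trace_energy n x"
      unfolding trace_energy_def by (rule member_le_sum[OF that]) auto
    then have "\<bar>half_trace (x i)\<bar>\<^sup>2 < e\<^sup>2" using neg by simp
    then show ?thesis using assms(2) by (rule power2_less_imp_less)
  qed
  then have "(\<Sum>i\<le>n. \<bar>half_trace (x i)\<bar>) < (\<Sum>i\<le>n. e)" by (intro sum_strict_mono) auto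
  moreover have "norm (sq_prod x (Suc n) - (-1) ^ Suc n *\<^sub>R mat 1) \<le> 4 * (\<Sum>j<Suc n. \<bar>half_trace (x j)\<bar>)"
    using assms(1) by (intro norm_sq_prod_le) simp
  ultimately show False using assms(3) by (simp add: lessThan_Suc_atMost algebra_simps del: sum.lessThan_Suc sq_prod.simps)
qed

section \<open>Bounded Lipschitz maps\<close>

text \<open>Lipschitz maps alone are not closed under products; together with boundedness they are,
  so the field can be treated factor by factor.\<close>

definition bounded_lipschitz_on :: "'a::metric_space set \<Rightarrow> ('a \<Rightarrow> 'b::real_normed_vector) \<Rightarrow> bool" where
  "bounded_lipschitz_on S f \<longleftrightarrow> (\<exists>B. \<forall>x\<in>S. norm (f x) \<le> B) \<and> (\<exists>L. L-lipschitz_on S f)"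

lemma bounded_lipschitz_onE:
  assumes "bounded_lipschitz_on S f"
  obtains B L where "0 \<le> B" "\<And>x. x \<in> S \<Longrightarrow> norm (f x) \<le> B" "0 \<le> L" "L-lipschitz_on S f"
proof -
  obtain B L where "\<forall>x\<in>S. norm (f x) \<le> B" "L-lipschitz_on S f"
    using assms by (auto simp: bounded_lipschitz_on_def)
  then show thesis using that[of "max 0 B" L] lipschitz_on_nonneg by fastforce
qed

lemma bounded_lipschitz_onI:
  assumes "\<And>x. x \<in> S \<Longrightarrow> norm (f x) \<le> B" "L-lipschitz_on S f"
  shows "bounded_lipschitz_on S f"
  using assms by (auto simp: bounded_lipschitz_on_def)

lemma bounded_lipschitz_on_const: "bounded_lipschitz_on S (\<lambda>x. c)"
  by (rule bounded_lipschitz_onI[OF order_refl lipschitz_on_constant])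

lemma bounded_lipschitz_on_add:
  assumes "bounded_lipschitz_on S f" "bounded_lipschitz_on S g"
  shows "bounded_lipschitz_on S (\<lambda>x. f x + g x)"
proof -
  obtain B L where f: "\<And>x. x \<in> S \<Longrightarrow> norm (f x) \<le> B" "L-lipschitz_on S f"
    using bounded_lipschitz_onE[OF assms(1)] by metis
  obtain B' L' where g: "\<And>x. x \<in> S \<Longrightarrow> norm (g x) \<le> B'" "L'-lipschitz_on S g"
    using bounded_lipschitz_onE[OF assms(2)] by metis
  show ?thesis
    by (rule bounded_lipschitz_onI[OF norm_triangle_mono[OF f(1) g(1)] lipschitz_on_add[OF f(2) g(2)]])
qed

lemma bounded_lipschitz_on_bounded_linear:
  assumes "bounded_lipschitz_on S f" "bounded_linear T"
  shows "bounded_lipschitz_on S (\<lambda>x. T (f x))"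
proof -
  obtain B L where f: "\<And>x. x \<in> S \<Longrightarrow> norm (f x) \<le> B" "L-lipschitz_on S f"
    using bounded_lipschitz_onE[OF assms(1)] by metis
  obtain K where K: "0 < K" "\<And>x. norm (T x) \<le> norm x * K"
    using bounded_linear.pos_bounded[OF assms(2)] by blast
  show ?thesis
  proof (rule bounded_lipschitz_onI)
    show "norm (T (f x)) \<le> B * K" if "x \<in> S" for x
      using K(2)[of "f x"] mult_right_mono[OF f(1)[OF that], of K] K(1) by linarith
    show "(L * K)-lipschitz_on S (\<lambda>x. T (f x))"
    proof (rule lipschitz_onI)
      fix x y assume xy: "x \<in> S" "y \<in> S"
      have "dist (T (f x)) (T (f y)) \<le> dist (f x) (f y) * K"
        using K(2)[of "f x - f y"] by (simp add: dist_norm linear_diff[OF bounded_linear.linear[OF assms(2)]])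
      also have "\<dots> \<le> L * dist x y * K"
        using lipschitz_onD[OF f(2) xy] K(1) by (intro mult_right_mono) auto
      finally show "dist (T (f x)) (T (f y)) \<le> L * K * dist x y" by (simp add: mult.assoc mult.commute[of K])
    qed (use lipschitz_on_nonneg[OF f(2)] K(1) in auto)
  qed
qed

lemma bounded_lipschitz_on_diff:
  assumes "bounded_lipschitz_on S f" "bounded_lipschitz_on S g"
  shows "bounded_lipschitz_on S (\<lambda>x. f x - g x)"
  using bounded_lipschitz_on_add[OF assms(1)
      bounded_lipschitz_on_bounded_linear[OF assms(2) bounded_linear_minus[OF bounded_linear_ident]]]
  by simp

lemma bounded_lipschitz_on_sum:
  assumes "\<And>i. i \<in> I \<Longrightarrow> bounded_lipschitz_on S (f i)"
  shows "bounded_lipschitz_on S (\<lambda>x. \<Sum>i\<in>I. f i x)"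
  using assms
  by (induction I rule: infinite_finite_induct)
    (auto intro: bounded_lipschitz_on_const bounded_lipschitz_on_add)

lemma bounded_lipschitz_on_bilinear:
  assumes bil: "bounded_bilinear b" and "bounded_lipschitz_on S f" "bounded_lipschitz_on S g"
  shows "bounded_lipschitz_on S (\<lambda>x. b (f x) (g x))"
proof -
  interpret bounded_bilinear b by (rule bil)
  obtain B L where f: "0 \<le> B" "\<And>x. x \<in> S \<Longrightarrow> norm (f x) \<le> B" "0 \<le> L" "L-lipschitz_on S f"
    using bounded_lipschitz_onE[OF assms(2)] by metis
  obtain B' L' where g: "0 \<le> B'" "\<And>x. x \<in> S \<Longrightarrow> norm (g x) \<le> B'" "0 \<le> L'" "L'-lipschitz_on S g"
    using bounded_lipschitz_onE[OF assms(3)] by metis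
  obtain K where K: "0 < K" "\<And>x y. norm (b x y) \<le> norm x * norm y * K"
    using pos_bounded by blast
  have le: "norm (b v w) \<le> r * s * K" if "norm v \<le> r" "norm w \<le> s" "0 \<le> r" for v w r s
    by (rule order_trans[OF K(2)]) (intro mult_right_mono mult_mono; use that K(1) in simp)
  show ?thesis
  proof (rule bounded_lipschitz_onI)
    show "norm (b (f x) (g x)) \<le> B * B' * K" if "x \<in> S" for x
      using that f g by (intro le) auto
    show "((L * B' + B * L') * K)-lipschitz_on S (\<lambda>x. b (f x) (g x))"
    proof (rule lipschitz_onI)
      fix x y assume xy: "x \<in> S" "y \<in> S"
      have "b (f x) (g x) - b (f y) (g y) = b (f x - f y) (g x) + b (f y) (g x - g y)"
        by (simp add: diff_left diff_right)
      also have "norm \<dots> \<le> (L * dist x y) * B' * K + B * (L' * dist x y) * K"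
        using lipschitz_onD[OF f(4) xy] lipschitz_onD[OF g(4) xy] xy f g
        by (intro norm_triangle_mono le) (auto simp: dist_norm)
      finally show "dist (b (f x) (g x)) (b (f y) (g y)) \<le> (L * B' + B * L') * K * dist x y"
        by (simp add: dist_norm algebra_simps)
    qed (use f g K(1) in simp)
  qed
qed

text \<open>The cutoff at \<open>d\<close> is itself 1-Lipschitz, and above \<open>d\<close> the
  inverse has Lipschitz constant 1 / d^2.\<close>

lemma bounded_lipschitz_on_inverse_max:
  fixes d :: real
  assumes "bounded_lipschitz_on S f" and d: "0 < d"
  shows "bounded_lipschitz_on S (\<lambda>x. inverse (max d (f x)))"
proof -
  obtain B L where f: "0 \<le> L" "L-lipschitz_on S f"
    using bounded_lipschitz_onE[OF assms(1)] by metis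
  show ?thesis
  proof (rule bounded_lipschitz_onI)
    show "norm (inverse (max d (f x))) \<le> inverse d" for x
      using d by (simp add: le_imp_inverse_le)
    show "(inverse d * L * inverse d)-lipschitz_on S (\<lambda>x. inverse (max d (f x)))"
    proof (rule lipschitz_onI)
      fix x y assume xy: "x \<in> S" "y \<in> S"
      have "inverse (max d (f x)) - inverse (max d (f y))
          = inverse (max d (f x)) * (max d (f y) - max d (f x)) * inverse (max d (f y))"
        using d by (simp add: field_simps)
      then have "dist (inverse (max d (f x))) (inverse (max d (f y)))
          = \<bar>inverse (max d (f x))\<bar> * \<bar>max d (f y) - max d (f x)\<bar> * \<bar>inverse (max d (f y))\<bar>"
        by (simp add: dist_real_def abs_mult)
      also have "\<dots> \<le> inverse d * (L * dist x y) * inverse d"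
      proof (intro mult_mono)
        have "\<bar>max d (f y) - max d (f x)\<bar> \<le> dist (f x) (f y)" by (auto simp: dist_real_def)
        then show "\<bar>max d (f y) - max d (f x)\<bar> \<le> L * dist x y" using lipschitz_onD[OF f(2) xy] by simp
      qed (use d f in \<open>auto simp: le_imp_inverse_le\<close>)
      finally show "dist (inverse (max d (f x))) (inverse (max d (f y))) \<le> inverse d * L * inverse d * dist x y"
        by (simp add: mult_ac)
    qed (use d f in simp)
  qed
qed

section \<open>The lifted flow\<close>

definition single_coord :: "nat \<Rightarrow> complex^2^2 \<Rightarrow> (nat, complex^2^2) bcontfun" where
  "single_coord i A = Bcontfun (\<lambda>j. if j = i then A else 0)"

text \<open>As a finite sum of bounded linear maps of the coordinates, it lets continuity, Lipschitz
  bounds and derivatives pass through termwise.\<close>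

definition embed :: "nat \<Rightarrow> (nat \<Rightarrow> complex^2^2) \<Rightarrow> (nat, complex^2^2) bcontfun" where
  "embed n x = (\<Sum>i\<le>n. single_coord i (x i))"

lemma apply_single_coord: "apply_bcontfun (single_coord i A) j = (if j = i then A else 0)"
proof -
  have "(\<lambda>j. if j = i then A else 0) \<in> bcontfun"
    by (rule bcontfun_normI[of _ "norm A"]) (auto simp: continuous_on_def tendsto_def at_discrete)
  then show ?thesis by (simp add: single_coord_def Bcontfun_inverse)
qed

lemma bounded_linear_apply_bcontfun: "bounded_linear (\<lambda>w. apply_bcontfun w i)"
  by (rule bounded_linear_intro[of _ 1]) (auto simp: norm_bounded)

lemma bounded_linear_single_coord: "bounded_linear (single_coord i)"
  by (rule bounded_linear_intro[of _ 1])
    (auto intro!: bcontfun_eqI norm_bound simp: apply_single_coord)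

lemma apply_embed: "apply_bcontfun (embed n x) j = (if j \<le> n then x j else 0)"
proof -
  have "apply_bcontfun (embed n x) j = (\<Sum>i\<le>n. if j = i then x i else 0)"
    unfolding embed_def
    using linear_sum[OF bounded_linear.linear[OF bounded_linear_apply_bcontfun], of "\<lambda>i. single_coord i (x i)" "{..n}" j]
    by (simp add: apply_single_coord)
  then show ?thesis by simp
qed

text \<open>The sign \<open>\<sigma>\<close> is the direction of travel, and 1 or -1 when used.
  Where the energy is at least \<open>d\<close>, the product of the squares moves with velocity
  exactly \<open>\<sigma>\<close> times u from the left; the cutoff keeps the field Lipschitz
  elsewhere.\<close>

definition flow_vel :: "nat \<Rightarrow> real \<Rightarrow> real \<Rightarrow> (nat \<Rightarrow> complex^2^2) \<Rightarrow> nat \<Rightarrow> complex^2^2" where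
  "flow_vel n d \<sigma> x i =
     (\<sigma> * inverse (max d (trace_energy n x))) *\<^sub>R (sqrt_lift (frame x i) (x i) ** x i)"

definition flow_field :: "nat \<Rightarrow> real \<Rightarrow> real \<Rightarrow> (nat, complex^2^2) bcontfun \<Rightarrow> (nat, complex^2^2) bcontfun" where
  "flow_field n d \<sigma> w = embed n (flow_vel n d \<sigma> (apply_bcontfun w))"

lemma flow_field_uminus: "flow_field n d (- \<sigma>) w = - flow_field n d \<sigma> w"
  by (rule bcontfun_eqI) (simp add: flow_field_def flow_vel_def apply_embed)

lemma bounded_lipschitz_on_flow_field:
  assumes "0 < d"
  shows "bounded_lipschitz_on (cball 0 R) (flow_field n d \<sigma>)"
proof -
  let ?S = "cball 0 R :: (nat, complex^2^2) bcontfun set"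
  note bl = bounded_lipschitz_on_const bounded_lipschitz_on_add bounded_lipschitz_on_diff
    bounded_lipschitz_on_sum bounded_lipschitz_on_bilinear[OF matrix_mult.bounded_bilinear_axioms]
    bounded_lipschitz_on_bilinear[OF bounded_bilinear_scaleR]
    bounded_lipschitz_on_bilinear[OF bounded_bilinear_mult]
    bounded_lipschitz_on_inverse_max[OF _ assms]
  have w: "bounded_lipschitz_on ?S (\<lambda>w. apply_bcontfun w i)" for i
  proof (rule bounded_lipschitz_onI)
    show "norm (apply_bcontfun w i) \<le> R" if "w \<in> ?S" for w
      using norm_bounded[of w i] that by simp
    show "1-lipschitz_on ?S (\<lambda>w. apply_bcontfun w i)"
      by (rule lipschitz_onI) (simp_all add: dist_bounded)
  qed
  have ct: "bounded_lipschitz_on ?S (\<lambda>w. conj_transpose (f w))" if "bounded_lipschitz_on ?S f"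
    for f :: "_ \<Rightarrow> complex^2^2"
    by (rule bounded_lipschitz_on_bounded_linear[OF that bounded_linear_conj_transpose])
  have ht: "bounded_lipschitz_on ?S (\<lambda>w. half_trace (apply_bcontfun w i))" for i
    by (rule bounded_lipschitz_on_bounded_linear[OF w bounded_linear_half_trace])
  have P: "bounded_lipschitz_on ?S (\<lambda>w. sq_prod (apply_bcontfun w) i)" for i
    by (induction i) (simp_all, (intro bl w)+)
  have F: "bounded_lipschitz_on ?S (\<lambda>w. frame (apply_bcontfun w) i)" for i
    unfolding frame_def by (intro bl P ct)
  have E: "bounded_lipschitz_on ?S (\<lambda>w. trace_energy n (apply_bcontfun w))"
    unfolding trace_energy_def power2_eq_square by (intro bl ht)
  have "bounded_lipschitz_on ?S (\<lambda>w. flow_vel n d \<sigma> (apply_bcontfun w) i)" for i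
    unfolding flow_vel_def sqrt_lift_def divide_inverse by (intro bl w ct ht F E)
  then show ?thesis
    unfolding flow_field_def[abs_def] embed_def
    by (intro bl bounded_lipschitz_on_bounded_linear[OF _ bounded_linear_single_coord])
qed

section \<open>Quantities conserved by the lifted flow\<close>

lemma has_vector_derivative_zero_imp_const:
  fixes f :: "real \<Rightarrow> 'a::real_normed_vector"
  assumes "\<And>s. s \<in> {0..h} \<Longrightarrow> (f has_vector_derivative 0) (at s within {0..h})" "s \<in> {0..h}"
  shows "f s = f 0"
proof -
  have "\<exists>c. \<forall>x\<in>{0..h}. f x = c"
    using assms(1) by (intro has_derivative_zero_constant) (auto simp: has_vector_derivative_def)
  then show ?thesis using assms(2) by fastforce
qed

text \<open>Jacobi's formula; it shows that the determinant is conserved when \<open>X\<close> is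
  trace-free.\<close>

lemma has_vector_derivative_det:
  fixes f :: "real \<Rightarrow> complex^2^2"
  assumes "(f has_vector_derivative X ** f s) (at s within S)"
  shows "((\<lambda>s. det (f s)) has_vector_derivative trace X * det (f s)) (at s within S)"
proof -
  have e: "((\<lambda>s. f s $ i $ j) has_vector_derivative (X ** f s) $ i $ j) (at s within S)" for i j
    by (intro bounded_linear.has_vector_derivative[OF bounded_linear_vec_nth] assms)
  show ?thesis
    unfolding det_2
    by (rule has_vector_derivative_eq_rhs,
        rule has_vector_derivative_diff[OF has_vector_derivative_mult[OF e e] has_vector_derivative_mult[OF e e]])
      (simp add: matrix_matrix_mult_def sum_2 trace_def algebra_simps)
qed

lemma conj_transpose_frame: "conj_transpose (frame x i) = - frame x i"
  by (simp add: frame_def conj_transpose_mult conj_transpose_torus_gen matrix_mult_simps matrix_mul_assoc)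

lemma flow_coord_derivative:
  assumes "solves_ode_on (flow_field n d \<sigma>) N h y" "s \<in> {0..h}" "i \<le> n"
  shows "((\<lambda>s. apply_bcontfun (y s) i) has_vector_derivative
      flow_vel n d \<sigma> (apply_bcontfun (y s)) i) (at s within {0..h})"
  using bounded_linear.has_vector_derivative[OF bounded_linear_apply_bcontfun, of y _ "at s within {0..h}" i] assms
  by (fastforce simp: solves_ode_on_def flow_field_def apply_embed)

text \<open>This makes \<open>y h\<close> recoverable from its coordinates up to \<open>n\<close>,
  so that the reversed flow can start from the restricted tuple.\<close>

lemma flow_support:
  assumes "solves_ode_on (flow_field n d \<sigma>) N h y" "s \<in> {0..h}" "\<And>i. i > n \<Longrightarrow> apply_bcontfun (y 0) i = 0" "i > n"
  shows "apply_bcontfun (y s) i = 0"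
proof -
  have "((\<lambda>s. apply_bcontfun (y s) i) has_vector_derivative 0) (at s within {0..h})" if "s \<in> {0..h}" for s
    using bounded_linear.has_vector_derivative[OF bounded_linear_apply_bcontfun, of y _ "at s within {0..h}" i] assms that
    by (fastforce simp: solves_ode_on_def flow_field_def apply_embed)
  from has_vector_derivative_zero_imp_const[OF this assms(2)] show ?thesis using assms by simp
qed

text \<open>The order of the conservation laws is forced. Skewness gives unitarity of each
  coordinate; then the prefixes are unitary, so \<open>frame\<close> is conjugate to
  \<open>torus_gen\<close> and hence trace-free; only then does the determinant come out
  constant.\<close>

lemma flow_preserves_SU2:
  assumes y: "solves_ode_on (flow_field n d \<sigma>) N h y" and s: "s \<in> {0..h}"
    and y0: "\<And>i. i \<le> n \<Longrightarrow> apply_bcontfun (y 0) i \<in> carrier SU2" and i: "i \<le> n"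
  shows "apply_bcontfun (y s) i \<in> carrier SU2"
proof -
  define X where "X s i = (\<sigma> * inverse (max d (trace_energy n (apply_bcontfun (y s))))) *\<^sub>R
      sqrt_lift (frame (apply_bcontfun (y s)) i) (apply_bcontfun (y s) i)" for s i
  have X: "((\<lambda>s. apply_bcontfun (y s) i) has_vector_derivative X s i ** apply_bcontfun (y s) i) (at s within {0..h})"
    if "s \<in> {0..h}" "i \<le> n" for s i
    using flow_coord_derivative[OF y that] by (simp add: flow_vel_def X_def matrix_mult_simps)
  have skew: "conj_transpose (X s i) = - X s i" for s i
    by (simp add: X_def conj_transpose_linear sqrt_lift_skew conj_transpose_frame)
  have unitary: "conj_transpose (apply_bcontfun (y s) i) ** apply_bcontfun (y s) i = mat 1"
    if s: "s \<in> {0..h}" and i: "i \<le> n" for s i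
  proof -
    let ?f = "\<lambda>s. conj_transpose (apply_bcontfun (y s) i) ** apply_bcontfun (y s) i"
    have "(?f has_vector_derivative 0) (at s within {0..h})" if s: "s \<in> {0..h}" for s
      by (rule has_vector_derivative_eq_rhs,
          rule matrix_mult.has_vector_derivative[OF
            bounded_linear.has_vector_derivative[OF bounded_linear_conj_transpose X[OF s i]] X[OF s i]])
        (simp add: conj_transpose_mult skew matrix_mult_simps matrix_mul_assoc)
    from has_vector_derivative_zero_imp_const[OF this s] show ?thesis
      using y0[OF i] by (simp add: SU2_iff)
  qed
  have P: "P ** conj_transpose P = mat 1"
    if "P = sq_prod (apply_bcontfun (y s)) i" "s \<in> {0..h}" "i \<le> n" for P s i
    using that(1,3)
  proof (induction i arbitrary: P)
    case (Suc i)
    have u: "apply_bcontfun (y s) i ** conj_transpose (apply_bcontfun (y s) i) = mat 1"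
      using unitary[of s i] that Suc.prems by (simp add: matrix_left_right_inverse)
    have u': "apply_bcontfun (y s) i ** (conj_transpose (apply_bcontfun (y s) i) ** Z) = Z" for Z :: "complex^2^2"
      using u by (metis matrix_mul_assoc matrix_mul_lid)
    show ?case
      using Suc by (simp add: conj_transpose_mult u' flip: matrix_mul_assoc)
  qed simp
  have tr: "trace (X s i) = 0" if s: "s \<in> {0..h}" and i: "i \<le> n" for s i
  proof -
    define P where "P = sq_prod (apply_bcontfun (y s)) i"
    have "trace (frame (apply_bcontfun (y s)) i) = trace (torus_gen ** (P ** conj_transpose P))"
      unfolding frame_def P_def[symmetric] using trace_mul_sym[of "conj_transpose P" "torus_gen ** P"]
      by (simp add: matrix_mul_assoc)
    then have "trace (frame (apply_bcontfun (y s)) i) = 0"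
      using P[OF P_def s i] by (simp add: trace_torus_gen)
    then show ?thesis by (simp add: X_def trace_scaleR trace_sqrt_lift)
  qed
  have "((\<lambda>s. det (apply_bcontfun (y s) i)) has_vector_derivative 0) (at s within {0..h})" if "s \<in> {0..h}" for s
    using has_vector_derivative_det[OF X[OF that i]] tr[OF that i] by simp
  from has_vector_derivative_zero_imp_const[OF this s]
  show ?thesis using y0[OF i] unitary[OF s i] by (simp add: SU2_iff)
qed

text \<open>Induction on the length of the prefix P: the lift moves the next square A^2 with
  velocity proportional to \<tau>^2 P^-1 u P A^2, and multiplication by P turns this into \<tau>^2 u
  P A^2. Each factor thus adds its \<tau>^2 to the speed.\<close>

lemma flow_sq_prod_derivative:
  assumes y: "solves_ode_on (flow_field n d \<sigma>) N h y" and s: "s \<in> {0..h}"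
    and SU2: "\<And>i. i \<le> n \<Longrightarrow> apply_bcontfun (y s) i \<in> carrier SU2" and "m \<le> Suc n"
  shows "((\<lambda>s. sq_prod (apply_bcontfun (y s)) m) has_vector_derivative
      (\<sigma> * inverse (max d (trace_energy n (apply_bcontfun (y s)))) * (\<Sum>i<m. (half_trace (apply_bcontfun (y s) i))\<^sup>2)) *\<^sub>R
      (torus_gen ** sq_prod (apply_bcontfun (y s)) m)) (at s within {0..h})"
  using assms(4)
proof (induction m)
  case (Suc m)
  define k where "k = \<sigma> * inverse (max d (trace_energy n (apply_bcontfun (y s))))"
  define A where "A = apply_bcontfun (y s) m"
  define P where "P = sq_prod (apply_bcontfun (y s)) m"
  define \<xi> where "\<xi> = sqrt_lift (conj_transpose P ** torus_gen ** P) A"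
  have A: "A \<in> carrier SU2" and P: "P \<in> carrier SU2"
    using SU2 Suc.prems by (auto simp: A_def P_def intro!: sq_prod_closed)
  have dA: "((\<lambda>s. apply_bcontfun (y s) m) has_vector_derivative k *\<^sub>R (\<xi> ** A)) (at s within {0..h})"
    using flow_coord_derivative[OF y s, of m] Suc.prems
    by (simp add: flow_vel_def k_def \<xi>_def A_def P_def frame_def)
  have "A ** (k *\<^sub>R (\<xi> ** A)) + k *\<^sub>R (\<xi> ** A) ** A = k *\<^sub>R ((\<xi> ** A + A ** \<xi>) ** A)"
    by (simp add: matrix_mult_simps matrix_mul_assoc scaleR_add_right)
  also have "\<dots> = k *\<^sub>R ((half_trace A)\<^sup>2 *\<^sub>R (conj_transpose P ** (torus_gen ** (P ** (A ** A)))))"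
    by (simp add: \<xi>_def sqrt_lift_SU2[OF A] matrix_mult_simps matrix_mul_assoc)
  finally have dA2: "((\<lambda>s. apply_bcontfun (y s) m ** apply_bcontfun (y s) m) has_vector_derivative
      k *\<^sub>R ((half_trace A)\<^sup>2 *\<^sub>R (conj_transpose P ** (torus_gen ** (P ** (A ** A)))))) (at s within {0..h})"
    using matrix_mult.has_vector_derivative[OF dA dA] by (simp add: A_def)
  have "((\<lambda>s. sq_prod (apply_bcontfun (y s)) (Suc m)) has_vector_derivative
      P ** (k *\<^sub>R ((half_trace A)\<^sup>2 *\<^sub>R (conj_transpose P ** (torus_gen ** (P ** (A ** A)))))) +
      ((k * (\<Sum>i<m. (half_trace (apply_bcontfun (y s) i))\<^sup>2)) *\<^sub>R (torus_gen ** P)) ** (A ** A))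
      (at s within {0..h})"
    using matrix_mult.has_vector_derivative[OF Suc.IH dA2] Suc.prems by (simp add: k_def P_def A_def)
  moreover have "P ** (k *\<^sub>R ((half_trace A)\<^sup>2 *\<^sub>R (conj_transpose P ** (torus_gen ** (P ** (A ** A)))))) +
      ((k * S) *\<^sub>R (torus_gen ** P)) ** (A ** A) =
      (k * (S + (half_trace A)\<^sup>2)) *\<^sub>R (torus_gen ** (P ** (A ** A)))" for S
    by (simp add: matrix_mult_simps SU2_cancel[OF P] distrib_left scaleR_add_left flip: matrix_mul_assoc)
  ultimately show ?case by (simp add: k_def P_def A_def)
qed simp

text \<open>The cutoff is inactive as long as the product stays on the arc, and the product stays on
  the arc if it moves at the right speed. The circle is broken by the relative speed
  \<open>c\<close>, which lies between 0 and 1 in any case: the product may lag behind, but it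
  cannot leave the arc.\<close>

lemma flow_moves_torus_elt:
  assumes y: "solves_ode_on (flow_field n d \<sigma>) N h y" and s: "s \<in> {0..h}"
    and y0: "\<And>i. i \<le> n \<Longrightarrow> apply_bcontfun (y 0) i \<in> carrier SU2"
    and a: "sq_prod (apply_bcontfun (y 0)) (Suc n) = torus_elt a"
    and arc: "\<And>r. r \<in> {0..h} \<Longrightarrow>
      4 * real (Suc n) * e \<le> norm (torus_elt (a + \<sigma> * r) - (-1) ^ Suc n *\<^sub>R mat 1)"
    and e: "0 < e" and d: "d = e\<^sup>2"
  shows "sq_prod (apply_bcontfun (y s)) (Suc n) = torus_elt (a + \<sigma> * s)"
proof -
  define E where "E s = trace_energy n (apply_bcontfun (y s))" for s
  define c where "c s = inverse (max d (E s)) * E s" for s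
  define \<phi> where "\<phi> s = integral {0..s} c" for s
  have "0 < d" using e d by simp
  have SU2: "apply_bcontfun (y s) i \<in> carrier SU2" if "s \<in> {0..h}" "i \<le> n" for s i
    using flow_preserves_SU2[OF y that(1) y0 that(2)] .
  have E0: "0 \<le> E s" for s by (simp add: E_def trace_energy_def sum_nonneg)
  have c: "0 \<le> c s" "c s \<le> 1" for s
    using \<open>0 < d\<close> E0[of s] by (auto simp: c_def divide_simps)
  have cy: "continuous_on {0..h} (\<lambda>s. half_trace (apply_bcontfun (y s) i))" for i
    using solves_ode_on_continuous[OF y]
    by (intro bounded_linear.continuous_on[OF bounded_linear_half_trace]
        bounded_linear.continuous_on[OF bounded_linear_apply_bcontfun])
  have "continuous_on {0..h} c"
    unfolding c_def E_def trace_energy_def using \<open>0 < d\<close> by (intro continuous_intros cy) auto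
  then have \<phi>': "(\<phi> has_real_derivative c s) (at s within {0..h})" if "s \<in> {0..h}" for s
    unfolding \<phi>_def using that by (rule integral_has_real_derivative)
  have \<phi>: "\<phi> s \<in> {0..s}" if "s \<in> {0..h}" for s
  proof -
    have i: "c integrable_on {0..s}"
      using \<open>continuous_on {0..h} c\<close> that
      by (intro integrable_continuous_real) (auto elim: continuous_on_subset)
    have "\<phi> s \<le> integral {0..s} (\<lambda>_. 1)"
      unfolding \<phi>_def using c by (intro integral_le i) auto
    moreover have "0 \<le> \<phi> s" unfolding \<phi>_def using c by (intro integral_nonneg i) auto
    ultimately show ?thesis using that by simp
  qed
  \<comment> \<open>An integrating factor: multiplied by the torus element of the opposite angle,
    the product becomes constant in time.\<close>
  have Q: "sq_prod (apply_bcontfun (y s)) (Suc n) = torus_elt (a + \<sigma> * \<phi> s)" if s: "s \<in> {0..h}" for s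
  proof -
    let ?P = "\<lambda>s. sq_prod (apply_bcontfun (y s)) (Suc n)"
    let ?f = "\<lambda>s. torus_elt (- (\<sigma> * \<phi> s)) ** ?P s"
    have "(?f has_vector_derivative 0) (at s within {0..h})" if s: "s \<in> {0..h}" for s
    proof -
      have 1: "((\<lambda>s. - (\<sigma> * \<phi> s)) has_real_derivative - (\<sigma> * c s)) (at s within {0..h})"
        by (intro DERIV_minus DERIV_cmult \<phi>'[OF s])
      have 2: "(?P has_vector_derivative (\<sigma> * c s) *\<^sub>R (torus_gen ** ?P s)) (at s within {0..h})"
        using flow_sq_prod_derivative[OF y s SU2[OF s], of "Suc n"]
        by (simp add: c_def E_def trace_energy_def lessThan_Suc_atMost mult.assoc del: sq_prod.simps sum.lessThan_Suc)
      show ?thesis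
        by (rule has_vector_derivative_eq_rhs,
            rule matrix_mult.has_vector_derivative[OF has_vector_derivative_torus_elt[OF 1] 2])
          (simp add: matrix_mult_simps matrix_mul_assoc max_torus_commute(2)[OF torus_elt_closed]
            del: sq_prod.simps)
    qed
    from has_vector_derivative_zero_imp_const[OF this s]
    have "torus_elt (\<sigma> * \<phi> s) ** ?f s = torus_elt (\<sigma> * \<phi> s) ** torus_elt a"
      using a by (simp add: \<phi>_def del: sq_prod.simps)
    then show ?thesis
      by (simp add: matrix_mul_assoc torus_elt_add add.commute del: sq_prod.simps)
  qed
  \<comment> \<open>Since \<phi> s lies between 0 and s, the hypothesis on the arc applies at that
    angle and bounds the energy below by \<open>d\<close>.\<close>
  have "c s = 1" if s: "s \<in> {0..h}" for s
  proof -
    have "e\<^sup>2 \<le> E s"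
      unfolding E_def
    proof (rule trace_energy_bound)
      show "4 * real (Suc n) * e \<le> norm (sq_prod (apply_bcontfun (y s)) (Suc n) - (-1) ^ Suc n *\<^sub>R mat 1)"
        unfolding Q[OF s] using \<phi>[OF s] s by (intro arc) auto
    qed (use SU2 s e in auto)
    moreover from this have "0 < E s" using e by (smt (verit) zero_less_power)
    ultimately show ?thesis by (simp add: c_def d max_def)
  qed
  then have "\<phi> s = integral {0..s} (\<lambda>_. 1)"
    unfolding \<phi>_def using s by (intro integral_cong) auto
  then show ?thesis using Q[OF s] s by simp
qed

text \<open>
  Bounded functions on \<open>nat\<close> serve as a Banach space containing all the finite products of matrix
  spaces; the library proves completeness of bounded continuous functions only on metric domains.
\<close>

instantiation nat :: metric_space
begin

definition dist_nat :: "nat \<Rightarrow> nat \<Rightarrow> real" where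
  "dist_nat m n = \<bar>real m - real n\<bar>"

definition uniformity_nat :: "(nat \<times> nat) filter" where
  "uniformity_nat = (INF e\<in>{0<..}. principal {(x, y). dist x y < e})"

instance
proof
  fix U :: "nat set"
  have "x = y" if "\<bar>real x - real y\<bar> < 1" for x y using that by linarith
  then have "eventually (\<lambda>(x', y). x' = x \<longrightarrow> y \<in> U) uniformity" if "x \<in> U" for x
    unfolding uniformity_nat_def using that
    by (intro eventually_INF1[of 1]) (auto simp: eventually_principal dist_nat_def)
  then show "open U \<longleftrightarrow> (\<forall>x\<in>U. eventually (\<lambda>(x', y). x' = x \<longrightarrow> y \<in> U) uniformity)"
    by (auto simp: open_discrete)
qed (auto simp: dist_nat_def uniformity_nat_def)

end

instance bcontfun :: (metric_space, banach) banach ..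

section \<open>Moving the fibre\<close>

lemma conj_matrix_mult:
  assumes "t \<in> carrier SU2"
  shows "(t ** A ** conj_transpose t) ** (t ** B ** conj_transpose t) = t ** (A ** B) ** conj_transpose t"
  by (simp add: SU2_cancel[OF assms] flip: matrix_mul_assoc)

lemma half_trace_conj:
  assumes "t \<in> carrier SU2"
  shows "half_trace (t ** A ** conj_transpose t) = half_trace A"
  using trace_mul_sym[of "t ** A" "conj_transpose t"]
  by (simp add: half_trace_def SU2_cancel[OF assms] matrix_mul_assoc)

text \<open>Every ingredient of the field is natural under simultaneous conjugation except the fixed
  matrix \<open>torus_gen\<close>, which only commutes with T in general.\<close>

lemma flow_vel_conj:
  assumes t: "t \<in> max_torus"
  shows "flow_vel n d \<sigma> (\<lambda>i. t ** x i ** conj_transpose t) i = t ** flow_vel n d \<sigma> x i ** conj_transpose t"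
proof -
  have t': "t \<in> carrier SU2" using t by (rule max_torus_SU2)
  have "conj_transpose t ** torus_gen ** t = torus_gen"
    using max_torus_commute(2)[OF t] SU2_cancel[OF t'] by (metis matrix_mul_assoc matrix_mul_lid)
  then have tg: "conj_transpose t ** (torus_gen ** (t ** Z)) = torus_gen ** Z" for Z :: "complex^2^2"
    by (metis matrix_mul_assoc)
  have f: "frame (\<lambda>i. t ** x i ** conj_transpose t) i = t ** frame x i ** conj_transpose t"
    unfolding frame_def sq_prod_conj[OF t'] conj_transpose_mult
    by (simp add: tg flip: matrix_mul_assoc)
  have l: "sqrt_lift (t ** \<eta> ** conj_transpose t) (t ** A ** conj_transpose t)
      = t ** sqrt_lift \<eta> A ** conj_transpose t" for \<eta> A
  proof -
    have "t ** A ** conj_transpose t - conj_transpose (t ** A ** conj_transpose t)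
        = t ** (A - conj_transpose A) ** conj_transpose t"
      by (simp add: conj_transpose_mult matrix_mult_simps matrix_mul_assoc)
    then show ?thesis
      by (simp add: sqrt_lift_def half_trace_conj[OF t'] conj_matrix_mult[OF t'] matrix_mult_simps)
  qed
  show ?thesis
    unfolding flow_vel_def f l conj_matrix_mult[OF t'] trace_energy_def half_trace_conj[OF t']
    by (simp add: matrix_mult_simps)
qed

lemma flow_vel_cong:
  assumes "\<And>i. i \<le> n \<Longrightarrow> x i = y i" "i \<le> n"
  shows "flow_vel n d \<sigma> x i = flow_vel n d \<sigma> y i"
proof -
  have "sq_prod x i = sq_prod y i" using assms by (intro sq_prod_cong) auto
  then show ?thesis using assms by (simp add: flow_vel_def frame_def trace_energy_def)
qed

lemma embed_cong: "(\<And>i. i \<le> n \<Longrightarrow> x i = y i) \<Longrightarrow> embed n x = embed n y"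
  by (simp add: embed_def)

lemma norm_embed_le: "(\<And>i. i \<le> n \<Longrightarrow> x i \<in> carrier SU2) \<Longrightarrow> norm (embed n x) \<le> 2"
  by (rule norm_bound) (simp add: apply_embed norm_SU2_le)

text \<open>Combined with uniqueness, this makes the time-\<open>h\<close> map
  T-equivariant.\<close>

lemma flow_conj:
  assumes y: "solves_ode_on (flow_field n d \<sigma>) N h y" and t: "t \<in> max_torus"
    and SU2: "\<And>s i. s \<in> {0..h} \<Longrightarrow> i \<le> n \<Longrightarrow> apply_bcontfun (y s) i \<in> carrier SU2"
    and N: "cball 0 2 \<subseteq> N"
  shows "solves_ode_on (flow_field n d \<sigma>) N h
    (\<lambda>s. embed n (\<lambda>i. t ** apply_bcontfun (y s) i ** conj_transpose t))"
  unfolding solves_ode_on_def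
proof (intro ballI conjI)
  fix s assume s: "s \<in> {0..h}"
  have t': "t \<in> carrier SU2" using t by (rule max_torus_SU2)
  let ?z = "\<lambda>s. embed n (\<lambda>i. t ** apply_bcontfun (y s) i ** conj_transpose t)"
  have "norm (?z s) \<le> 2"
    by (intro norm_embed_le SU2_mult_closed SU2_conj_transpose_closed t' SU2[OF s])
  then show "?z s \<in> N" using N by auto
  have "(?z has_vector_derivative (\<Sum>i\<le>n. single_coord i
      (t ** flow_vel n d \<sigma> (apply_bcontfun (y s)) i ** conj_transpose t))) (at s within {0..h})"
    unfolding embed_def
    by (intro has_vector_derivative_sum bounded_linear.has_vector_derivative[OF bounded_linear_single_coord]
        bounded_linear.has_vector_derivative[OF matrix_mult.bounded_linear_left]
        bounded_linear.has_vector_derivative[OF matrix_mult.bounded_linear_right]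
        flow_coord_derivative[OF y s]) simp
  moreover have "flow_field n d \<sigma> (?z s) = (\<Sum>i\<le>n. single_coord i
      (t ** flow_vel n d \<sigma> (apply_bcontfun (y s)) i ** conj_transpose t))"
    unfolding flow_field_def embed_def[symmetric]
  proof (rule embed_cong)
    fix i assume i: "i \<le> n"
    have "flow_vel n d \<sigma> (apply_bcontfun (?z s)) i
        = flow_vel n d \<sigma> (\<lambda>i. t ** apply_bcontfun (y s) i ** conj_transpose t) i"
      by (rule flow_vel_cong) (use i in \<open>simp_all add: apply_embed\<close>)
    then show "flow_vel n d \<sigma> (apply_bcontfun (?z s)) i =
        t ** flow_vel n d \<sigma> (apply_bcontfun (y s)) i ** conj_transpose t"
      by (simp add: flow_vel_conj[OF t])
  qed
  ultimately show "(?z has_vector_derivative flow_field n d \<sigma> (?z s)) (at s within {0..h})" by simp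
qed

lemma topspace_SU2_top [simp]: "topspace SU2_top = carrier SU2"
  by (simp add: SU2_top_def)

lemma topspace_X_space:
  "topspace (X_space n C) = {x \<in> {0..n} \<rightarrow>\<^sub>E carrier SU2. sq_prod x (Suc n) \<in> C}"
  by (auto simp: X_space_def square_word_eq)

lemma continuous_map_X_space_coord:
  assumes "i \<le> n"
  shows "continuous_map (X_space n C) SU2_top (\<lambda>x. x i)"
  unfolding X_space_def using assms
  by (intro continuous_map_from_subtopology continuous_map_product_projection) simp

lemma continuous_map_SU2_top_euclidean:
  "continuous_map X SU2_top f \<Longrightarrow> continuous_map X euclidean f"
  by (auto simp: SU2_top_def continuous_map_in_subtopology)

lemma continuous_map_into_X_space:
  assumes "\<And>i. i \<le> n \<Longrightarrow> continuous_map Z euclidean (\<lambda>z. f z i)"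
    and "f \<in> topspace Z \<rightarrow> topspace (X_space n C)"
  shows "continuous_map Z (X_space n C) f"
proof -
  have f: "f z \<in> {0..n} \<rightarrow>\<^sub>E carrier SU2" "square_word n (f z) \<in> C" if "z \<in> topspace Z" for z
    using assms(2) that by (auto simp: topspace_X_space square_word_eq simp del: sq_prod.simps)
  have "continuous_map Z SU2_top (\<lambda>z. f z i)" if "i \<in> {0..n}" for i
    using assms(1)[of i] PiE_mem[OF f(1) that] that
    by (auto simp: SU2_top_def continuous_map_in_subtopology)
  then show ?thesis
    using f by (auto simp: X_space_def continuous_map_in_subtopology continuous_map_componentwise PiE_def)
qed

lemma simultaneous_conjugation_eq:
  "t \<in> carrier SU2 \<Longrightarrow> simultaneous_conjugation n t x = (\<lambda>i\<in>{0..n}. t ** x i ** conj_transpose t)"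
  by (simp add: simultaneous_conjugation_def conjugation_eq)

section \<open>Equivariant transport between fibres over the torus\<close>

lemma equivariant_homeomorphic_refl: "equivariant_homeomorphic G X \<alpha> X \<alpha>"
  unfolding equivariant_homeomorphic_def by (intro exI[of _ id]) (simp add: homeomorphic_map_id)

lemma equivariant_homeomorphic_trans:
  assumes "equivariant_homeomorphic G X \<alpha> Y \<beta>" "equivariant_homeomorphic G Y \<beta> Z \<gamma>"
  shows "equivariant_homeomorphic G X \<alpha> Z \<gamma>"
proof -
  obtain f g where f: "homeomorphic_map X Y f" "\<And>k x. k \<in> carrier G \<Longrightarrow> x \<in> topspace X \<Longrightarrow> f (\<alpha> k x) = \<beta> k (f x)"
    and g: "homeomorphic_map Y Z g" "\<And>k x. k \<in> carrier G \<Longrightarrow> x \<in> topspace Y \<Longrightarrow> g (\<beta> k x) = \<gamma> k (g x)"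
    using assms unfolding equivariant_homeomorphic_def by metis
  have "f x \<in> topspace Y" if "x \<in> topspace X" for x
    using homeomorphic_imp_surjective_map[OF f(1)] that by blast
  then show ?thesis
    unfolding equivariant_homeomorphic_def
    by (intro exI[of _ "g \<circ> f"]) (simp add: homeomorphic_map_compose[OF f(1) g(1)] f(2) g(2))
qed

abbreviation torus_fibre :: "nat \<Rightarrow> real \<Rightarrow> (nat \<Rightarrow> complex^2^2) topology" where
  "torus_fibre n a \<equiv> X_space n {torus_elt a}"

text \<open>The homeomorphism is the time-\<open>h\<close> map of the flow, and its inverse is the
  one for \<open>- \<sigma>\<close>. The length \<open>h0\<close> is fixed before \<open>a\<close>,
  so that it serves along a whole arc.\<close>

lemma equivariant_homeomorphic_step:
  assumes e: "0 < e"
  obtains h0 where "0 < h0"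
    "\<And>\<sigma> a h. \<bar>\<sigma>\<bar> = 1 \<Longrightarrow> 0 \<le> h \<Longrightarrow> h \<le> h0 \<Longrightarrow>
      (\<And>r. r \<in> {0..h} \<Longrightarrow> 4 * real (Suc n) * e \<le> norm (torus_elt (a + \<sigma> * r) - (-1) ^ Suc n *\<^sub>R mat 1)) \<Longrightarrow>
      equivariant_homeomorphic torus_group (torus_fibre n a) (simultaneous_conjugation n)
        (torus_fibre n (a + \<sigma> * h)) (simultaneous_conjugation n)"
proof -
  define d where "d = e\<^sup>2"
  \<comment> \<open>Radius 3 leaves room for the unit balls about the embedded tuples, which have
    norm at most 2.\<close>
  define N where "N = (cball 0 3 :: (nat, complex^2^2) bcontfun set)"
  define V where "V \<sigma> = flow_field n d \<sigma>" for \<sigma>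
  have "0 < d" using e by (simp add: d_def)
  then obtain M L where M: "0 \<le> M" "\<And>w. w \<in> N \<Longrightarrow> norm (V 1 w) \<le> M" and L: "0 \<le> L" "L-lipschitz_on N (V 1)"
    using bounded_lipschitz_onE[OF bounded_lipschitz_on_flow_field] unfolding N_def V_def by metis
  \<comment> \<open>Small enough for \<open>h * M \<le> 1\<close> and \<open>h * L \<le> 1/2\<close>
    at once.\<close>
  define h0 where "h0 = 1 / (2 * (1 + M + L))"
  have "0 < h0" using M L by (simp add: h0_def)
  moreover have "equivariant_homeomorphic torus_group (torus_fibre n a) (simultaneous_conjugation n)
        (torus_fibre n (a + \<sigma> * h)) (simultaneous_conjugation n)"
    if \<sigma>: "\<bar>\<sigma>\<bar> = 1" and h: "0 \<le> h" "h \<le> h0"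
      and arc: "\<And>r. r \<in> {0..h} \<Longrightarrow> 4 * real (Suc n) * e \<le> norm (torus_elt (a + \<sigma> * r) - (-1) ^ Suc n *\<^sub>R mat 1)"
    for \<sigma> a h
  proof -
    have hh: "0 \<in> {0..h}" "h \<in> {0..h}" using h by auto
    have hM: "h * M \<le> 1" "h * L \<le> 1 / 2"
    proof -
      have "h * (2 * (1 + M + L)) \<le> 1"
        using h M L by (simp add: h0_def pos_le_divide_eq)
      moreover have "0 \<le> h * M" "0 \<le> h * L" using h M L by auto
      ultimately show "h * M \<le> 1" "h * L \<le> 1 / 2" using h by (auto simp: algebra_simps)
    qed
    have V: "norm (V \<tau> w) \<le> M" "L-lipschitz_on N (V \<tau>)" if "\<bar>\<tau>\<bar> = 1" "w \<in> N" for \<tau> w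
    proof -
      have "\<tau> = 1 \<or> \<tau> = -1" using that(1) by linarith
      moreover have "V (-1) = (\<lambda>w. - V 1 w)" by (simp add: V_def fun_eq_iff flow_field_uminus)
      ultimately show "norm (V \<tau> w) \<le> M" "L-lipschitz_on N (V \<tau>)" using M L that(2) by auto
    qed
    have "0 \<in> N" by (simp add: N_def)
    note lip = V(2)[OF _ \<open>0 \<in> N\<close>]
    \<comment> \<open>A solution is merely chosen here; uniqueness later identifies it with reversed
      and conjugated curves.\<close>
    define S where "S \<tau> w = (SOME y. y 0 = w \<and> solves_ode_on (V \<tau>) N h y)" for \<tau> w
    have S: "S \<tau> w 0 = w \<and> solves_ode_on (V \<tau>) N h (S \<tau> w)" if "\<bar>\<tau>\<bar> = 1" "norm w \<le> 2" for \<tau> w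
    proof -
      note \<tau>w = that
      have "cball w 1 \<subseteq> N"
      proof
        fix v assume "v \<in> cball w 1"
        then have "norm v \<le> norm w + 1"
          using norm_triangle_ineq4[of w "w - v"] by (simp add: dist_norm)
        then show "v \<in> N" using that(2) by (simp add: N_def)
      qed
      then have "\<exists>y. y 0 = w \<and> solves_ode_on (V \<tau>) N h y"
        using solves_ode_on_exists[of w N L "V \<tau>" M h] lip[OF \<tau>w(1)] V(1)[OF \<tau>w(1)] h(1) hM by metis
      then show ?thesis unfolding S_def by (rule someI_ex)
    qed
    define F where "F \<tau> x = (\<lambda>i\<in>{0..n}. apply_bcontfun (S \<tau> (embed n x) h) i)" for \<tau> x
    \<comment> \<open>The condition is symmetric under exchanging the ends of the arc and the
      direction, so what follows applies to the map and to its inverse.\<close>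
    define good where "good \<tau> b \<longleftrightarrow> (\<forall>r\<in>{0..h}. 4 * real (Suc n) * e \<le>
        norm (torus_elt (b + \<tau> * r) - (-1) ^ Suc n *\<^sub>R mat 1))" for \<tau> b
    have main: "F \<tau> x \<in> topspace (torus_fibre n (b + \<tau> * h)) \<and> F (- \<tau>) (F \<tau> x) = x \<and>
        (\<forall>t\<in>max_torus. F \<tau> (simultaneous_conjugation n t x) = simultaneous_conjugation n t (F \<tau> x))"
      if \<tau>: "\<bar>\<tau>\<bar> = 1" and g: "good \<tau> b" and x: "x \<in> topspace (torus_fibre n b)" for \<tau> b x
    proof -
      define y where "y = S \<tau> (embed n x)"
      have x': "x \<in> {0..n} \<rightarrow>\<^sub>E carrier SU2" "sq_prod x (Suc n) = torus_elt b"
        using x by (auto simp: topspace_X_space)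
      have xc: "x i \<in> carrier SU2" if "i \<le> n" for i using x' that by auto
      have y: "y 0 = embed n x" "solves_ode_on (V \<tau>) N h y"
        using S[OF \<tau> norm_embed_le[OF xc]] by (auto simp: y_def)
      note y2 = y(2)[unfolded V_def]
      have y0: "apply_bcontfun (y 0) i \<in> carrier SU2" if "i \<le> n" for i
        using that by (simp add: y(1) apply_embed xc)
      have yc: "apply_bcontfun (y s) i \<in> carrier SU2" if "s \<in> {0..h}" "i \<le> n" for s i
        by (rule flow_preserves_SU2[OF y2 that(1) y0 that(2)])
      have Fy: "F \<tau> x = (\<lambda>i\<in>{0..n}. apply_bcontfun (y h) i)" by (simp add: F_def y_def)
      have emb: "embed n (F \<tau> x) = y h"
        using flow_support[OF y2 hh(2)] by (intro bcontfun_eqI) (simp add: apply_embed Fy y(1))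
      have "sq_prod (apply_bcontfun (y 0)) (Suc n) = sq_prod x (Suc n)"
        by (rule sq_prod_cong) (simp add: y(1) apply_embed)
      then have "sq_prod (apply_bcontfun (y h)) (Suc n) = torus_elt (b + \<tau> * h)"
        using g x'(2) e by (intro flow_moves_torus_elt[OF y2 hh(2) y0]) (auto simp: good_def d_def simp del: sq_prod.simps)
      moreover have "sq_prod (F \<tau> x) (Suc n) = sq_prod (apply_bcontfun (y h)) (Suc n)"
        by (rule sq_prod_cong) (simp add: Fy)
      ultimately have 1: "F \<tau> x \<in> topspace (torus_fibre n (b + \<tau> * h))"
        using yc[OF hh(2)] by (auto simp: topspace_X_space Fy simp del: sq_prod.simps)
      have "norm (y h) \<le> 2"
        unfolding emb[symmetric] by (rule norm_embed_le) (use yc[OF hh(2)] in \<open>simp add: Fy\<close>)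
      then have S': "S (- \<tau>) (y h) 0 = y h" "solves_ode_on (V (- \<tau>)) N h (S (- \<tau>) (y h))"
        using S[of "- \<tau>" "y h"] \<tau> by auto
      have rev: "solves_ode_on (V (- \<tau>)) N h (\<lambda>s. y (h - s))"
        using solves_ode_on_reverse[OF y(2)] by (simp add: V_def flow_field_uminus[abs_def])
      have "S (- \<tau>) (y h) h = y (h - h)"
        using solves_ode_on_unique[OF lip hM(2) S'(2) rev _ hh(2)] \<tau> S'(1) by simp
      then have inv: "apply_bcontfun (S (- \<tau>) (embed n (F \<tau> x)) h) i = (if i \<le> n then x i else 0)" for i
        by (simp add: emb y(1) apply_embed)
      have 2: "F (- \<tau>) (F \<tau> x) = x"
      proof
        fix i
        show "F (- \<tau>) (F \<tau> x) i = x i"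
          using PiE_arb[OF x'(1), of i] by (simp add: F_def[of "- \<tau>" "F \<tau> x"] inv)
      qed
      have 3: "F \<tau> (simultaneous_conjugation n t x) = simultaneous_conjugation n t (F \<tau> x)"
        if t: "t \<in> max_torus" for t
      proof -
        have t': "t \<in> carrier SU2" using t by (rule max_torus_SU2)
        define z where "z s = embed n (\<lambda>i. t ** apply_bcontfun (y s) i ** conj_transpose t)" for s
        have z: "solves_ode_on (V \<tau>) N h z"
          unfolding z_def V_def by (rule flow_conj[OF y2 t yc]) (auto simp: N_def)
        define w where "w = embed n (simultaneous_conjugation n t x)"
        have z0: "z 0 = w"
          unfolding z_def w_def by (rule embed_cong) (simp add: y(1) apply_embed simultaneous_conjugation_eq[OF t'])
        have "norm w \<le> 2"
          unfolding w_def
          by (rule norm_embed_le) (simp add: simultaneous_conjugation_eq[OF t'] xc t' SU2_mult_closed SU2_conj_transpose_closed)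
        then have Sw: "S \<tau> w 0 = w" "solves_ode_on (V \<tau>) N h (S \<tau> w)" using S \<tau> by auto
        have "S \<tau> w h = z h"
          using solves_ode_on_unique[OF lip[OF \<tau>] hM(2) Sw(2) z _ hh(2)] Sw(1) z0 by simp
        then show ?thesis
          unfolding F_def[of _ "simultaneous_conjugation n t x"] w_def[symmetric]
          by (auto simp: z_def apply_embed simultaneous_conjugation_eq[OF t'] Fy fun_eq_iff)
      qed
      show ?thesis using 1 2 3 by blast
    qed
    have cont: "continuous_map (torus_fibre n b) (torus_fibre n (b + \<tau> * h)) (F \<tau>)"
      if \<tau>: "\<bar>\<tau>\<bar> = 1" and g: "good \<tau> b" for \<tau> b
    proof (rule continuous_map_into_X_space)
      show "F \<tau> \<in> topspace (torus_fibre n b) \<rightarrow> topspace (torus_fibre n (b + \<tau> * h))"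
        using main[OF \<tau> g] by blast
      fix i assume "i \<le> n"
      \<comment> \<open>The stability estimate, read as a Lipschitz bound in the initial
        value.\<close>
      have "2-lipschitz_on (cball 0 2) (\<lambda>w. S \<tau> w h)"
        using solves_ode_on_stability[OF lip[OF \<tau>] hM(2) _ _ hh(2)] S[OF \<tau>]
        by (intro lipschitz_onI) (metis mem_cball_0, simp)
      then have "continuous_on (cball 0 2) (\<lambda>w. S \<tau> w h)" by (rule lipschitz_on_continuous_on)
      then have S_cont: "continuous_map (top_of_set (cball 0 2)) euclidean (\<lambda>w. apply_bcontfun (S \<tau> w h) i)"
        by (simp add: bounded_linear.continuous_on[OF bounded_linear_apply_bcontfun])
      have embed_cont: "continuous_map (torus_fibre n b) (top_of_set (cball 0 2)) (embed n)"
        unfolding continuous_map_in_subtopology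
      proof
        have "continuous_map (torus_fibre n b) euclidean (\<lambda>x. single_coord j (x j))" if "j \<in> {..n}" for j
        proof -
          have s: "continuous_map euclidean euclidean (single_coord j)"
            using bounded_linear.continuous_on[OF bounded_linear_single_coord continuous_on_id] by simp
          have "continuous_map (torus_fibre n b) euclidean (\<lambda>x. x j)"
            using that by (intro continuous_map_SU2_top_euclidean continuous_map_X_space_coord) simp
          from continuous_map_compose[OF this s] show ?thesis by (simp add: o_def)
        qed
        then show "continuous_map (torus_fibre n b) euclidean (embed n)"
          unfolding embed_def[abs_def] by (intro continuous_map_sum) auto
        show "embed n \<in> topspace (torus_fibre n b) \<rightarrow> cball 0 2"
        proof
          fix x assume "x \<in> topspace (torus_fibre n b)"
          then have "x i \<in> carrier SU2" if "i \<le> n" for i using that by (auto simp: topspace_X_space)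
          then show "embed n x \<in> cball 0 2" by (simp add: norm_embed_le)
        qed
      qed
      have "continuous_map (torus_fibre n b) euclidean (\<lambda>x. apply_bcontfun (S \<tau> (embed n x) h) i)"
        using continuous_map_compose[OF embed_cont S_cont] by (simp add: o_def)
      then show "continuous_map (torus_fibre n b) euclidean (\<lambda>x. F \<tau> x i)"
        using \<open>i \<le> n\<close> by (simp add: F_def)
    qed
    have g1: "good \<sigma> a" using arc by (auto simp: good_def)
    have g2: "good (- \<sigma>) (a + \<sigma> * h)"
      unfolding good_def
    proof
      fix r assume "r \<in> {0..h}"
      then have "h - r \<in> {0..h}" by auto
      from arc[OF this] show "4 * real (Suc n) * e \<le>
          norm (torus_elt (a + \<sigma> * h + - \<sigma> * r) - (-1) ^ Suc n *\<^sub>R mat 1)"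
        by (simp add: algebra_simps)
    qed
    have \<sigma>': "\<bar>- \<sigma>\<bar> = 1" using \<sigma> by simp
    have "homeomorphic_maps (torus_fibre n a) (torus_fibre n (a + \<sigma> * h)) (F \<sigma>) (F (- \<sigma>))"
      using cont[OF \<sigma> g1] cont[OF \<sigma>' g2] main[OF \<sigma> g1] main[OF \<sigma>' g2]
      by (simp add: homeomorphic_maps_def)
    then have "homeomorphic_map (torus_fibre n a) (torus_fibre n (a + \<sigma> * h)) (F \<sigma>)"
      by (rule homeomorphic_maps_imp_map)
    then show ?thesis
      unfolding equivariant_homeomorphic_def using main[OF \<sigma> g1] by (intro exI[of _ "F \<sigma>"]) simp
  qed
  ultimately show thesis by (rule that)
qed

lemma equivariant_homeomorphic_arc:
  assumes e: "0 < e" and \<sigma>: "\<bar>\<sigma>\<bar> = 1" and l: "0 \<le> l"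
    and arc: "\<And>r. r \<in> {0..l} \<Longrightarrow> 4 * real (Suc n) * e \<le> norm (torus_elt (a + \<sigma> * r) - (-1) ^ Suc n *\<^sub>R mat 1)"
  shows "equivariant_homeomorphic torus_group (torus_fibre n a) (simultaneous_conjugation n)
    (torus_fibre n (a + \<sigma> * l)) (simultaneous_conjugation n)"
proof -
  obtain h0 where h0: "0 < h0"
    "\<And>\<sigma> a h. \<bar>\<sigma>\<bar> = 1 \<Longrightarrow> 0 \<le> h \<Longrightarrow> h \<le> h0 \<Longrightarrow>
      (\<And>r. r \<in> {0..h} \<Longrightarrow> 4 * real (Suc n) * e \<le> norm (torus_elt (a + \<sigma> * r) - (-1) ^ Suc n *\<^sub>R mat 1)) \<Longrightarrow>
      equivariant_homeomorphic torus_group (torus_fibre n a) (simultaneous_conjugation n)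
        (torus_fibre n (a + \<sigma> * h)) (simultaneous_conjugation n)"
    using equivariant_homeomorphic_step[OF e, of n] by metis
  obtain m where m: "l / h0 < real m" using reals_Archimedean2 by blast
  then have "0 < m" using l h0(1) by (cases m) (auto simp: divide_less_0_iff)
  define h where "h = l / real m"
  have h: "0 \<le> h" "h \<le> h0" "real m * h = l"
    using m l h0(1) \<open>0 < m\<close> by (auto simp: h_def field_simps)
  have "equivariant_homeomorphic torus_group (torus_fibre n a) (simultaneous_conjugation n)
    (torus_fibre n (a + \<sigma> * (real k * h))) (simultaneous_conjugation n)" if "k \<le> m" for k
    using that
  proof (induction k)
    case 0
    then show ?case by (simp add: equivariant_homeomorphic_refl)
  next
    case (Suc k)
    have "real (Suc k) * h \<le> real m * h" using Suc.prems h(1) by (intro mult_right_mono) auto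
    then have k: "real k * h + h \<le> l" using h(3) by (simp add: distrib_right)
    have "equivariant_homeomorphic torus_group (torus_fibre n (a + \<sigma> * (real k * h))) (simultaneous_conjugation n)
      (torus_fibre n (a + \<sigma> * (real k * h) + \<sigma> * h)) (simultaneous_conjugation n)"
    proof (rule h0(2)[OF \<sigma> h(1,2)])
      fix r assume "r \<in> {0..h}"
      then have "real k * h + r \<in> {0..l}" using k h(1) by auto
      from arc[OF this] show "4 * real (Suc n) * e \<le>
          norm (torus_elt (a + \<sigma> * (real k * h) + \<sigma> * r) - (-1) ^ Suc n *\<^sub>R mat 1)"
        by (simp add: distrib_left add.assoc)
    qed
    then have "equivariant_homeomorphic torus_group (torus_fibre n (a + \<sigma> * (real k * h))) (simultaneous_conjugation n)
      (torus_fibre n (a + \<sigma> * (real (Suc k) * h))) (simultaneous_conjugation n)"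
      by (simp add: algebra_simps)
    with Suc show ?case by (auto intro: equivariant_homeomorphic_trans)
  qed
  from this[of m] show ?thesis using h(3) by simp
qed

lemma pow_neg_one: "(- mat 1) [^]\<^bsub>SU2\<^esub> n = (-1) ^ n *\<^sub>R mat 1"
  by (induction n) (simp_all add: matrix_mult_simps)

lemma torus_elt_multiple_pi: "torus_elt (real n * pi) = (-1) ^ n *\<^sub>R mat 1"
  by (simp add: torus_elt_eq_cos_sin)

lemma Xr_space_eq: "Xr_space n = torus_fibre n (real n * pi)"
  by (simp add: Xr_space_def pow_neg_one torus_elt_multiple_pi)

text \<open>Here \<open>b\<close> is an angle of (-1)^n and \<open>c\<close> the signed angle from
  it to \<open>a\<close>. As sin a is nonzero, \<open>c\<close> is not pi, so the arc from
  \<open>b + c\<close> back to \<open>b\<close> misses the antipode (-1)^(n+1).\<close>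

lemma torus_fibre_equivariant_homeomorphic:
  assumes "sin a \<noteq> 0"
  shows "equivariant_homeomorphic torus_group (torus_fibre n a) (simultaneous_conjugation n)
    (Xr_space n) (simultaneous_conjugation n)"
proof -
  define b where "b = real n * pi"
  define c where "c = Arg (cis (a - b))"
  have cis_c: "cis c = cis (a - b)" using cis_Arg[of "cis (a - b)"] by (simp add: c_def sgn_eq)
  have "\<bar>c\<bar> < pi"
  proof -
    have "c \<noteq> pi"
    proof
      assume "c = pi"
      then have "sin (a - b) = 0" using arg_cong[OF cis_c, of Im] by simp
      moreover have "sin (a - b) = sin a * (-1) ^ n" by (simp add: sin_diff b_def)
      ultimately show False using assms by simp
    qed
    then show ?thesis using Arg_bounded[of "cis (a - b)"] by (auto simp: c_def)
  qed
  have "cis (b + c) = cis a" using cis_c by (simp add: cis_mult[symmetric]) (simp add: cis_mult)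
  then have bc: "torus_elt (b + c) = torus_elt a" by (simp add: torus_elt_eq_iff)
  define \<sigma> where "\<sigma> = (if c < 0 then 1 else -1 :: real)"
  have \<sigma>: "\<bar>\<sigma>\<bar> = 1" "c + \<sigma> * \<bar>c\<bar> = 0" by (auto simp: \<sigma>_def)
  define f where "f r = norm (torus_elt (b + c + \<sigma> * r) - (-1) ^ Suc n *\<^sub>R mat 1)" for r
  have pos: "0 < f r" if "r \<in> {0..\<bar>c\<bar>}" for r
  proof -
    define \<phi> where "\<phi> = c + \<sigma> * r"
    have "\<bar>\<phi>\<bar> < pi" using that \<open>\<bar>c\<bar> < pi\<close> by (auto simp: \<phi>_def \<sigma>_def split: if_splits)
    have "torus_elt (b + \<phi>) \<noteq> torus_elt (real (Suc n) * pi)"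
    proof
      assume "torus_elt (b + \<phi>) = torus_elt (real (Suc n) * pi)"
      moreover have "real (Suc n) * pi = b + pi" by (simp add: b_def distrib_right)
      ultimately have "cis b * cis \<phi> = cis b * cis pi" by (simp only: torus_elt_eq_iff cis_mult)
      then have "cis \<phi> = cis pi" by (rule mult_left_cancel[OF cis_neq_zero, THEN iffD1])
      then have "cos \<phi> = -1" by (simp add: complex_eq_iff)
      moreover have "cos \<phi> \<noteq> cos pi"
        using \<open>\<bar>\<phi>\<bar> < pi\<close> cos_monotone_0_pi[of "\<bar>\<phi>\<bar>" pi] by simp
      ultimately show False by simp
    qed
    then show ?thesis
      unfolding f_def torus_elt_multiple_pi[symmetric] by (simp add: \<phi>_def add.assoc)
  qed
  have "continuous_on {0..\<bar>c\<bar>} f"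
    unfolding f_def torus_elt_eq_cos_sin by (intro continuous_intros)
  then obtain r0 where r0: "r0 \<in> {0..\<bar>c\<bar>}" "\<And>r. r \<in> {0..\<bar>c\<bar>} \<Longrightarrow> f r0 \<le> f r"
    using continuous_attains_inf[of "{0..\<bar>c\<bar>}" f] by auto
  \<comment> \<open>The least distance from the arc to the antipode, positive by compactness, in the
    normalization 4 (n + 1) e of the flow estimate.\<close>
  define e where "e = f r0 / (4 * real (Suc n))"
  have "0 < e" using pos[OF r0(1)] by (simp add: e_def)
  have "4 * real (Suc n) * e = f r0"
    unfolding e_def by (rule nonzero_mult_div_cancel_left[THEN trans[rotated]]) auto
  then have "equivariant_homeomorphic torus_group (torus_fibre n (b + c)) (simultaneous_conjugation n)
      (torus_fibre n (b + c + \<sigma> * \<bar>c\<bar>)) (simultaneous_conjugation n)"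
    using r0(2) by (intro equivariant_homeomorphic_arc[OF \<open>0 < e\<close> \<sigma>(1)]) (auto simp: f_def)
  moreover have "b + c + \<sigma> * \<bar>c\<bar> = b" using \<sigma>(2) by linarith
  ultimately show ?thesis by (simp only: bc Xr_space_eq flip: b_def)
qed

section \<open>Quotients\<close>

text \<open>The induced map is a quotient map because \<open>p\<close> and \<open>q\<close> are, and
  an injective quotient map is a homeomorphism. Both homeomorphisms of the theorem arise in this
  way.\<close>

lemma quotient_maps_same_fibres:
  assumes p: "quotient_map Z X p" and q: "quotient_map Z W q"
    and fib: "\<And>z z'. z \<in> topspace Z \<Longrightarrow> z' \<in> topspace Z \<Longrightarrow> p z = p z' \<longleftrightarrow> q z = q z'"
  obtains \<theta> where "homeomorphic_map X W \<theta>" "\<And>z. z \<in> topspace Z \<Longrightarrow> \<theta> (p z) = q z"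
proof -
  define \<theta> where "\<theta> x = q (SOME z. z \<in> topspace Z \<and> p z = x)" for x
  have \<theta>: "\<theta> (p z) = q z" if "z \<in> topspace Z" for z
  proof -
    have "\<exists>z'. z' \<in> topspace Z \<and> p z' = p z" using that by blast
    from someI_ex[OF this] show ?thesis unfolding \<theta>_def using fib that by metis
  qed
  have "quotient_map Z W (\<theta> \<circ> p)" using quotient_map_eq[OF q, of "\<theta> \<circ> p"] \<theta> by simp
  then have "quotient_map X W \<theta>" using quotient_map_compose_eq[OF p] by blast
  moreover have "inj_on \<theta> (topspace X)"
  proof (rule inj_onI)
    fix x x' assume "x \<in> topspace X" "x' \<in> topspace X" "\<theta> x = \<theta> x'"
    moreover from this obtain z z' where "z \<in> topspace Z" "z' \<in> topspace Z" "x = p z" "x' = p z'"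
      using quotient_imp_surjective_map[OF p] by blast
    ultimately show "x = x'" using \<theta> fib by metis
  qed
  ultimately show thesis using that[OF _ \<theta>] by (simp add: homeomorphic_map_def)
qed

text \<open>The action laws are asked only at the two points concerned: simultaneous conjugation
  restricts tuples, so its unit law holds on the spaces but not on all functions.\<close>

lemma orbit_eq_iff:
  assumes G: "group G"
    and act: "\<And>g h z. g \<in> carrier G \<Longrightarrow> h \<in> carrier G \<Longrightarrow> z \<in> {x, y} \<Longrightarrow> \<phi> g (\<phi> h z) = \<phi> (g \<otimes>\<^bsub>G\<^esub> h) z"
    and one: "\<And>z. z \<in> {x, y} \<Longrightarrow> \<phi> \<one>\<^bsub>G\<^esub> z = z"
  shows "orbit G \<phi> x = orbit G \<phi> y \<longleftrightarrow> (\<exists>g\<in>carrier G. \<phi> g x = y)"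
proof -
  interpret group G by (rule G)
  show ?thesis
  proof
    assume "orbit G \<phi> x = orbit G \<phi> y"
    moreover have "y \<in> orbit G \<phi> y" using one[of y] one_closed unfolding orbit_def by force
    ultimately have "y \<in> orbit G \<phi> x" by simp
    then show "\<exists>g\<in>carrier G. \<phi> g x = y" by (auto simp: orbit_def)
  next
    assume "\<exists>g\<in>carrier G. \<phi> g x = y"
    then obtain g where g: "g \<in> carrier G" "y = \<phi> g x" by blast
    have "orbit G \<phi> y \<subseteq> orbit G \<phi> x"
      using g act by (fastforce simp: orbit_def)
    moreover have "\<phi> h x \<in> orbit G \<phi> y" if h: "h \<in> carrier G" for h
    proof -
      have "\<phi> (h \<otimes>\<^bsub>G\<^esub> inv\<^bsub>G\<^esub> g) y = \<phi> h x"
        using act[of "h \<otimes>\<^bsub>G\<^esub> inv\<^bsub>G\<^esub> g" g x] g h by (simp add: m_assoc)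
      moreover have "h \<otimes>\<^bsub>G\<^esub> inv\<^bsub>G\<^esub> g \<in> carrier G" using g h by simp
      ultimately show ?thesis unfolding orbit_def by (metis (mono_tags, lifting) mem_Collect_eq)
    qed
    ultimately show "orbit G \<phi> x = orbit G \<phi> y" by (auto simp: orbit_def)
  qed
qed

lemma l_coset_max_torus_eq_iff:
  assumes "k \<in> carrier SU2" "l \<in> carrier SU2"
  shows "k <#\<^bsub>SU2\<^esub> max_torus = l <#\<^bsub>SU2\<^esub> max_torus \<longleftrightarrow> conj_transpose k ** l \<in> max_torus"
proof
  interpret T: subgroup max_torus SU2 by (rule subgroup_max_torus)
  have c: "g <#\<^bsub>SU2\<^esub> max_torus = (\<lambda>t. g ** t) ` max_torus" for g by (auto simp: l_coset_def)
  {
    assume "k <#\<^bsub>SU2\<^esub> max_torus = l <#\<^bsub>SU2\<^esub> max_torus"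
    moreover have "l ** mat 1 \<in> l <#\<^bsub>SU2\<^esub> max_torus" unfolding c using T.one_closed by (intro imageI) simp
    ultimately obtain t where "t \<in> max_torus" "l = k ** t" unfolding c by auto
    then show "conj_transpose k ** l \<in> max_torus" by (simp add: SU2_cancel[OF assms(1)])
  next
    assume m: "conj_transpose k ** l \<in> max_torus"
    define t where "t = conj_transpose k ** l"
    have l: "l = k ** t" by (simp add: t_def SU2_cancel[OF assms(1)])
    have t: "t \<in> max_torus" using m by (simp add: t_def)
    have t': "conj_transpose t \<in> max_torus"
      using T.m_inv_closed[OF t] SU2_inv[OF max_torus_SU2[OF t]] by simp
    have 1: "k ** s = l ** (conj_transpose t ** s)" for s :: "complex^2^2"
      by (simp add: l SU2_cancel[OF max_torus_SU2[OF t]] flip: matrix_mul_assoc)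
    have 2: "l ** s = k ** (t ** s)" for s :: "complex^2^2" by (simp add: l matrix_mul_assoc)
    show "k <#\<^bsub>SU2\<^esub> max_torus = l <#\<^bsub>SU2\<^esub> max_torus"
      unfolding c
    proof (intro subset_antisym image_subsetI)
      fix s assume s: "s \<in> max_torus"
      show "k ** s \<in> (**) l ` max_torus"
        using 1 T.m_closed[OF t' s] by (intro image_eqI[of _ _ "conj_transpose t ** s"]) auto
      show "l ** s \<in> (**) k ` max_torus"
        using 2 T.m_closed[OF t s] by (intro image_eqI[of _ _ "t ** s"]) auto
    qed
  }
qed

section \<open>Spaces with an action of SU(2)\<close>

lemma bounded_bilinear_matrix_vector_mult:
  "bounded_bilinear ((*v) :: complex^2^2 \<Rightarrow> complex^2 \<Rightarrow> complex^2)"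
proof -
  have "bilinear ((*v) :: complex^2^2 \<Rightarrow> complex^2 \<Rightarrow> complex^2)"
    unfolding bilinear_def
    by (auto intro!: linearI simp: matrix_vector_mult_def vec_eq_iff sum_2 algebra_simps)
  then show ?thesis by (simp add: bilinear_conv_bounded_bilinear)
qed

lemma continuous_map_bounded_bilinear:
  assumes "bounded_bilinear b" "continuous_map Z euclidean f" "continuous_map Z euclidean g"
  shows "continuous_map Z euclidean (\<lambda>z. b (f z) (g z))"
  using assms by (simp add: continuous_map_atin bounded_bilinear.tendsto)

lemma continuous_map_bounded_linear:
  assumes "bounded_linear b" "continuous_map Z euclidean f"
  shows "continuous_map Z euclidean (\<lambda>z. b (f z))"
  using assms by (simp add: continuous_map_atin bounded_linear.tendsto)

lemmas continuous_map_matrix_intros =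
  continuous_map_bounded_bilinear[OF matrix_mult.bounded_bilinear_axioms]
  continuous_map_bounded_linear[OF bounded_linear_conj_transpose]

lemma continuous_map_SU2_top:
  "continuous_map Z SU2_top f \<longleftrightarrow> continuous_map Z euclidean f \<and> f \<in> topspace Z \<rightarrow> carrier SU2"
  by (simp add: SU2_top_def continuous_map_in_subtopology)

lemma continuous_map_SU2_top_conj_transpose:
  "continuous_map Z SU2_top f \<Longrightarrow> continuous_map Z SU2_top (\<lambda>z. conj_transpose (f z))"
  by (auto simp: continuous_map_SU2_top intro!: continuous_map_matrix_intros SU2_conj_transpose_closed)

lemma continuous_map_SU2_top_mult:
  "continuous_map Z SU2_top f \<Longrightarrow> continuous_map Z SU2_top g \<Longrightarrow> continuous_map Z SU2_top (\<lambda>z. f z ** g z)"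
  by (auto simp: continuous_map_SU2_top intro!: continuous_map_matrix_intros SU2_mult_closed)

lemma compact_space_SU2_top: "compact_space SU2_top"
proof -
  have "closed (carrier SU2)"
  proof -
    have "closed {A :: complex^2^2. A ** conj_transpose A = mat 1}"
      by (intro closed_Collect_eq matrix_mult.continuous_on continuous_on_id continuous_on_const
          bounded_linear.continuous_on[OF bounded_linear_conj_transpose])
    moreover have "closed {A :: complex^2^2. det A = 1}"
      unfolding det_2 by (intro closed_Collect_eq continuous_intros)
    moreover have "carrier SU2 = {A. A ** conj_transpose A = mat 1} \<inter> {A. det A = 1}"
      by (auto simp: SU2_def)
    ultimately show ?thesis by (simp add: closed_Int)
  qed
  moreover have "bounded (carrier SU2)" using norm_SU2_le by (auto simp: bounded_iff)
  ultimately have "compact (carrier SU2)" by (simp add: compact_eq_bounded_closed)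
  then show ?thesis by (simp add: SU2_top_def compact_space_subtopology)
qed

text \<open>Compactness is wanted to make the map from SU(2) x X_n^r perfect.\<close>

lemma compact_space_X_space:
  assumes "closed C"
  shows "compact_space (X_space n C)"
proof -
  let ?P = "product_topology (\<lambda>_. SU2_top) {0..n}"
  have sq: "continuous_map ?P SU2_top (\<lambda>x. sq_prod x m)" if "m \<le> Suc n" for m
    using that
  proof (induction m)
    case 0
    then show ?case by (simp add: SU2_one_closed)
  next
    case (Suc m)
    then show ?case
      unfolding sq_prod.simps
      by (intro continuous_map_SU2_top_mult continuous_map_product_projection) auto
  qed
  have "closedin ?P {x \<in> topspace ?P. square_word n x \<in> C}"
    unfolding square_word_eq
    by (rule closedin_continuous_map_preimage[OF continuous_map_SU2_top_euclidean[OF sq[OF order_refl]]])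
      (simp add: assms)
  moreover have "compact_space ?P" by (simp add: compact_space_product_topology compact_space_SU2_top)
  ultimately have "compactin ?P {x \<in> topspace ?P. square_word n x \<in> C}"
    by (intro closedin_compact_space)
  also have "{x \<in> topspace ?P. square_word n x \<in> C} = topspace ?P \<inter> {x. square_word n x \<in> C}"
    by blast
  finally have "compactin ?P (topspace ?P \<inter> {x. square_word n x \<in> C})" .
  from compact_space_subtopology[OF this] show ?thesis
    by (simp only: X_space_def subtopology_restrict)
qed

lemma Hausdorff_space_X_space: "Hausdorff_space (X_space n C)"
  unfolding X_space_def SU2_top_def
  by (intro Hausdorff_space_subtopology) (simp add: Hausdorff_space_product_topology Hausdorff_space_subtopology)

section \<open>Simultaneous conjugation as a continuous action\<close>

abbreviation act :: "nat \<Rightarrow> complex^2^2 \<Rightarrow> (nat \<Rightarrow> complex^2^2) \<Rightarrow> nat \<Rightarrow> complex^2^2" where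
  "act n \<equiv> simultaneous_conjugation n"

lemma sq_prod_act:
  assumes "k \<in> carrier SU2"
  shows "sq_prod (act n k x) (Suc n) = k ** sq_prod x (Suc n) ** conj_transpose k"
proof -
  have "sq_prod (act n k x) (Suc n) = sq_prod (\<lambda>i. k ** x i ** conj_transpose k) (Suc n)"
    by (rule sq_prod_cong) (simp add: simultaneous_conjugation_eq[OF assms])
  then show ?thesis by (simp only: sq_prod_conj[OF assms])
qed

lemma act_closed:
  assumes "k \<in> carrier SU2" "x \<in> topspace (X_space n C)"
    "\<And>c. c \<in> C \<Longrightarrow> k ** c ** conj_transpose k \<in> C'"
  shows "act n k x \<in> topspace (X_space n C')"
proof -
  have x: "x \<in> {0..n} \<rightarrow>\<^sub>E carrier SU2" "sq_prod x (Suc n) \<in> C"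
    using assms(2) by (auto simp: topspace_X_space simp del: sq_prod.simps)
  have "act n k x \<in> {0..n} \<rightarrow>\<^sub>E carrier SU2"
    using assms(1) x(1)
    by (auto simp: simultaneous_conjugation_eq intro!: SU2_mult_closed SU2_conj_transpose_closed)
  then show ?thesis
    using x(2) assms(3) by (simp add: topspace_X_space sq_prod_act[OF assms(1)] del: sq_prod.simps)
qed

lemma act_act:
  "k \<in> carrier SU2 \<Longrightarrow> l \<in> carrier SU2 \<Longrightarrow> act n k (act n l x) = act n (k ** l) x"
  by (auto simp: simultaneous_conjugation_eq SU2_mult_closed conj_transpose_mult matrix_mul_assoc fun_eq_iff)

lemma act_one:
  assumes "x \<in> topspace (X_space n C)"
  shows "act n (mat 1) x = x"
proof
  fix i
  have "x \<in> {0..n} \<rightarrow>\<^sub>E carrier SU2" using assms by (simp add: topspace_X_space)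
  from PiE_arb[OF this, of i] show "act n (mat 1) x i = x i"
    by (auto simp: simultaneous_conjugation_eq[OF SU2_one_closed])
qed

lemma continuous_map_act:
  assumes "continuous_map Z SU2_top f" "continuous_map Z (X_space n C) g"
    and "\<And>z. z \<in> topspace Z \<Longrightarrow> act n (f z) (g z) \<in> topspace (X_space n C')"
  shows "continuous_map Z (X_space n C') (\<lambda>z. act n (f z) (g z))"
proof (rule continuous_map_into_X_space)
  fix i assume i: "i \<le> n"
  have f: "continuous_map Z euclidean f" "f \<in> topspace Z \<rightarrow> carrier SU2"
    using assms(1) by (auto simp: continuous_map_SU2_top)
  have "continuous_map Z euclidean (\<lambda>z. g z i)"
    using continuous_map_SU2_top_euclidean[OF continuous_map_compose[OF assms(2) continuous_map_X_space_coord[OF i]]]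
    by (simp add: o_def)
  then have "continuous_map Z euclidean (\<lambda>z. f z ** g z i ** conj_transpose (f z))"
    by (intro continuous_map_matrix_intros f)
  then show "continuous_map Z euclidean (\<lambda>z. act n (f z) (g z) i)"
    by (rule continuous_map_eq) (use funcset_mem[OF f(2)] i in \<open>simp add: simultaneous_conjugation_eq\<close>)
qed (use assms(3) in auto)

text \<open>As (-1)^n is central, all of SU(2) acts on this fibre and not just T; the untwisting of
  the induced space rests on this.\<close>

lemma Xr_act_closed:
  assumes "k \<in> carrier SU2" "y \<in> topspace (Xr_space n)"
  shows "act n k y \<in> topspace (Xr_space n)"
  using assms(2) unfolding Xr_space_eq
  by (rule act_closed[OF assms(1)])
    (simp add: torus_elt_multiple_pi matrix_mult_simps SU2_cancel[OF assms(1)])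

lemma continuous_map_Xr_act:
  assumes f: "continuous_map Z SU2_top f" and g: "continuous_map Z (Xr_space n) g"
  shows "continuous_map Z (Xr_space n) (\<lambda>z. act n (f z) (g z))"
proof -
  have "act n (f z) (g z) \<in> topspace (Xr_space n)" if "z \<in> topspace Z" for z
    using that continuous_map_funspace[OF f] continuous_map_funspace[OF g] by (auto intro!: Xr_act_closed)
  then show ?thesis
    using continuous_map_act[OF f] g unfolding Xr_space_eq by blast
qed

lemma conj_transpose_max_torus: "t \<in> max_torus \<Longrightarrow> conj_transpose t \<in> max_torus"
  using subgroup.m_inv_closed[OF subgroup_max_torus, of t] SU2_inv[of t] max_torus_SU2 by simp

text \<open>
  With \<open>g\<close> a \<open>T\<close>-equivariant homeomorphism from \<open>X_n^r\<close> to the fibre over \<open>torus_elt a\<close>, the map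
  is \<open>\<Psi> (k, y) = k \<cdot> g (k\<^sup>-\<^sup>1 \<cdot> y)\<close>; it exhibits \<open>X_n(C)\<close> as \<open>G \<times>\<^sub>T X_n^r\<close>, untwisted by \<open>(k, y) \<mapsto> (k, k y)\<close>.
\<close>

lemma induced_space_map:
  assumes a: "sin a \<noteq> 0" and C: "C = {k ** torus_elt a ** conj_transpose k | k. k \<in> carrier SU2}"
  obtains \<Psi> where "perfect_map (prod_topology SU2_top (Xr_space n)) (X_space n C) \<Psi>"
    "\<And>l k y. l \<in> carrier SU2 \<Longrightarrow> k \<in> carrier SU2 \<Longrightarrow> y \<in> topspace (Xr_space n) \<Longrightarrow>
      \<Psi> (l ** k, act n l y) = act n l (\<Psi> (k, y))"
    "\<And>k y k' y'. k \<in> carrier SU2 \<Longrightarrow> y \<in> topspace (Xr_space n) \<Longrightarrow> k' \<in> carrier SU2 \<Longrightarrow> y' \<in> topspace (Xr_space n) \<Longrightarrow>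
      \<Psi> (k, y) = \<Psi> (k', y') \<longleftrightarrow> y = y' \<and> conj_transpose k ** k' \<in> max_torus"
proof -
  let ?Y = "Xr_space n" and ?F = "torus_fibre n a"
  obtain f where f: "homeomorphic_map ?F ?Y f"
    "\<And>t x. t \<in> max_torus \<Longrightarrow> x \<in> topspace ?F \<Longrightarrow> f (act n t x) = act n t (f x)"
    using torus_fibre_equivariant_homeomorphic[OF a, of n] by (auto simp: equivariant_homeomorphic_def)
  obtain g where fg: "homeomorphic_maps ?F ?Y f g" using f(1) homeomorphic_map_maps by blast
  have gc: "continuous_map ?Y ?F g" and g: "\<And>y. y \<in> topspace ?Y \<Longrightarrow> g y \<in> topspace ?F"
    and f_in: "\<And>x. x \<in> topspace ?F \<Longrightarrow> f x \<in> topspace ?Y"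
    and gf: "\<And>x. x \<in> topspace ?F \<Longrightarrow> g (f x) = x" and fg': "\<And>y. y \<in> topspace ?Y \<Longrightarrow> f (g y) = y"
    using fg by (auto simp: homeomorphic_maps_def dest: continuous_map_funspace)
  have F_act: "act n t x \<in> topspace ?F" if "t \<in> max_torus" "x \<in> topspace ?F" for t x
  proof (rule act_closed[OF max_torus_SU2[OF that(1)] that(2)])
    fix c assume "c \<in> {torus_elt a}"
    then show "t ** c ** conj_transpose t \<in> {torus_elt a}"
      using max_torus_commute(1)[OF that(1)] SU2_cancel[OF max_torus_SU2[OF that(1)]]
      by (simp flip: matrix_mul_assoc)
  qed
  have g_equiv: "g (act n t y) = act n t (g y)" if "t \<in> max_torus" "y \<in> topspace ?Y" for t y
    using f(2)[OF that(1) g[OF that(2)]] gf[OF F_act[OF that(1) g[OF that(2)]]] fg'[OF that(2)] by simp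
  define \<Psi> where "\<Psi> z = act n (fst z) (g (act n (conj_transpose (fst z)) (snd z)))" for z
  have ct: "conj_transpose k \<in> carrier SU2" if "k \<in> carrier SU2" for k
    using that by (rule SU2_conj_transpose_closed)
  have gy: "g (act n (conj_transpose k) y) \<in> topspace ?F" if "k \<in> carrier SU2" "y \<in> topspace ?Y" for k y
    by (intro g Xr_act_closed ct that)
  have \<Psi>_in: "\<Psi> (k, y) \<in> topspace (X_space n C)" if "k \<in> carrier SU2" "y \<in> topspace ?Y" for k y
    unfolding \<Psi>_def using gy[OF that] that(1) C by (auto intro!: act_closed[of _ _ _ "{torus_elt a}"])
  have cont: "continuous_map (prod_topology SU2_top ?Y) (X_space n C) \<Psi>"
  proof -
    let ?Z = "prod_topology SU2_top ?Y"
    have inner: "continuous_map ?Z ?Y (\<lambda>z. act n (conj_transpose (fst z)) (snd z))"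
      by (intro continuous_map_Xr_act continuous_map_SU2_top_conj_transpose continuous_map_fst continuous_map_snd)
    have "continuous_map ?Z ?F (\<lambda>z. g (act n (conj_transpose (fst z)) (snd z)))"
      using continuous_map_compose[OF inner gc] by (simp add: o_def)
    then show ?thesis
      unfolding \<Psi>_def
      by (rule continuous_map_act[OF continuous_map_fst])
        (use \<Psi>_in in \<open>auto simp: \<Psi>_def\<close>)
  qed
  have surj: "\<Psi> ` topspace (prod_topology SU2_top ?Y) = topspace (X_space n C)"
  proof (intro subset_antisym subsetI)
    fix x assume x: "x \<in> topspace (X_space n C)"
    then have "sq_prod x (Suc n) \<in> C" by (simp add: topspace_X_space del: sq_prod.simps)
    \<comment> \<open>Conjugating \<open>x\<close> back by \<open>k\<close> puts its product of
      squares at \<open>torus_elt a\<close>, hence \<open>x\<close> into the domain of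
      \<open>f\<close>.\<close>
    then obtain k where k: "k \<in> carrier SU2" "sq_prod x (Suc n) = k ** torus_elt a ** conj_transpose k"
      using C by blast
    let ?x = "act n (conj_transpose k) x"
    have "x \<in> topspace (X_space n {k ** torus_elt a ** conj_transpose k})"
      using x k(2) by (simp add: topspace_X_space del: sq_prod.simps)
    then have x': "?x \<in> topspace ?F"
      by (rule act_closed[OF ct[OF k(1)]])
        (simp add: SU2_cancel[OF k(1)] flip: matrix_mul_assoc)
    have "\<Psi> (k, act n k (f ?x)) = act n k (g (f ?x))"
      using act_act[OF ct[OF k(1)] k(1)] SU2_cancel(2)[OF k(1)] act_one[OF f_in[OF x', unfolded Xr_space_eq]]
      by (simp add: \<Psi>_def)
    also have "\<dots> = x"
      using gf[OF x'] act_act[OF k(1) ct[OF k(1)]] SU2_cancel(1)[OF k(1)] act_one[OF x] by simp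
    finally show "x \<in> \<Psi> ` topspace (prod_topology SU2_top ?Y)"
      using k(1) Xr_act_closed[OF k(1) f_in[OF x']] by (intro image_eqI[of _ _ "(k, act n k (f ?x))"]) auto
  qed (use \<Psi>_in in auto)
  \<comment> \<open>A continuous map from a compact space to a Hausdorff space is proper.\<close>
  have "compact_space (prod_topology SU2_top ?Y)"
    by (simp add: compact_space_prod_topology compact_space_SU2_top compact_space_X_space Xr_space_eq)
  then have perfect: "perfect_map (prod_topology SU2_top ?Y) (X_space n C) \<Psi>"
    unfolding perfect_map_def
    using cont surj continuous_imp_proper_map Hausdorff_space_X_space Hausdorff_imp_kc_space by blast
  have equiv: "\<Psi> (l ** k, act n l y) = act n l (\<Psi> (k, y))"
    if "l \<in> carrier SU2" "k \<in> carrier SU2" "y \<in> topspace ?Y" for l k y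
  proof -
    \<comment> \<open>Since (l k)^-1 l = k^-1, the argument of \<open>g\<close> is unchanged and
      only the outer conjugation picks up \<open>l\<close>.\<close>
    have "act n (conj_transpose (l ** k)) (act n l y) = act n (conj_transpose k) y"
      using that by (simp add: act_act ct SU2_mult_closed conj_transpose_mult SU2_cancel flip: matrix_mul_assoc)
    then show ?thesis using that by (simp add: \<Psi>_def act_act SU2_mult_closed)
  qed
  have fib: "\<Psi> (k, y) = \<Psi> (k', y') \<longleftrightarrow> y = y' \<and> conj_transpose k ** k' \<in> max_torus"
    if k: "k \<in> carrier SU2" and y: "y \<in> topspace ?Y" and k': "k' \<in> carrier SU2" and y': "y' \<in> topspace ?Y"
    for k y k' y'
  proof
    define m where "m = conj_transpose k ** k'"
    have m: "m \<in> carrier SU2" using k k' by (simp add: m_def SU2_mult_closed ct)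
    have k'_eq: "k' = k ** m" by (simp add: m_def SU2_cancel[OF k])
    have ctk': "act n m (act n (conj_transpose k') z) = act n (conj_transpose k) z" for z
      using k k' m by (simp add: act_act ct m_def SU2_cancel flip: matrix_mul_assoc)
    {
      assume eq: "\<Psi> (k, y) = \<Psi> (k', y')"
      \<comment> \<open>Comparing products of squares shows that \<open>m\<close> centralizes
        \<open>torus_elt a\<close> and so lies in T. Equivariance of \<open>g\<close> then moves
        \<open>m\<close> inside, and injectivity of \<open>g\<close> gives y = y'.\<close>
      have "sq_prod (g (act n (conj_transpose k) y)) (Suc n) = torus_elt a"
        "sq_prod (g (act n (conj_transpose k') y')) (Suc n) = torus_elt a"
        using gy[OF k y] gy[OF k' y'] by (simp_all add: topspace_X_space del: sq_prod.simps)
      then have "k ** torus_elt a ** conj_transpose k = k' ** torus_elt a ** conj_transpose k'"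
        using arg_cong[OF eq, of "\<lambda>x. sq_prod x (Suc n)"] k k' by (simp add: \<Psi>_def sq_prod_act del: sq_prod.simps)
      then have "conj_transpose k ** (k ** torus_elt a ** conj_transpose k) ** k'
          = conj_transpose k ** (k' ** torus_elt a ** conj_transpose k') ** k'" by simp
      then have "m ** torus_elt a = torus_elt a ** m"
        by (simp add: m_def SU2_cancel[OF k] SU2_cancel[OF k'] flip: matrix_mul_assoc)
      then have mT: "m \<in> max_torus" using commute_torus_elt_imp_max_torus[OF m _ a] by simp
      have "act n (conj_transpose k) (\<Psi> (k, y)) = g (act n (conj_transpose k) y)"
        using act_act[OF ct[OF k] k] act_one[OF gy[OF k y]] by (simp add: \<Psi>_def SU2_cancel[OF k])
      moreover have "act n (conj_transpose k) (\<Psi> (k', y')) = act n m (g (act n (conj_transpose k') y'))"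
        using act_act[OF ct[OF k] k'] by (simp add: \<Psi>_def m_def)
      moreover have "\<dots> = g (act n (conj_transpose k) y')"
        using g_equiv[OF mT Xr_act_closed[OF ct[OF k'] y']] by (simp add: ctk')
      ultimately have "g (act n (conj_transpose k) y) = g (act n (conj_transpose k) y')" using eq by simp
      then have "act n (conj_transpose k) y = act n (conj_transpose k) y'"
        using fg' Xr_act_closed[OF ct[OF k]] y y' by metis
      then have "act n k (act n (conj_transpose k) y) = act n k (act n (conj_transpose k) y')" by simp
      then have "y = y'"
        using act_one[of _ n] y y' by (simp add: act_act k ct SU2_cancel[OF k] Xr_space_eq)
      then show "y = y' \<and> conj_transpose k ** k' \<in> max_torus" using mT by (simp add: m_def)
    next
      assume "y = y' \<and> conj_transpose k ** k' \<in> max_torus"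
      then have y_eq: "y' = y" and mT: "m \<in> max_torus" by (auto simp: m_def)
      have "\<Psi> (k', y') = act n k (act n m (g (act n (conj_transpose k') y)))"
        using act_act[OF k m] by (simp add: \<Psi>_def y_eq k'_eq)
      also have "\<dots> = \<Psi> (k, y)"
        using g_equiv[OF mT Xr_act_closed[OF ct[OF k'] y]] by (simp add: ctk' \<Psi>_def)
      finally show "\<Psi> (k, y) = \<Psi> (k', y')" by simp
    }
  qed
  show thesis using that[OF perfect equiv fib] .
qed

text \<open>Every class meets the torus by diagonalization. If sin a were 0, the torus element would
  be 1 or -1, hence central, and the class one of the excluded singletons.\<close>

lemma conjugacy_class_cases:
  assumes "C \<in> conjugacy_classes" "C \<noteq> {mat 1}" "C \<noteq> {- mat 1}"
  obtains a where "sin a \<noteq> 0" "C = {k ** torus_elt a ** conj_transpose k | k. k \<in> carrier SU2}"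
proof -
  obtain c where c: "c \<in> carrier SU2" "C = {conjugation k c | k. k \<in> carrier SU2}"
    using assms(1) by (auto simp: conjugacy_classes_def orbits_def orbit_def)
  have "{conjugation k c | k. k \<in> carrier SU2} = {k ** c ** conj_transpose k | k. k \<in> carrier SU2}"
    by (intro Collect_cong) (metis conjugation_eq)
  with c have c: "c \<in> carrier SU2" "C = {k ** c ** conj_transpose k | k. k \<in> carrier SU2}" by simp_all
  obtain g a where g: "g \<in> carrier SU2" "c = g ** torus_elt a ** conj_transpose g"
    using SU2_diagonalize[OF c(1)] by blast
  have C: "C = {k ** torus_elt a ** conj_transpose k | k. k \<in> carrier SU2}"
  proof (intro subset_antisym subsetI)
    fix x assume "x \<in> C"
    then obtain k where k: "k \<in> carrier SU2" "x = k ** c ** conj_transpose k" using c(2) by blast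
    then have "x = (k ** g) ** torus_elt a ** conj_transpose (k ** g)"
      by (simp add: g(2) conj_transpose_mult matrix_mul_assoc)
    then show "x \<in> {k ** torus_elt a ** conj_transpose k | k. k \<in> carrier SU2}"
      using SU2_mult_closed[OF k(1) g(1)] by blast
  next
    fix x assume "x \<in> {k ** torus_elt a ** conj_transpose k | k. k \<in> carrier SU2}"
    then obtain k where k: "k \<in> carrier SU2" "x = k ** torus_elt a ** conj_transpose k" by blast
    then have "x = (k ** conj_transpose g) ** c ** conj_transpose (k ** conj_transpose g)"
      by (simp add: g(2) conj_transpose_mult SU2_cancel[OF g(1)] flip: matrix_mul_assoc)
    then show "x \<in> C"
      using SU2_mult_closed[OF k(1) SU2_conj_transpose_closed[OF g(1)]] c(2) by blast
  qed
  have "sin a \<noteq> 0"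
  proof
    assume "sin a = 0"
    then have "torus_elt a = cos a *\<^sub>R mat 1" by (simp add: torus_elt_eq_cos_sin)
    then have "C = {cos a *\<^sub>R mat 1}"
      unfolding C using SU2_one_closed
      by (auto simp: matrix_mult_simps SU2_cancel intro!: exI[of _ "mat 1"])
    moreover have "cos a = 1 \<or> cos a = -1"
      using sin_cos_squared_add[of a] \<open>sin a = 0\<close> by (simp add: power2_eq_1_iff)
    ultimately show False using assms(2,3) by auto
  qed
  then show thesis using C by (rule that)
qed

lemma group_torus: "group torus_group"
  by (rule subgroup.subgroup_is_group[OF subgroup_max_torus group_SU2])

section \<open>Continuity of the action on the infinite sphere\<close>

lemma EG_action_mult: "EG_action g (EG_action h v) = EG_action (g ** h) v"
  by (simp add: EG_action_def matrix_vector_mul_assoc)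

lemma EG_action_one: "EG_action (mat 1) v = v"
  by (simp add: EG_action_def)

lemma topspace_EG [simp]: "topspace EG = EG_set"
  by (simp add: EG_def)

lemma continuous_map_euclidean_coordinatewise:
  "continuous_map Z (euclidean :: ('a \<Rightarrow> 'b::topological_space) topology) f \<longleftrightarrow>
     (\<forall>i. continuous_map Z euclidean (\<lambda>z. f z i))"
  unfolding euclidean_product_topology[symmetric] by (rule continuous_map_componentwise_UNIV)

lemma continuous_map_EG_action:
  assumes f: "continuous_map Z SU2_top f" and v: "continuous_map Z EG v"
  shows "continuous_map Z EG (\<lambda>z. EG_action (f z) (v z))"
proof -
  have f': "continuous_map Z euclidean f" "\<And>z. z \<in> topspace Z \<Longrightarrow> f z \<in> carrier SU2"
    using f by (auto simp: continuous_map_SU2_top)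
  have v': "continuous_map Z euclidean v" "\<And>z. z \<in> topspace Z \<Longrightarrow> v z \<in> EG_set"
    using v by (auto simp: EG_def continuous_map_in_subtopology)
  have "continuous_map Z euclidean (\<lambda>z. EG_action (f z) (v z))"
    unfolding EG_action_def continuous_map_euclidean_coordinatewise
  proof
    fix i
    have "continuous_map Z euclidean (\<lambda>z. v z i)"
      using v'(1) by (simp add: continuous_map_euclidean_coordinatewise)
    then show "continuous_map Z euclidean (\<lambda>z. f z *v v z i)"
      by (rule continuous_map_bounded_bilinear[OF bounded_bilinear_matrix_vector_mult f'(1)])
  qed
  then show ?thesis
    using f'(2) v'(2) EG_action_closed by (auto simp: EG_def continuous_map_in_subtopology)
qed

theorem lemma4p2:
  fixes n :: nat and C :: "(complex^2^2) set"
  assumes "C \<in> conjugacy_classes"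
    and "C \<noteq> {mat 1}" and "C \<noteq> {- mat 1}"
  shows "equivariant_homeomorphic SU2
           (X_space n C) (simultaneous_conjugation n)
           (prod_topology G_mod_T (Xr_space n))
           (diag_action left_translation (simultaneous_conjugation n))
       \<and> equivariant_cohomology_isomorphic
           SU2 (X_space n C) (simultaneous_conjugation n)
           torus_group (Xr_space n) (simultaneous_conjugation n)"
proof -
  obtain a where a: "sin a \<noteq> 0" and C: "C = {k ** torus_elt a ** conj_transpose k | k. k \<in> carrier SU2}"
    using conjugacy_class_cases[OF assms] by blast
  let ?X = "X_space n C" and ?Y = "Xr_space n"
  obtain \<Psi> where \<Psi>: "perfect_map (prod_topology SU2_top ?Y) ?X \<Psi>"
    and equiv: "\<And>l k y. l \<in> carrier SU2 \<Longrightarrow> k \<in> carrier SU2 \<Longrightarrow> y \<in> topspace ?Y \<Longrightarrow>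
      \<Psi> (l ** k, act n l y) = act n l (\<Psi> (k, y))"
    and fib: "\<And>k y k' y'. k \<in> carrier SU2 \<Longrightarrow> y \<in> topspace ?Y \<Longrightarrow> k' \<in> carrier SU2 \<Longrightarrow> y' \<in> topspace ?Y \<Longrightarrow>
      \<Psi> (k, y) = \<Psi> (k', y') \<longleftrightarrow> y = y' \<and> conj_transpose k ** k' \<in> max_torus"
    using induced_space_map[OF a C, of n] by metis
  note ct = SU2_conj_transpose_closed
  have \<Psi>_in: "\<Psi> (k, y) \<in> topspace ?X" if "k \<in> carrier SU2" "y \<in> topspace ?Y" for k y
    using \<Psi> that by (auto simp: perfect_map_def)
  have \<Psi>_surj: "\<exists>k\<in>carrier SU2. \<exists>y\<in>topspace ?Y. x = \<Psi> (k, y)" if "x \<in> topspace ?X" for x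
  proof -
    have "x \<in> \<Psi> ` topspace (prod_topology SU2_top ?Y)" using \<Psi> that by (simp add: perfect_map_def)
    then show ?thesis by auto
  qed
  have Y_one: "act n (mat 1) y = y" if "y \<in> topspace ?Y" for y
    using act_one that unfolding Xr_space_eq by blast

  have "equivariant_homeomorphic SU2 ?X (act n) (prod_topology G_mod_T ?Y) (diag_action left_translation (act n))"
  proof -
    let ?q = "\<lambda>(k, y). (k <#\<^bsub>SU2\<^esub> max_torus, y :: nat \<Rightarrow> complex^2^2)"
    \<comment> \<open>Local compactness of the second factor keeps the product of the coset map with
      the identity a quotient map.\<close>
    have "locally_compact_space ?Y" "Hausdorff_space ?Y"
      by (auto simp: Xr_space_eq compact_space_X_space Hausdorff_space_X_space
          intro!: compact_imp_locally_compact_space)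
    then have q: "quotient_map (prod_topology SU2_top ?Y) (prod_topology G_mod_T ?Y) ?q"
      unfolding G_mod_T_def by (intro quotient_map_prod_left quotient_map_quotient_topology) auto
    have q_fib: "\<Psi> z = \<Psi> z' \<longleftrightarrow> ?q z = ?q z'"
      if "z \<in> topspace (prod_topology SU2_top ?Y)" "z' \<in> topspace (prod_topology SU2_top ?Y)" for z z'
      using that by (cases z; cases z') (simp add: fib l_coset_max_torus_eq_iff conj_commute)
    obtain \<theta> where \<theta>: "homeomorphic_map ?X (prod_topology G_mod_T ?Y) \<theta>"
      "\<And>z. z \<in> topspace (prod_topology SU2_top ?Y) \<Longrightarrow> \<theta> (\<Psi> z) = ?q z"
      by (rule quotient_maps_same_fibres[OF perfect_imp_quotient_map[OF \<Psi>] q q_fib]) blast+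
    have "\<theta> (act n l x) = diag_action left_translation (act n) l (\<theta> x)"
      if l: "l \<in> carrier SU2" and x: "x \<in> topspace ?X" for l x
    proof -
      obtain k y where k: "k \<in> carrier SU2" and y: "y \<in> topspace ?Y" and "x = \<Psi> (k, y)"
        using \<Psi>_surj[OF x] by blast
      then have "\<theta> (act n l x) = ?q (l ** k, act n l y)"
        using \<theta>(2)[of "(l ** k, act n l y)"] Xr_act_closed[OF l y] SU2_mult_closed[OF l k] by (simp add: equiv l)
      also have "\<dots> = diag_action left_translation (act n) l (?q (k, y))"
        using SU2.lcos_m_assoc[OF _ l k, of max_torus] max_torus_SU2
        by (auto simp: diag_action_def left_translation_def)
      also have "?q (k, y) = \<theta> x" using \<theta>(2)[of "(k, y)"] k y \<open>x = \<Psi> (k, y)\<close> by simp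
      finally show ?thesis .
    qed
    then show ?thesis using \<theta>(1) by (auto simp: equivariant_homeomorphic_def)
  qed
  moreover have "borel_construction SU2 ?X (act n) homeomorphic_space borel_construction torus_group ?Y (act n)"
  proof -
    let ?Z = "prod_topology EG (prod_topology SU2_top ?Y)"
    let ?G = "diag_action EG_action (act n)"
    define p where "p = (\<lambda>z. orbit SU2 ?G (fst z, \<Psi> (snd z)))"
    \<comment> \<open>Moving the point by k^-1 brings its group coordinate to 1; the freedom that
      remains is T, as in EG x_G (G/T x Y) = EG x_T Y.\<close>
    define r where "r z = ?G (conj_transpose (fst (snd z))) (fst z, snd (snd z))"
      for z :: "(nat \<Rightarrow> complex^2) \<times> (complex^2^2) \<times> (nat \<Rightarrow> complex^2^2)"
    \<comment> \<open>Properness passes to the product with the identity of \<open>EG\<close>, where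
      the quotient property alone would not suffice.\<close>
    have "perfect_map ?Z (prod_topology EG ?X) (\<lambda>(v, w). (v, \<Psi> w))"
    proof -
      have "proper_map ?Z (prod_topology EG ?X) (\<lambda>(v, w). (v, \<Psi> w))"
        using \<Psi> proper_map_id[of EG] by (simp add: proper_map_prod perfect_map_def id_def)
      moreover have "continuous_map ?Z (prod_topology EG ?X) (\<lambda>(v, w). (v, \<Psi> w))"
        using \<Psi> by (simp add: continuous_map_prod_top perfect_map_def)
      moreover have "(\<lambda>(v, w). (v, \<Psi> w)) ` topspace ?Z = topspace (prod_topology EG ?X)"
        using \<Psi>_surj \<Psi>_in by (force simp: image_iff)
      ultimately show ?thesis by (simp add: perfect_map_def)
    qed
    from quotient_map_compose[OF perfect_imp_quotient_map[OF this] quotient_map_quotient_topology]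
    have p: "quotient_map ?Z (borel_construction SU2 ?X (act n)) p"
      by (simp add: borel_construction_def p_def o_def case_prod_beta)
    have r_in: "r z \<in> topspace (prod_topology EG ?Y)" if "z \<in> topspace ?Z" for z
      using that by (auto simp: r_def diag_action_def intro!: EG_action_closed Xr_act_closed ct)
    have r_cont: "continuous_map ?Z (prod_topology EG ?Y) r"
    proof -
      have k: "continuous_map ?Z SU2_top (\<lambda>z. conj_transpose (fst (snd z)))"
        using continuous_map_compose[OF continuous_map_snd continuous_map_fst, of EG SU2_top ?Y]
        by (intro continuous_map_SU2_top_conj_transpose) (simp add: o_def)
      have y: "continuous_map ?Z ?Y (\<lambda>z. snd (snd z))"
        using continuous_map_compose[OF continuous_map_snd continuous_map_snd, of EG SU2_top ?Y]
        by (simp add: o_def)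
      have "continuous_map ?Z EG (\<lambda>z. EG_action (conj_transpose (fst (snd z))) (fst z))"
        by (intro continuous_map_EG_action k continuous_map_fst)
      moreover have "continuous_map ?Z ?Y (\<lambda>z. act n (conj_transpose (fst (snd z))) (snd (snd z)))"
        by (rule continuous_map_Xr_act[OF k y])
      ultimately show ?thesis
        unfolding r_def diag_action_def by (simp add: continuous_map_pairedI)
    qed
    have "quotient_map ?Z (prod_topology EG ?Y) r"
    proof -
      \<comment> \<open>The map \<open>?s\<close> inserts the group coordinate 1 and is a continuous
        section of \<open>r\<close>, which makes \<open>r\<close> a quotient map.\<close>
      let ?W = "prod_topology EG ?Y" and ?s = "\<lambda>z. (fst z, (mat 1, snd z))"
      have s: "continuous_map ?W ?Z ?s"
        by (intro continuous_map_pairedI continuous_map_fst continuous_map_snd) (simp add: SU2_one_closed)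
      have "z = (r \<circ> ?s) z" if "z \<in> topspace ?W" for z
        using that Y_one by (auto simp: r_def diag_action_def EG_action_one)
      moreover have "quotient_map ?W ?W (\<lambda>z. z)"
        using homeomorphic_map_id[of ?W ?W] by (simp add: homeomorphic_map_def id_def)
      ultimately have "quotient_map ?W ?W (r \<circ> ?s)" by (rule quotient_map_eq[rotated])
      then show ?thesis by (rule quotient_map_from_composition[OF s r_cont])
    qed
    from quotient_map_compose[OF this quotient_map_quotient_topology]
    have q: "quotient_map ?Z (borel_construction torus_group ?Y (act n)) (orbit torus_group ?G \<circ> r)"
      by (simp add: borel_construction_def)
    have fibres: "p z = p z' \<longleftrightarrow> (orbit torus_group ?G \<circ> r) z = (orbit torus_group ?G \<circ> r) z'"
      if z: "z \<in> topspace ?Z" and z': "z' \<in> topspace ?Z" for z z'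
    proof -
      obtain v k y where zv: "z = (v, (k, y))" by (metis prod.exhaust)
      obtain v' k' y' where zv': "z' = (v', (k', y'))" by (metis prod.exhaust)
      have k: "k \<in> carrier SU2" "k' \<in> carrier SU2" and y: "y \<in> topspace ?Y" "y' \<in> topspace ?Y"
        using z z' by (auto simp: zv zv')
      have X1: "act n (mat 1) (\<Psi> (k, y)) = \<Psi> (k, y)" "act n (mat 1) (\<Psi> (k', y')) = \<Psi> (k', y')"
        using act_one \<Psi>_in k y by blast+
      have ctY: "act n (conj_transpose l) w \<in> topspace ?Y" if "l \<in> carrier SU2" "w \<in> topspace ?Y" for l w
        by (intro Xr_act_closed ct that)
      have "p z = p z' \<longleftrightarrow> (\<exists>l\<in>carrier SU2. ?G l (v, \<Psi> (k, y)) = (v', \<Psi> (k', y')))"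
        unfolding p_def zv zv' fst_conv snd_conv
        by (rule orbit_eq_iff[OF group_SU2])
          (auto simp: diag_action_def EG_action_mult act_act EG_action_one X1)
      also have "\<dots> \<longleftrightarrow> (\<exists>l\<in>carrier SU2. v' = EG_action l v \<and> y' = act n l y \<and>
          conj_transpose (l ** k) ** k' \<in> max_torus)"
      proof (rule bex_cong[OF refl])
        fix l assume l: "l \<in> carrier SU2"
        show "?G l (v, \<Psi> (k, y)) = (v', \<Psi> (k', y')) \<longleftrightarrow> v' = EG_action l v \<and> y' = act n l y \<and>
          conj_transpose (l ** k) ** k' \<in> max_torus"
          using fib[OF SU2_mult_closed[OF l k(1)] Xr_act_closed[OF l y(1)] k(2) y(2)]
          by (auto simp: diag_action_def equiv[OF l k(1) y(1)])
      qed
      also have "\<dots> \<longleftrightarrow> (\<exists>t\<in>max_torus. ?G t (r z) = r z')"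
      proof
        assume "\<exists>l\<in>carrier SU2. v' = EG_action l v \<and> y' = act n l y \<and> conj_transpose (l ** k) ** k' \<in> max_torus"
        then obtain l where l: "l \<in> carrier SU2" "v' = EG_action l v" "y' = act n l y"
          "conj_transpose (l ** k) ** k' \<in> max_torus" by blast
        \<comment> \<open>If \<open>l\<close> matches the G-orbits, then k'^-1 l k lies in T and
          matches the T-orbits; in the other direction \<open>l\<close> is recovered as k' t
          k^-1.\<close>
        have "conj_transpose (conj_transpose (l ** k) ** k') = conj_transpose k' ** (l ** k)"
          by (simp add: conj_transpose_mult)
        then have t: "conj_transpose k' ** (l ** k) \<in> max_torus"
          using conj_transpose_max_torus[OF l(4)] by simp
        have "(conj_transpose k' ** (l ** k)) ** conj_transpose k = conj_transpose k' ** l"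
          by (simp add: SU2_cancel[OF k(1)] flip: matrix_mul_assoc)
        then have "?G (conj_transpose k' ** (l ** k)) (r z) = r z'"
          using k l(1) max_torus_SU2[OF t]
          by (simp add: r_def zv zv' diag_action_def EG_action_mult act_act ct l(2,3))
        then show "\<exists>t\<in>max_torus. ?G t (r z) = r z'" using t by blast
      next
        assume "\<exists>t\<in>max_torus. ?G t (r z) = r z'"
        then obtain t where t: "t \<in> max_torus" "?G t (r z) = r z'" by blast
        have t': "t \<in> carrier SU2" by (rule max_torus_SU2[OF t(1)])
        let ?l = "k' ** (t ** conj_transpose k)"
        have l: "?l \<in> carrier SU2" by (intro SU2_mult_closed ct k t')
        have "?G k' (?G t (r z)) = ?G k' (r z')" by (simp add: t(2))
        then have "(EG_action ?l v, act n ?l y) = (v', y')"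
          using k t' Y_one[OF y(2)]
          by (simp add: r_def zv zv' diag_action_def EG_action_mult act_act ct SU2_mult_closed SU2_cancel
              EG_action_one)
        moreover have "conj_transpose (?l ** k) ** k' = conj_transpose t"
          by (simp add: conj_transpose_mult SU2_cancel[OF k(1)] SU2_cancel[OF k(2)] flip: matrix_mul_assoc)
        ultimately show "\<exists>l\<in>carrier SU2. v' = EG_action l v \<and> y' = act n l y \<and> conj_transpose (l ** k) ** k' \<in> max_torus"
          using l conj_transpose_max_torus[OF t(1)] by (intro bexI[of _ ?l]) auto
      qed
      also have "\<dots> \<longleftrightarrow> (\<exists>t\<in>carrier torus_group. ?G t (r z) = r z')" by simp
      also have "\<dots> \<longleftrightarrow> (orbit torus_group ?G \<circ> r) z = (orbit torus_group ?G \<circ> r) z'"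
        unfolding o_def
        by (rule orbit_eq_iff[OF group_torus, symmetric])
          (use k y ctY in \<open>auto simp: r_def zv zv' diag_action_def EG_action_mult act_act EG_action_one
            max_torus_SU2 Y_one\<close>)
      finally show ?thesis .
    qed
    show ?thesis
      by (rule quotient_maps_same_fibres[OF p q fibres]) (blast intro: homeomorphic_map_imp_homeomorphic_space)+
  qed
  ultimately show ?thesis
    by (simp add: equivariant_cohomology_isomorphic_def homeomorphic_imp_cohomology_isomorphic)
qed

end
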